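(* Consider smooth functions $\phi_1,\phi_2,\psi_1,\psi_2:\mathcal{A}\to\mathcal{A}$ and $p,q:\mathcal{A}\to\mathbb{R}$ such that $$\partial_a\phi_\alpha=-p\,\psi_\alpha,\qquad \partial_{\widehat a}\psi_\alpha=-q\,\phi_\alpha,\qquad \alpha=1,2,$$ and $|\psi_2\phi_1-\psi_1\phi_2|^2\neq 0$. The formulas $$F_0+F_1=-\int_\gamma\left(\psi_1\widehat{\phi}_1\,da+\widehat{\psi}_1\phi_1\,d\widehat a\right),\qquad F_0-F_1=\int_\gamma\left(\psi_2\widehat{\phi}_2\,da+\widehat{\psi}_2\phi_2\,d\widehat a\right),$$ $$F_2+\sigma F_3=\int_\gamma\left(\psi_1\widehat{\phi}_2\,da+\widehat{\psi}_2\phi_1\,d\widehat a\right),\qquad F_2-\sigma F_3=\int_\gamma\left(\psi_2\widehat{\phi}_1\,da+\widehat{\psi}_1\phi_2\,d\widehat a\right),$$ where $\gamma$ is an arbitrary path between a fixed point and a variable point in $\mathcal{A}$, define the conformal immersion of a Lorentz surface into $\mathbb{R}^{2,2}$ $$F=(F_0,F_1,F_2,F_3):\mathcal{A}\to\mathbb{R}^{2,2}.$$ The induced metric of the Lorentz surface is of the form $$g=-|\psi_2\phi_1-\psi_1\phi_2|^2\,da\,d\widehat a,$$ and the Lorentzian norm of the mean curvature vector $\vec H$ of the immersion is $$|\vec H|^2=\frac{pq}{|\psi_2\phi_1-\psi_1\phi_2|^2}.$$ Conversely, the isometric immersion of a simply-connected Lorentzian surface $(M,g)$ into $\mathbb{R}^{2,2}$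 may be described in that way.
   Context: $\mathbb{R}^{2,2}$ is $\mathbb{R}^4$ with the metric $\langle\cdot,\cdot\rangle=-dx_0^2+dx_1^2-dx_2^2+dx_3^2$. The algebra of Lorentz numbers is $\mathcal{A}=\{u+\sigma v: u,v\in\mathbb{R}\}$, with $\sigma\notin\mathbb{R}$, $\sigma^2=1$. For $a=u+\sigma v$, set $\widehat a=u-\sigma v$ and $|a|^2=a\widehat a$; for an $\mathcal{A}$-valued function $f$, $\widehat f$ is the pointwise conjugate. Further, $\partial_a=\frac12(\partial_u+\sigma\partial_v)$, $\partial_{\widehat a}=\frac12(\partial_u-\sigma\partial_v)$, $da=du+\sigma dv$, $d\widehat a=du-\sigma dv$. A Lorentzian surface is a surface with a metric of signature $(1,1)$. A Lorentz surface is a surface covered by charts into $\mathcal{A}$ whose transition maps are conformal (differential commuting with multiplication by $\sigma$); equivalently, a surface with a conformal class of Lorentzian metrics. The mean curvature vector is $\vec H=\frac12\mathrm{tr}_gB$, where $B$ is the normal-bundle-valued second fundamental form, and $|\vec H|^2=\langle\vec H,\vec H\rangle$.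
   Formalization: The mean curvature formula is corrected to |H|^2 = 4pq/|psi_2 phi_1 - psi_1 phi_2|^2. As M need not be globally conformal to A, the converse says: M is covered by conformal charts onto all of A, and in each such chart the immersion is given by the formulas up to translation. *)

theory Defs
  imports "HOL-Analysis.Analysis"
begin

section \<open>Lorentz numbers\<close>

datatype lorentz = Lorentz (upart: real) (vpart: real)

lemma lorentz_eq_iff: "a = b \<longleftrightarrow> upart a = upart b \<and> vpart a = vpart b"
  by (cases a; cases b) simp

lemma lorentz_eqI [intro?]: "upart a = upart b \<Longrightarrow> vpart a = vpart b \<Longrightarrow> a = b"
  by (simp add: lorentz_eq_iff)

instantiation lorentz :: comm_ring_1
begin

definition "0 = Lorentz 0 0"
definition "1 = Lorentz 1 0"
definition "a + b = Lorentz (upart a + upart b) (vpart a + vpart b)"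
definition "a - b = Lorentz (upart a - upart b) (vpart a - vpart b)"
definition "- a = Lorentz (- upart a) (- vpart a)"
definition "a * b = Lorentz (upart a * upart b + vpart a * vpart b) (upart a * vpart b + vpart a * upart b)"

lemmas lorentz_ring_defs =
  zero_lorentz_def one_lorentz_def plus_lorentz_def minus_lorentz_def
  uminus_lorentz_def times_lorentz_def

instance
  by standard (simp_all add: lorentz_ring_defs algebra_simps)

end

lemma lorentz_sel [simp]:
  "upart 0 = 0" "vpart 0 = 0" "upart 1 = 1" "vpart 1 = 0"
  "upart (a + b) = upart a + upart b" "vpart (a + b) = vpart a + vpart b"
  "upart (a - b) = upart a - upart b" "vpart (a - b) = vpart a - vpart b"
  "upart (- a) = - upart a" "vpart (- a) = - vpart a"
  "upart (a * b) = upart a * upart b + vpart a * vpart b"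
  "vpart (a * b) = upart a * vpart b + vpart a * upart b"
  by (simp_all add: lorentz_ring_defs)

text \<open>The norm is the Euclidean one and only fixes the topology and the smooth structure of the
  plane; it is unrelated to the indefinite form \<open>|a|\<^sup>2\<close>, which is \<open>lsq\<close> below.\<close>

instantiation lorentz :: real_vector
begin

definition "scaleR r a = Lorentz (r * upart a) (r * vpart a)"

instance
  by standard (simp_all add: lorentz_eq_iff scaleR_lorentz_def algebra_simps)

end

lemma lorentz_scaleR_sel [simp]: "upart (r *\<^sub>R a) = r * upart a" "vpart (r *\<^sub>R a) = r * vpart a"
  by (simp_all add: scaleR_lorentz_def)

instantiation lorentz :: real_inner
begin

definition "inner a b = upart a * upart b + vpart a * vpart b"
definition "norm (a::lorentz) = sqrt (inner a a)"
definition "sgn (a::lorentz) = a /\<^sub>R norm a"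
definition "dist a b = norm (a - b :: lorentz)"
definition "(uniformity :: (lorentz \<times> lorentz) filter) =
  (INF e\<in>{0 <..}. principal {(x, y). dist x y < e})"
definition "open (U :: lorentz set) \<longleftrightarrow>
  (\<forall>x\<in>U. eventually (\<lambda>(x', y). x' = x \<longrightarrow> y \<in> U) uniformity)"

instance
proof
  fix a b c :: lorentz and r :: real and U :: "lorentz set"
  show "inner a b = inner b a" "inner (a + b) c = inner a c + inner b c"
    "inner (r *\<^sub>R a) b = r * inner a b" "0 \<le> inner a a"
    by (simp_all add: inner_lorentz_def algebra_simps)
  show "inner a a = 0 \<longleftrightarrow> a = 0"
    by (simp add: inner_lorentz_def lorentz_eq_iff)
qed (rule norm_lorentz_def sgn_lorentz_def dist_lorentz_def uniformity_lorentz_def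
      open_lorentz_def)+

end

instance lorentz :: real_algebra_1
proof
  fix a b :: lorentz and r :: real
  show "r *\<^sub>R a * b = r *\<^sub>R (a * b)" "a * r *\<^sub>R b = r *\<^sub>R (a * b)"
    by (simp_all add: lorentz_eq_iff distrib_left mult_ac)
qed

definition lsigma :: lorentz where "lsigma = Lorentz 0 1"

lemma lsigma_sel [simp]: "upart lsigma = 0" "vpart lsigma = 1"
  by (simp_all add: lsigma_def)

instantiation lorentz :: euclidean_space
begin

definition "Basis = {1, lsigma}"

instance
proof
  fix a b :: lorentz
  show "(Basis :: lorentz set) \<noteq> {}" "finite (Basis :: lorentz set)"
    by (simp_all add: Basis_lorentz_def)
  show "inner a b = (if a = b then 1 else 0)" if "a \<in> Basis" "b \<in> Basis"
    using that by (auto simp: Basis_lorentz_def inner_lorentz_def lorentz_eq_iff)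
  show "(\<forall>b\<in>Basis. inner a b = 0) \<longleftrightarrow> a = 0"
    by (simp add: Basis_lorentz_def inner_lorentz_def lorentz_eq_iff[of a])
qed

end

definition lcnj :: "lorentz \<Rightarrow> lorentz"
  where "lcnj a = Lorentz (upart a) (- vpart a)"

definition lsq :: "lorentz \<Rightarrow> real"
  where "lsq a = upart (a * lcnj a)"

lemma lcnj_sel [simp]: "upart (lcnj a) = upart a" "vpart (lcnj a) = - vpart a"
  by (simp_all add: lcnj_def)

lemma lsigma_squared: "lsigma * lsigma = 1"
  by (simp add: lorentz_eq_iff)

lemma lorentz_decompose: "a = of_real (upart a) + lsigma * of_real (vpart a)"
  by (simp add: lorentz_eq_iff of_real_def)

lemma of_real_lsq: "of_real (lsq a) = a * lcnj a"
  by (simp add: lorentz_eq_iff of_real_def lsq_def)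


section \<open>Calculus on the plane of Lorentz numbers\<close>

abbreviation differential ::
    "('a::real_normed_vector \<Rightarrow> 'b::real_normed_vector) \<Rightarrow> 'a \<Rightarrow> 'a \<Rightarrow> 'b"
  where "differential f z \<equiv> frechet_derivative f (at z)"

text \<open>Used for open subsets of Euclidean spaces only.\<close>

primrec Ck_on :: "nat \<Rightarrow> 'a set \<Rightarrow> ('a::real_normed_vector \<Rightarrow> 'b::real_normed_vector) \<Rightarrow> bool"
  where
    "Ck_on 0 S f \<longleftrightarrow> continuous_on S f"
  | "Ck_on (Suc k) S f \<longleftrightarrow>
       (\<forall>z\<in>S. f differentiable (at z)) \<and> (\<forall>v. Ck_on k S (\<lambda>z. differential f z v))"

definition smooth_on :: "'a set \<Rightarrow> ('a::real_normed_vector \<Rightarrow> 'b::real_normed_vector) \<Rightarrow> bool"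
  where "smooth_on S f \<longleftrightarrow> (\<forall>k. Ck_on k S f)"

definition d_a :: "(lorentz \<Rightarrow> lorentz) \<Rightarrow> lorentz \<Rightarrow> lorentz"
  where "d_a f z = (1/2) *\<^sub>R (differential f z 1 + lsigma * differential f z lsigma)"

definition d_ahat :: "(lorentz \<Rightarrow> lorentz) \<Rightarrow> lorentz \<Rightarrow> lorentz"
  where "d_ahat f z = (1/2) *\<^sub>R (differential f z 1 - lsigma * differential f z lsigma)"

text \<open>\<open>has_path_integral f h \<gamma> I\<close>: the integral of \<open>f da + h d\<widehat>a\<close> along \<open>\<gamma>\<close> is
  \<open>I\<close>; the values of \<open>da\<close> and \<open>d\<widehat>a\<close> on a tangent vector \<open>v\<close> are \<open>v\<close> and its
  conjugate.\<close>

definition has_path_integral ::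
    "(lorentz \<Rightarrow> lorentz) \<Rightarrow> (lorentz \<Rightarrow> lorentz) \<Rightarrow> (real \<Rightarrow> lorentz) \<Rightarrow> lorentz \<Rightarrow> bool"
  where "has_path_integral f h \<gamma> I \<longleftrightarrow>
    ((\<lambda>t. let v = vector_derivative \<gamma> (at t within {0..1})
          in f (\<gamma> t) * v + h (\<gamma> t) * lcnj v) has_integral I) {0..1}"

text \<open>The symmetric bilinear form \<open>da d\<widehat>a = du\<^sup>2 - dv\<^sup>2\<close>.\<close>

definition da_dahat :: "lorentz \<Rightarrow> lorentz \<Rightarrow> real"
  where "da_dahat v w = upart (v * lcnj w)"


section \<open>Immersions of the plane of Lorentz numbers into \<open>\<real>\<^bsup>2,2\<^esup>\<close>\<close>

text \<open>Components are indexed \<open>0, 1, 2, 3\<close>; in the index type \<open>4\<close> the numeral \<open>4\<close>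
  equals \<open>0\<close>.\<close>

definition inner22 :: "real ^ 4 \<Rightarrow> real ^ 4 \<Rightarrow> real"
  where "inner22 x y = - (x $ 0 * y $ 0) + x $ 1 * y $ 1 - x $ 2 * y $ 2 + x $ 3 * y $ 3"

definition induced_metric :: "(lorentz \<Rightarrow> real ^ 4) \<Rightarrow> lorentz \<Rightarrow> lorentz \<Rightarrow> lorentz \<Rightarrow> real"
  where "induced_metric F z v w = inner22 (differential F z v) (differential F z w)"

definition conformal_immersion :: "(lorentz \<Rightarrow> real ^ 4) \<Rightarrow> bool"
  where "conformal_immersion F \<longleftrightarrow>
    smooth_on UNIV F \<and> (\<forall>z. inj (differential F z)) \<and>
    (\<exists>\<rho>. \<forall>z. \<rho> z \<noteq> 0 \<and> (\<forall>v w. induced_metric F z v w = \<rho> z * da_dahat v w))"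

text \<open>The normal component of a vector at \<open>z\<close>; it is well defined where the induced metric is
  nondegenerate.\<close>

definition normal_part :: "(lorentz \<Rightarrow> real ^ 4) \<Rightarrow> lorentz \<Rightarrow> real ^ 4 \<Rightarrow> real ^ 4"
  where "normal_part F z y =
    (THE n. (\<forall>v. inner22 n (differential F z v) = 0) \<and> y - n \<in> range (differential F z))"

definition second_fundamental_form ::
    "(lorentz \<Rightarrow> real ^ 4) \<Rightarrow> lorentz \<Rightarrow> lorentz \<Rightarrow> lorentz \<Rightarrow> real ^ 4"
  where "second_fundamental_form F z v w =
    normal_part F z (differential (\<lambda>x. differential F x w) z v)"

text \<open>The trace \<open>g\<^bsup>ij\<^esup> B\<^sub>i\<^sub>j\<close> in the basis \<open>1, \<sigma>\<close>.\<close>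

definition metric_trace ::
    "(lorentz \<Rightarrow> lorentz \<Rightarrow> real) \<Rightarrow> (lorentz \<Rightarrow> lorentz \<Rightarrow> 'b::real_vector) \<Rightarrow> 'b"
  where "metric_trace g B =
    (1 / (g 1 1 * g lsigma lsigma - g 1 lsigma * g lsigma 1)) *\<^sub>R
      (g lsigma lsigma *\<^sub>R B 1 1 - g 1 lsigma *\<^sub>R B lsigma 1
        - g lsigma 1 *\<^sub>R B 1 lsigma + g 1 1 *\<^sub>R B lsigma lsigma)"

text \<open>With the factors \<open>1/2\<close> here, in \<open>d_a\<close> and in \<open>d_ahat\<close>, an induced metric
  \<open>\<rho> da d\<widehat>a = \<rho> (du\<^sup>2 - dv\<^sup>2)\<close> gives \<open>H = (1/(2\<rho>)) (F\<^sub>u\<^sub>u - F\<^sub>v\<^sub>v)\<close>, that is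
  \<open>2/\<rho>\<close> times the derivative of \<open>F\<close> by \<open>d_a\<close> and \<open>d_ahat\<close>. For the immersions below this
  makes \<open>\<langle>H, H\<rangle>\<close> equal to \<open>4pq / |\<psi>\<^sub>2\<phi>\<^sub>1 - \<psi>\<^sub>1\<phi>\<^sub>2|\<^sup>2\<close>; the same formula
  without the factor \<open>4\<close> fails for these normalisations. Example: for
  \<open>p = q = c \<noteq> 0\<close>, \<open>\<phi>\<^sub>1 = \<psi>\<^sub>1 = exp (-2cu)\<close> and \<open>\<phi>\<^sub>2 = -\<psi>\<^sub>2 = exp (2cu)\<close> the surface
  is a cylinder over a hyperbola of radius \<open>1/(2c)\<close>, so \<open>\<langle>H, H\<rangle> = c\<^sup>2\<close>, while
  \<open>|\<psi>\<^sub>2\<phi>\<^sub>1 - \<psi>\<^sub>1\<phi>\<^sub>2|\<^sup>2 = 4\<close>.\<close>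

definition mean_curvature :: "(lorentz \<Rightarrow> real ^ 4) \<Rightarrow> lorentz \<Rightarrow> real ^ 4"
  where "mean_curvature F z =
    (1/2) *\<^sub>R metric_trace (induced_metric F z) (second_fundamental_form F z)"


section \<open>Weierstrass representation\<close>

definition weierstrass_data ::
    "(lorentz \<Rightarrow> lorentz) \<Rightarrow> (lorentz \<Rightarrow> lorentz) \<Rightarrow> (lorentz \<Rightarrow> lorentz) \<Rightarrow> (lorentz \<Rightarrow> lorentz) \<Rightarrow>
      (lorentz \<Rightarrow> real) \<Rightarrow> (lorentz \<Rightarrow> real) \<Rightarrow> bool"
  where "weierstrass_data \<phi>1 \<phi>2 \<psi>1 \<psi>2 p q \<longleftrightarrow>
    smooth_on UNIV \<phi>1 \<and> smooth_on UNIV \<phi>2 \<and> smooth_on UNIV \<psi>1 \<and> smooth_on UNIV \<psi>2 \<and>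
    smooth_on UNIV p \<and> smooth_on UNIV q \<and>
    (\<forall>z. d_a \<phi>1 z = - (p z *\<^sub>R \<psi>1 z) \<and> d_ahat \<psi>1 z = - (q z *\<^sub>R \<phi>1 z) \<and>
         d_a \<phi>2 z = - (p z *\<^sub>R \<psi>2 z) \<and> d_ahat \<psi>2 z = - (q z *\<^sub>R \<phi>2 z) \<and>
         lsq (\<psi>2 z * \<phi>1 z - \<psi>1 z * \<phi>2 z) \<noteq> 0)"

definition weierstrass_formulas ::
    "lorentz \<Rightarrow> (lorentz \<Rightarrow> lorentz) \<Rightarrow> (lorentz \<Rightarrow> lorentz) \<Rightarrow> (lorentz \<Rightarrow> lorentz) \<Rightarrow>
      (lorentz \<Rightarrow> lorentz) \<Rightarrow> (lorentz \<Rightarrow> real ^ 4) \<Rightarrow> bool"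
  where "weierstrass_formulas a\<^sub>0 \<phi>1 \<phi>2 \<psi>1 \<psi>2 F \<longleftrightarrow>
    (\<forall>\<gamma>. valid_path \<gamma> \<and> pathstart \<gamma> = a\<^sub>0 \<longrightarrow>
      (let X = F (pathfinish \<gamma>) in
        has_path_integral (\<lambda>z. \<psi>1 z * lcnj (\<phi>1 z)) (\<lambda>z. lcnj (\<psi>1 z) * \<phi>1 z) \<gamma>
          (- of_real (X $ 0 + X $ 1)) \<and>
        has_path_integral (\<lambda>z. \<psi>2 z * lcnj (\<phi>2 z)) (\<lambda>z. lcnj (\<psi>2 z) * \<phi>2 z) \<gamma>
          (of_real (X $ 0 - X $ 1)) \<and>
        has_path_integral (\<lambda>z. \<psi>1 z * lcnj (\<phi>2 z)) (\<lambda>z. lcnj (\<psi>2 z) * \<phi>1 z) \<gamma>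
          (of_real (X $ 2) + lsigma * of_real (X $ 3)) \<and>
        has_path_integral (\<lambda>z. \<psi>2 z * lcnj (\<phi>1 z)) (\<lambda>z. lcnj (\<psi>1 z) * \<phi>2 z) \<gamma>
          (of_real (X $ 2) - lsigma * of_real (X $ 3))))"


section \<open>Lorentzian surfaces\<close>

text \<open>A chart is a pair of its domain and the coordinate map; the coordinate plane is the plane of
  Lorentz numbers, of which a smooth atlas only uses the structure of a real vector space. The
  surface is the whole type.\<close>

type_synonym 'm chart = "'m set \<times> ('m \<Rightarrow> lorentz)"

abbreviation chart_inv :: "'m chart \<Rightarrow> lorentz \<Rightarrow> 'm"
  where "chart_inv c \<equiv> inv_into (fst c) (snd c)"

abbreviation transition :: "'m chart \<Rightarrow> 'm chart \<Rightarrow> lorentz \<Rightarrow> lorentz"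
  where "transition c d \<equiv> snd d \<circ> chart_inv c"

abbreviation overlap :: "'m chart \<Rightarrow> 'm chart \<Rightarrow> lorentz set"
  where "overlap c d \<equiv> snd c ` (fst c \<inter> fst d)"

definition smooth_surface :: "'m::{t2_space, second_countable_topology} chart set \<Rightarrow> bool"
  where "smooth_surface \<A> \<longleftrightarrow>
    (\<Union>c\<in>\<A>. fst c) = UNIV \<and>
    (\<forall>c\<in>\<A>. open (fst c) \<and> open (snd c ` fst c) \<and>
      homeomorphism (fst c) (snd c ` fst c) (snd c) (chart_inv c)) \<and>
    (\<forall>c\<in>\<A>. \<forall>d\<in>\<A>. smooth_on (overlap c d) (transition c d))"

text \<open>A metric is given by its coordinate expressions: \<open>g c z v w\<close> is the product, at the point
  with coordinate \<open>z\<close>, of the tangent vectors with components \<open>v\<close> and \<open>w\<close> in the chart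
  \<open>c\<close>.\<close>

definition lorentzian_metric ::
    "'m::{t2_space, second_countable_topology} chart set \<Rightarrow>
      ('m chart \<Rightarrow> lorentz \<Rightarrow> lorentz \<Rightarrow> lorentz \<Rightarrow> real) \<Rightarrow> bool"
  where "lorentzian_metric \<A> g \<longleftrightarrow>
    (\<forall>c\<in>\<A>.
      (\<forall>v w. smooth_on (snd c ` fst c) (\<lambda>z. g c z v w)) \<and>
      (\<forall>z \<in> snd c ` fst c.
        bilinear (g c z) \<and> (\<forall>v w. g c z v w = g c z w v) \<and>
        (\<exists>e1 e2. g c z e1 e1 = 1 \<and> g c z e2 e2 = -1 \<and> g c z e1 e2 = 0)) \<and>
      (\<forall>d\<in>\<A>. \<forall>z \<in> overlap c d. \<forall>v w.
        g c z v w = g d (transition c d z)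
          (differential (transition c d) z v) (differential (transition c d) z w)))"

definition isometric_immersion ::
    "'m::{t2_space, second_countable_topology} chart set \<Rightarrow>
      ('m chart \<Rightarrow> lorentz \<Rightarrow> lorentz \<Rightarrow> lorentz \<Rightarrow> real) \<Rightarrow> ('m \<Rightarrow> real ^ 4) \<Rightarrow> bool"
  where "isometric_immersion \<A> g f \<longleftrightarrow>
    (\<forall>c\<in>\<A>. smooth_on (snd c ` fst c) (f \<circ> chart_inv c) \<and>
      (\<forall>z \<in> snd c ` fst c. inj (differential (f \<circ> chart_inv c) z) \<and>
        (\<forall>v w. induced_metric (f \<circ> chart_inv c) z v w = g c z v w)))"

text \<open>A chart of the smooth structure in which the metric is a nonvanishing multiple of
  \<open>da d\<widehat>a\<close>.\<close>

definition conformal_chart ::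
    "'m::{t2_space, second_countable_topology} chart set \<Rightarrow>
      ('m chart \<Rightarrow> lorentz \<Rightarrow> lorentz \<Rightarrow> lorentz \<Rightarrow> real) \<Rightarrow> 'm chart \<Rightarrow> bool"
  where "conformal_chart \<A> g c \<longleftrightarrow>
    smooth_surface (insert c \<A>) \<and>
    (\<exists>\<rho>. \<forall>z \<in> snd c ` fst c. \<rho> z \<noteq> 0 \<and>
      (\<forall>d\<in>\<A>. z \<in> overlap c d \<longrightarrow>
        (\<forall>v w. g d (transition c d z)
            (differential (transition c d) z v) (differential (transition c d) z w)
          = \<rho> z * da_dahat v w)))"

end

theory Submission
  imports Defs
begin

text \<open>In the idempotent basis \<open>(1 \<plusminus> \<sigma>)/2\<close> a Lorentz number \<open>u + \<sigma>v\<close> is the pair of null coordinates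
  \<open>(s, t) = (u + v, u - v)\<close>, conjugation swaps the two entries, and the Dirac equations decouple.
  Identifying \<open>\<real>\<^bsup>2,2\<^esup>\<close> with the \<open>2 \<times> 2\<close> matrices, the metric being the determinant, the
  formulas say \<open>F\<^sub>s = X Y\<^sup>T\<close>, \<open>F\<^sub>t = Z W\<^sup>T\<close> with \<open>X, W\<close> the null components of \<open>\<psi>\<close> and \<open>Z, Y\<close> those of
  \<open>\<phi>\<close>; the Dirac equations give \<open>F\<^sub>s\<^sub>t = - q Z Y\<^sup>T - p X W\<^sup>T\<close>, so the forms are closed and the mean
  curvature is read off from a determinant.

  Conversely, in a conformal chart \<open>F\<^sub>s\<close> and \<open>F\<^sub>t\<close> are null, that is of rank one, and factor smoothly
  as \<open>X Y\<^sup>T\<close> and \<open>Z W\<^sup>T\<close> over the plane. The factorisations are unique up to scalings of \<open>X\<close> and \<open>Z\<close>,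
  which are fixed by requiring \<open>X\<^sub>t \<parallel> Z\<close> and \<open>Z\<^sub>s \<parallel> X\<close>, two linear ordinary differential
  equations; the symmetry of \<open>F\<^sub>s\<^sub>t\<close> then yields the Dirac equations. Conformal charts exist because
  the two null directions of a Lorentzian metric integrate to null coordinates, and rescaling each
  of these by the tangent makes the image the whole plane.\<close>

section \<open>Functions of class \<open>C\<^sup>k\<close> and smooth functions\<close>

text \<open>The spinors must live on the whole plane. A rank-one column factors locally at once, but
  the sign of its factors is fixed globally only by lifting a map into the circle to a real angle,
  which is then halved; the lift is an integral along rays from 0. The scalings of X and Z solve
  equations that differentiate in one null direction only, so they are exponentials of integrals
  along parallel lines, again global. Requiring X_t parallel to Z is possible because X and Z form a
  basis: their determinant times that of Y and W is the conformal factor.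

  For the charts the obstacle is smoothness of a flow in its initial value. Only scalar equations
  occur, and for them the derivative in the initial value is an explicit exponential involving the
  flow itself. Regularity then follows by bootstrapping: a function whose derivative is as regular
  as the function is smooth. The same device serves inverse functions.\<close>

lemma Ck_on_cong:
  assumes "open S" "\<And>z. z \<in> S \<Longrightarrow> f z = g z" "Ck_on k S f"
  shows "Ck_on k S g"
  using assms(2,3)
proof (induction k arbitrary: f g)
  case 0
  then show ?case by (simp cong: continuous_on_cong)
next
  case (Suc k)
  have d: "(g has_derivative differential f z) (at z)" if "z \<in> S" for z
  proof (rule has_derivative_transform_within_open[OF _ assms(1) that Suc.prems(1)])
    show "(f has_derivative differential f z) (at z)"
      using Suc.prems(2) that by (simp add: frechet_derivative_works)
  qed
  have e: "differential f z = differential g z" if "z \<in> S" for z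
    using frechet_derivative_at[OF d[OF that]] .
  have "Ck_on k S (\<lambda>z. differential g z v)" for v
  proof (rule Suc.IH)
    show "differential f z v = differential g z v" if "z \<in> S" for z
      using e[OF that] by simp
    show "Ck_on k S (\<lambda>z. differential f z v)"
      using Suc.prems(2) by simp
  qed
  then show ?case
    using d by (auto simp: differentiable_def)
qed

lemma Ck_on_subset: "Ck_on k S f \<Longrightarrow> T \<subseteq> S \<Longrightarrow> Ck_on k T f"
  by (induction k arbitrary: f) (auto intro: continuous_on_subset)

lemma Ck_on_SucD: "Ck_on (Suc k) S f \<Longrightarrow> Ck_on k S f"
proof (induction k arbitrary: f)
  case 0
  then have "f differentiable_on S"
    by (simp add: differentiable_at_imp_differentiable_on)
  then show ?case by (simp add: differentiable_imp_continuous_on)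
next
  case (Suc k)
  then have "f differentiable (at z)" if "z \<in> S" for z
    using that by simp
  moreover have "Ck_on k S (\<lambda>z. differential f z v)" for v
    using Suc.prems by (intro Suc.IH) (subst (asm) Ck_on.simps(2), blast)
  ultimately show ?case by simp
qed

lemma Ck_on_le: "Ck_on n S f \<Longrightarrow> k \<le> n \<Longrightarrow> Ck_on k S f"
proof (induction n)
  case (Suc n)
  then show ?case using Ck_on_SucD[of n S f] by (metis le_Suc_eq)
qed simp

lemma Ck_on_SucI:
  assumes "open S" "\<And>z. z \<in> S \<Longrightarrow> (f has_derivative D z) (at z)"
    "\<And>v. Ck_on k S (\<lambda>z. D z v)"
  shows "Ck_on (Suc k) S f"
proof -
  have "differential f z = D z" if "z \<in> S" for z
    using frechet_derivative_at[OF assms(2)[OF that]] by simp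
  then have "Ck_on k S (\<lambda>z. differential f z v)" for v
    using Ck_on_cong[OF assms(1) _ assms(3)[of v]] by simp
  then show ?thesis using assms(2) by (auto simp: differentiable_def)
qed

lemma Ck_on_has_derivative:
  "Ck_on (Suc k) S f \<Longrightarrow> z \<in> S \<Longrightarrow> (f has_derivative differential f z) (at z)"
  by (simp add: frechet_derivative_works)

lemma Ck_on_imp_continuous_on: "Ck_on k S f \<Longrightarrow> continuous_on S f"
  using Ck_on_le[of k S f 0] by simp

lemma Ck_on_const: "open S \<Longrightarrow> Ck_on k S (\<lambda>_. c)"
proof (induction k arbitrary: c)
  case (Suc k)
  then show ?case by (intro Ck_on_SucI[where D="\<lambda>_ _. 0"]) auto
qed simp

lemma Ck_on_bounded_linear:
  assumes "bounded_linear L" "open S" "Ck_on k S f"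
  shows "Ck_on k S (\<lambda>z. L (f z))"
  using assms(3)
proof (induction k arbitrary: f)
  case 0
  then show ?case by (simp add: bounded_linear.continuous_on[OF assms(1)])
next
  case (Suc k)
  then show ?case
    by (intro Ck_on_SucI[OF assms(2), where D="\<lambda>z v. L (differential f z v)"]
        bounded_linear.has_derivative[OF assms(1)] Ck_on_has_derivative) auto
qed

lemma Ck_on_add:
  assumes "open S" "Ck_on k S f" "Ck_on k S g"
  shows "Ck_on k S (\<lambda>z. f z + g z)"
  using assms(2,3)
proof (induction k arbitrary: f g)
  case 0
  then show ?case by (simp add: continuous_on_add)
next
  case (Suc k)
  then show ?case
    by (intro Ck_on_SucI[OF assms(1), where D="\<lambda>z v. differential f z v + differential g z v"]
        has_derivative_add Ck_on_has_derivative) auto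
qed

lemma Ck_on_sum:
  "open S \<Longrightarrow> (\<And>i. i \<in> I \<Longrightarrow> Ck_on k S (f i)) \<Longrightarrow> Ck_on k S (\<lambda>z. \<Sum>i\<in>I. f i z)"
  by (induction I rule: infinite_finite_induct) (auto intro: Ck_on_const Ck_on_add)

lemma Ck_on_bounded_bilinear:
  assumes B: "bounded_bilinear B" and S: "open S" and "Ck_on k S f" "Ck_on k S g"
  shows "Ck_on k S (\<lambda>z. B (f z) (g z))"
  using assms(3,4)
proof (induction k arbitrary: f g)
  case 0
  then show ?case by (simp add: bounded_bilinear.continuous_on[OF B])
next
  case (Suc k)
  note fg = Suc.prems[THEN Ck_on_SucD]
  show ?case
    by (rule Ck_on_SucI[OF S bounded_bilinear.FDERIV[OF B]])
       (use Suc fg in \<open>auto intro!: Ck_on_add[OF S] simp: frechet_derivative_works\<close>)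
qed

lemma Ck_on_Pair:
  assumes S: "open S" and "Ck_on k S f" "Ck_on k S g"
  shows "Ck_on k S (\<lambda>z. (f z, g z))"
proof -
  have l: "bounded_linear (\<lambda>x. (x, 0))" "bounded_linear (\<lambda>x. (0, x))"
    by (auto intro!: bounded_linear_Pair bounded_linear_ident bounded_linear_zero)
  have "Ck_on k S (\<lambda>z. (f z, 0) + (0, g z))"
    by (rule Ck_on_add[OF S Ck_on_bounded_linear[OF l(1) S assms(2)] Ck_on_bounded_linear[OF l(2) S assms(3)]])
  then show ?thesis by simp
qed

text \<open>\<open>Ck_on\<close> sees derivatives in fixed directions only, whereas in the chain
  rule the direction \<open>differential f z v\<close> moves with \<open>z\<close>. Expanding it
  over \<open>Basis\<close> leaves fixed directions with variable coefficients; hence the Euclidean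
  middle space.\<close>

lemma Ck_on_compose:
  fixes f :: "'a::real_normed_vector \<Rightarrow> 'b::euclidean_space" and g :: "'b \<Rightarrow> 'c::real_normed_vector"
  assumes S: "open S" and "f ` S \<subseteq> T" "Ck_on k S f" "Ck_on k T g"
  shows "Ck_on k S (\<lambda>z. g (f z))"
  using assms(2-)
proof (induction k arbitrary: g)
  case 0
  then show ?case using continuous_on_compose2[of T g S f] by simp
next
  case (Suc k)
  have df: "(f has_derivative differential f z) (at z)" if "z \<in> S" for z
    by (rule Ck_on_has_derivative[OF Suc.prems(2) that])
  have dg: "(g has_derivative differential g (f z)) (at (f z))" if "z \<in> S" for z
    by (rule Ck_on_has_derivative[OF Suc.prems(3)]) (use Suc.prems(1) that in blast)
  have lin: "differential g (f z) w = (\<Sum>b\<in>Basis. (w \<bullet> b) *\<^sub>R differential g (f z) b)"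
    if "z \<in> S" for z w
  proof -
    interpret bounded_linear "differential g (f z)"
      using dg[OF that] by (rule has_derivative_bounded_linear)
    have "differential g (f z) w = differential g (f z) (\<Sum>b\<in>Basis. (w \<bullet> b) *\<^sub>R b)"
      by (simp only: euclidean_representation)
    then show ?thesis by (simp only: sum scaleR)
  qed
  show ?case
  proof (rule Ck_on_SucI[OF S, where
        D="\<lambda>z v. \<Sum>b\<in>Basis. (differential f z v \<bullet> b) *\<^sub>R differential g (f z) b"])
    fix z assume z: "z \<in> S"
    show "((\<lambda>z. g (f z)) has_derivative
      (\<lambda>v. \<Sum>b\<in>Basis. (differential f z v \<bullet> b) *\<^sub>R differential g (f z) b)) (at z)"
      by (rule has_derivative_eq_rhs[OF has_derivative_compose[OF df[OF z] dg[OF z]]])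
         (rule ext, rule lin[OF z])
  next
    fix v
    have fk: "Ck_on k S f" by (rule Ck_on_SucD[OF Suc.prems(2)])
    have gb: "Ck_on k T (\<lambda>y. differential g y b)" for b
      using Suc.prems(3) by simp
    have fv: "Ck_on k S (\<lambda>z. differential f z v)"
      using Suc.prems(2) by simp
    have "Ck_on k S (\<lambda>z. (differential f z v \<bullet> b) *\<^sub>R differential g (f z) b)" for b
      by (rule Ck_on_bounded_bilinear[OF bounded_bilinear_scaleR S
            Ck_on_bounded_linear[OF bounded_linear_inner_left S fv]
            Suc.IH[OF Suc.prems(1) fk gb]])
    then show "Ck_on k S
        (\<lambda>z. \<Sum>b\<in>Basis. (differential f z v \<bullet> b) *\<^sub>R differential g (f z) b)"
      by (rule Ck_on_sum[OF S])
  qed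
qed

lemma Ck_on_local:
  assumes "\<And>z. z \<in> S \<Longrightarrow> \<exists>U. open U \<and> z \<in> U \<and> Ck_on k U f"
  shows "Ck_on k S f"
  using assms
proof (induction k arbitrary: f)
  case 0
  then show ?case
    using continuous_on_eq_continuous_at by (fastforce intro!: continuous_at_imp_continuous_on)
next
  case (Suc k)
  have "\<exists>U. open U \<and> z \<in> U \<and> Ck_on k U (\<lambda>z. differential f z v)" if "z \<in> S" for z v
    using Suc.prems[OF that] by auto
  then have "Ck_on k S (\<lambda>z. differential f z v)" for v
    by (intro Suc.IH) blast
  moreover have "f differentiable (at z)" if "z \<in> S" for z
    using Suc.prems[OF that] by auto
  ultimately show ?case by simp
qed

lemma smooth_onD: "smooth_on S f \<Longrightarrow> Ck_on k S f"
  by (simp add: smooth_on_def)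

lemma smooth_on_cong: "smooth_on S f \<Longrightarrow> open S \<Longrightarrow> (\<And>z. z \<in> S \<Longrightarrow> f z = g z) \<Longrightarrow> smooth_on S g"
  by (auto simp: smooth_on_def intro: Ck_on_cong)

lemma smooth_on_subset: "smooth_on S f \<Longrightarrow> T \<subseteq> S \<Longrightarrow> smooth_on T f"
  by (auto simp: smooth_on_def intro: Ck_on_subset)

lemma smooth_on_continuous: "smooth_on S f \<Longrightarrow> continuous_on S f"
  by (auto dest: smooth_onD intro: Ck_on_imp_continuous_on)

lemma smooth_on_has_derivative:
  "smooth_on S f \<Longrightarrow> z \<in> S \<Longrightarrow> (f has_derivative differential f z) (at z)"
  by (rule Ck_on_has_derivative[OF smooth_onD])

lemma smooth_on_differential: "smooth_on S f \<Longrightarrow> smooth_on S (\<lambda>z. differential f z v)"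
  unfolding smooth_on_def by (metis Ck_on.simps(2))

lemma smooth_on_derivI:
  assumes "open S" "\<And>z. z \<in> S \<Longrightarrow> (f has_derivative D z) (at z)" "\<And>v. smooth_on S (\<lambda>z. D z v)"
  shows "smooth_on S f"
  unfolding smooth_on_def using Ck_on_SucI[OF assms(1,2)] Ck_on_SucD assms(3)
  by (metis smooth_on_def)

lemma smooth_on_const: "open S \<Longrightarrow> smooth_on S (\<lambda>_. c)"
  by (auto simp: smooth_on_def intro: Ck_on_const)

lemma smooth_on_bounded_linear:
  "bounded_linear L \<Longrightarrow> open S \<Longrightarrow> smooth_on S f \<Longrightarrow> smooth_on S (\<lambda>z. L (f z))"
  by (auto simp: smooth_on_def intro: Ck_on_bounded_linear)

lemma smooth_on_id: "open S \<Longrightarrow> smooth_on S (\<lambda>z. z)"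
  by (rule smooth_on_derivI[where D="\<lambda>_ v. v"]) (auto intro: smooth_on_const)

lemma smooth_on_linear: "bounded_linear L \<Longrightarrow> open S \<Longrightarrow> smooth_on S L"
  by (rule smooth_on_bounded_linear[OF _ _ smooth_on_id])

lemma smooth_on_add: "open S \<Longrightarrow> smooth_on S f \<Longrightarrow> smooth_on S g \<Longrightarrow> smooth_on S (\<lambda>z. f z + g z)"
  by (auto simp: smooth_on_def intro: Ck_on_add)

lemma smooth_on_uminus: "open S \<Longrightarrow> smooth_on S f \<Longrightarrow> smooth_on S (\<lambda>z. - f z)"
  by (rule smooth_on_bounded_linear[OF bounded_linear_minus[OF bounded_linear_ident]])

lemma smooth_on_diff: "open S \<Longrightarrow> smooth_on S f \<Longrightarrow> smooth_on S g \<Longrightarrow> smooth_on S (\<lambda>z. f z - g z)"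
  using smooth_on_add[of S f "\<lambda>z. - g z"] smooth_on_uminus by auto

lemma smooth_on_bilinear:
  "bounded_bilinear B \<Longrightarrow> open S \<Longrightarrow> smooth_on S f \<Longrightarrow> smooth_on S g \<Longrightarrow> smooth_on S (\<lambda>z. B (f z) (g z))"
  by (auto simp: smooth_on_def intro: Ck_on_bounded_bilinear)

lemmas smooth_on_mult = smooth_on_bilinear[OF bounded_bilinear_mult]
lemmas smooth_on_scaleR = smooth_on_bilinear[OF bounded_bilinear_scaleR]

lemma smooth_on_compose:
  fixes f :: "'a::real_normed_vector \<Rightarrow> 'b::euclidean_space" and g :: "'b \<Rightarrow> 'c::real_normed_vector"
  shows "open S \<Longrightarrow> f ` S \<subseteq> T \<Longrightarrow> smooth_on S f \<Longrightarrow> smooth_on T g \<Longrightarrow> smooth_on S (\<lambda>z. g (f z))"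
  using Ck_on_compose[of S f T _ g] by (auto simp: smooth_on_def)

lemma smooth_on_Pair:
  "open S \<Longrightarrow> smooth_on S f \<Longrightarrow> smooth_on S g \<Longrightarrow> smooth_on S (\<lambda>z. (f z, g z))"
  by (auto simp: smooth_on_def intro: Ck_on_Pair)

lemma smooth_on_fst: "open S \<Longrightarrow> smooth_on S f \<Longrightarrow> smooth_on S (\<lambda>z. fst (f z))"
  by (rule smooth_on_bounded_linear[OF bounded_linear_fst])

lemma smooth_on_snd: "open S \<Longrightarrow> smooth_on S f \<Longrightarrow> smooth_on S (\<lambda>z. snd (f z))"
  by (rule smooth_on_bounded_linear[OF bounded_linear_snd])

lemma smooth_on_local:
  assumes "\<And>z. z \<in> S \<Longrightarrow> \<exists>U. open U \<and> z \<in> U \<and> smooth_on U f"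
  shows "smooth_on S f"
  using assms unfolding smooth_on_def by (meson Ck_on_local)

text \<open>Regularity climbs one order at a time, starting from continuity. Meant for functions
  whose derivative is expressed through themselves: \<open>exp\<close>, \<open>inverse\<close>,
  \<open>sqrt\<close>, the flow, inverse functions.\<close>

lemma smooth_on_bootstrap:
  assumes "open S" "\<And>z. z \<in> S \<Longrightarrow> (f has_derivative D z) (at z)"
    "\<And>k v. Ck_on k S f \<Longrightarrow> Ck_on k S (\<lambda>z. D z v)"
  shows "smooth_on S f"
  unfolding smooth_on_def
proof
  fix k show "Ck_on k S f"
  proof (induction k)
    case 0
    then show ?case
      using assms(2) by (auto intro!: continuous_at_imp_continuous_on dest: has_derivative_continuous)
  next
    case (Suc k)
    show ?case by (rule Ck_on_SucI[OF assms(1,2) assms(3)[OF Suc]])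
  qed
qed

section \<open>Elementary functions\<close>

lemma smooth_on_exp_real: "smooth_on UNIV (exp :: real \<Rightarrow> real)"
proof (rule smooth_on_bootstrap[where D="\<lambda>z v. exp z * v"])
  show "(exp has_derivative (*) (exp z)) (at z)" for z :: real
    using DERIV_exp[of z] by (simp add: has_field_derivative_def)
qed (auto intro!: Ck_on_bounded_linear[OF bounded_linear_mult_left])

lemma smooth_on_inverse_real: "smooth_on (- {0}) (inverse :: real \<Rightarrow> real)"
proof (rule smooth_on_bootstrap[where D="\<lambda>z v. - (inverse z * v * inverse z)"])
  show "(inverse has_derivative (\<lambda>v. - (inverse z * v * inverse z))) (at z)" if "z \<in> - {0}" for z :: real
    using that by (intro has_derivative_inverse') auto
  show "Ck_on k (- {0}) (\<lambda>z. - (inverse z * v * inverse z))"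
    if "Ck_on k (- {0}) (inverse :: real \<Rightarrow> real)" for k and v :: real
  proof -
    have o: "open (- {0 :: real})" by auto
    note m = Ck_on_bounded_bilinear[OF bounded_bilinear_mult o]
    have "Ck_on k (- {0}) (\<lambda>z. inverse z * v * inverse z)"
      using m[OF m[OF that Ck_on_const[OF o, of k v]] that] .
    then show ?thesis
      using Ck_on_bounded_linear[OF bounded_linear_minus[OF bounded_linear_ident] o] by blast
  qed
qed auto

lemma smooth_on_sin_cos_real:
  "smooth_on UNIV (sin :: real \<Rightarrow> real)" "smooth_on UNIV (cos :: real \<Rightarrow> real)"
proof -
  have "Ck_on k UNIV (sin :: real \<Rightarrow> real) \<and> Ck_on k UNIV (cos :: real \<Rightarrow> real)" for k
  proof (induction k)
    case 0
    then show ?case by (auto intro!: continuous_intros)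
  next
    case (Suc k)
    have "Ck_on (Suc k) UNIV (sin :: real \<Rightarrow> real)"
      by (rule Ck_on_SucI[where D="\<lambda>z v. cos z * v"])
         (use Suc DERIV_sin in \<open>auto simp: has_field_derivative_def
           intro!: Ck_on_bounded_linear[OF bounded_linear_mult_left]\<close>)
    moreover have "Ck_on (Suc k) UNIV (cos :: real \<Rightarrow> real)"
      by (rule Ck_on_SucI[OF _ DERIV_cos[unfolded has_field_derivative_def]])
         (use Suc in \<open>auto intro!: Ck_on_bounded_linear[OF bounded_linear_mult_left]
             Ck_on_bounded_linear[OF bounded_linear_minus[OF bounded_linear_ident]]
             simp del: mult_minus_left\<close>)
    ultimately show ?case by blast
  qed
  then show "smooth_on UNIV (sin :: real \<Rightarrow> real)" "smooth_on UNIV (cos :: real \<Rightarrow> real)"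
    by (auto simp: smooth_on_def)
qed

lemma smooth_on_exp: "open S \<Longrightarrow> smooth_on S f \<Longrightarrow> smooth_on S (\<lambda>z. exp (f z :: real))"
  by (rule smooth_on_compose[OF _ _ _ smooth_on_exp_real]) auto

lemma smooth_on_sin: "open S \<Longrightarrow> smooth_on S f \<Longrightarrow> smooth_on S (\<lambda>z. sin (f z :: real))"
  by (rule smooth_on_compose[OF _ _ _ smooth_on_sin_cos_real(1)]) auto

lemma smooth_on_cos: "open S \<Longrightarrow> smooth_on S f \<Longrightarrow> smooth_on S (\<lambda>z. cos (f z :: real))"
  by (rule smooth_on_compose[OF _ _ _ smooth_on_sin_cos_real(2)]) auto

lemma smooth_on_inverse:
  "open S \<Longrightarrow> smooth_on S f \<Longrightarrow> (\<And>z. z \<in> S \<Longrightarrow> f z \<noteq> (0::real)) \<Longrightarrow> smooth_on S (\<lambda>z. inverse (f z))"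
  by (rule smooth_on_compose[OF _ _ _ smooth_on_inverse_real]) auto

lemma smooth_on_divide:
  "open S \<Longrightarrow> smooth_on S f \<Longrightarrow> smooth_on S g \<Longrightarrow> (\<And>z. z \<in> S \<Longrightarrow> g z \<noteq> (0::real))
    \<Longrightarrow> smooth_on S (\<lambda>z. f z / g z)"
  unfolding divide_inverse by (intro smooth_on_mult smooth_on_inverse)

lemma smooth_on_arctan: "smooth_on UNIV arctan"
proof (rule smooth_on_derivI[where D="\<lambda>z v. inverse (1 + z * z) * v"])
  show "(arctan has_derivative (*) (inverse (1 + z * z))) (at z)" for z
    using DERIV_arctan[of z] by (simp add: has_field_derivative_def power2_eq_square)
  show "smooth_on UNIV (\<lambda>z. inverse (1 + z * z) * v)" for v :: real
    by (intro smooth_on_mult smooth_on_inverse smooth_on_add smooth_on_const smooth_on_id)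
       (auto simp: add_nonneg_eq_0_iff)
qed auto

lemma smooth_on_tan: "smooth_on {- (pi/2)<..<pi/2} (tan :: real \<Rightarrow> real)"
proof -
  have "smooth_on {- (pi/2)<..<pi/2} (\<lambda>x. sin x / cos x)"
    using cos_gt_zero_pi
    by (intro smooth_on_divide smooth_on_sin smooth_on_cos smooth_on_id)
       (force simp: less_le)+
  then show ?thesis by (simp add: tan_def[abs_def])
qed

lemmas smooth_intros = smooth_on_const smooth_on_id smooth_on_add smooth_on_uminus smooth_on_diff
  smooth_on_mult smooth_on_scaleR smooth_on_Pair smooth_on_fst smooth_on_snd smooth_on_exp
  smooth_on_sin smooth_on_cos smooth_on_inverse smooth_on_divide

section \<open>Integrals depending on a parameter\<close>

lemma has_derivative_integral_param:
  fixes h :: "'a::euclidean_space \<times> real \<Rightarrow> 'b::euclidean_space"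
  assumes S: "open S" and ST: "S \<times> {0..1} \<subseteq> T" and h: "Ck_on (Suc 0) T h" and z: "z \<in> S"
  shows "((\<lambda>z. integral {0..1} (\<lambda>t. h (z, t))) has_derivative
    (\<lambda>v. integral {0..1} (\<lambda>t. differential h (z, t) (v, 0)))) (at z)"
proof -
  obtain r where r: "r > 0" "ball z r \<subseteq> S" using S z openE by blast
  have hd: "(h has_derivative differential h p) (at p)" if "p \<in> T" for p
    by (rule Ck_on_has_derivative[OF h that])
  have T: "(x, t) \<in> T" if "x \<in> ball z r" "t \<in> {0..1}" for x t using that r ST by blast
  \<comment> \<open>\<open>leibniz_rule\<close> takes the derivative as a continuous family of
    bounded operators, so the partial differential is packed as a \<open>blinfun\<close>, with
    continuity checked on basis vectors.\<close>
  define D where "D x t = Blinfun (\<lambda>v. differential h (x, t) (v, 0))" for x t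
  have d1: "((\<lambda>x. h (x, t)) has_derivative (\<lambda>v. differential h (x, t) (v, 0))) (at x)"
    if "(x, t) \<in> T" for x t
  proof -
    have "((\<lambda>x. (x, t)) has_derivative (\<lambda>v. (v, 0))) (at x)"
      by (auto intro!: derivative_eq_intros)
    from has_derivative_compose[OF this hd[OF that]] show ?thesis .
  qed
  have D: "blinfun_apply (D x t) = (\<lambda>v. differential h (x, t) (v, 0))" if "(x, t) \<in> T" for x t
    unfolding D_def by (rule bounded_linear_Blinfun_apply[OF has_derivative_bounded_linear[OF d1[OF that]]])
  have contD: "continuous_on (ball z r \<times> {0..1}) (\<lambda>(x, t). D x t)"
  proof (rule continuous_on_blinfun_componentwise)
    fix i :: 'a
    have "continuous_on (ball z r \<times> {0..1}) (\<lambda>p. differential h p (i, 0))"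
    proof (rule continuous_on_subset)
      show "continuous_on T (\<lambda>p. differential h p (i, 0))" using h by simp
      show "ball z r \<times> {0..1} \<subseteq> T" using T by blast
    qed
    then show "continuous_on (ball z r \<times> {0..1}) (\<lambda>p. blinfun_apply (case p of (x, t) \<Rightarrow> D x t) i)"
      by (rule continuous_on_eq) (auto simp: D[OF T])
  qed
  have conth: "continuous_on T h" by (rule Ck_on_imp_continuous_on[OF h])
  have "((\<lambda>x. integral (cbox 0 1) (\<lambda>t. h (x, t))) has_derivative
      blinfun_apply (integral (cbox 0 1) (D z))) (at z within ball z r)"
  proof (rule leibniz_rule[where U="ball z r"])
    show "((\<lambda>x. h (x, t)) has_derivative blinfun_apply (D x t)) (at x within ball z r)"
      if "x \<in> ball z r" "t \<in> cbox 0 1" for x t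
      using d1[OF T] D[OF T] that by (metis has_derivative_at_withinI cbox_interval)
    show "(\<lambda>t. h (x, t)) integrable_on cbox 0 1" if "x \<in> ball z r" for x
      using T[OF that]
      by (intro integrable_continuous continuous_on_compose2[OF conth] continuous_intros) auto
    show "continuous_on (ball z r \<times> cbox 0 1) (\<lambda>(x, t). D x t)" using contD by simp
  qed (use r in auto)
  then have "((\<lambda>x. integral {0..1} (\<lambda>t. h (x, t))) has_derivative
      blinfun_apply (integral {0..1} (D z))) (at z)"
    using r by (simp add: at_within_open[of z "ball z r"])
  moreover have "blinfun_apply (integral {0..1} (D z)) v
      = integral {0..1} (\<lambda>t. differential h (z, t) (v, 0))" for v
  proof -
    have "D z integrable_on {0..1}"
      using r by (intro integrable_continuous_real
          continuous_on_compose2[OF contD, of _ "\<lambda>t. (z, t)", simplified] continuous_intros) auto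
    from integral_linear[OF this blinfun.bounded_linear_left[of v]]
    have "blinfun_apply (integral {0..1} (D z)) v = integral {0..1} (\<lambda>t. blinfun_apply (D z t) v)"
      by (simp add: o_def)
    also have "\<dots> = integral {0..1} (\<lambda>t. differential h (z, t) (v, 0))"
      by (rule integral_cong) (use D[OF T] r in auto)
    finally show ?thesis .
  qed
  ultimately show ?thesis by (metis (no_types, lifting) ext has_derivative_eq_rhs)
qed

text \<open>Differentiating under the integral sign replaces \<open>h\<close> by one of its
  directional derivatives, which drives the induction. The closure lemmas for \<open>Ck_on\<close>
  want open sets and \<open>S \<times> {0..1}\<close> is not open, so the integrand may live on a
  larger \<open>T\<close>.\<close>

lemma Ck_on_integral_param:
  fixes h :: "'a::euclidean_space \<times> real \<Rightarrow> 'b::euclidean_space"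
  assumes "open S" "S \<times> {0..1} \<subseteq> T" "Ck_on k T h"
  shows "Ck_on k S (\<lambda>z. integral {0..1} (\<lambda>t. h (z, t)))"
  using assms(3)
proof (induction k arbitrary: h)
  case 0
  then have "continuous_on (S \<times> cbox 0 1) (\<lambda>(x, t). h (x, t))"
    using assms(2) by (auto intro: continuous_on_subset)
  then show ?case using integral_continuous_on_param[of S 0 1 "\<lambda>x t. h (x, t)"] by simp
next
  case (Suc k)
  have "Ck_on (Suc 0) T h" by (rule Ck_on_le[OF Suc.prems]) simp
  then show ?case
    using Suc by (intro Ck_on_SucI[OF assms(1) has_derivative_integral_param[OF assms(1,2)]]) auto
qed

lemma smooth_on_integral_param:
  fixes h :: "'a::euclidean_space \<times> real \<Rightarrow> 'b::euclidean_space"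
  assumes "open S" "S \<times> {0..1} \<subseteq> T" "smooth_on T h"
  shows "smooth_on S (\<lambda>z. integral {0..1} (\<lambda>t. h (z, t)))"
  using Ck_on_integral_param[OF assms(1,2)] assms(3) by (auto simp: smooth_on_def)

section \<open>Symmetry of second derivatives\<close>

lemma has_real_derivative_line:
  fixes g :: "'a::real_normed_vector \<Rightarrow> real"
  assumes g: "\<And>x. (g has_derivative differential g x) (at x)"
  shows "((\<lambda>s. g (c + s *\<^sub>R u)) has_real_derivative differential g (c + s *\<^sub>R u) u) (at s)"
proof -
  have l: "((\<lambda>s. c + s *\<^sub>R u) has_derivative (\<lambda>h. h *\<^sub>R u)) (at s)"
    by (auto intro!: derivative_eq_intros)
  show ?thesis
    by (rule has_derivative_imp_has_field_derivative[OF has_derivative_compose[OF l g]])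
       (use linear_scale[OF bounded_linear.linear[OF has_derivative_bounded_linear[OF g]]] in simp)
qed

text \<open>Two applications of the mean value theorem: to the increment by
  \<open>t *\<^sub>R w\<close> as a function of the step along \<open>v\<close>, then to the
  resulting first derivative along \<open>w\<close>.\<close>

lemma second_difference:
  fixes f :: "'a::real_normed_vector \<Rightarrow> real"
  assumes f: "Ck_on (Suc (Suc 0)) UNIV f" and t: "0 < t"
  shows "\<exists>x y. 0 < x \<and> x < t \<and> 0 < y \<and> y < t \<and>
    f (z + t *\<^sub>R v + t *\<^sub>R w) - f (z + t *\<^sub>R v) - f (z + t *\<^sub>R w) + f z
      = t * t * differential (\<lambda>x. differential f x v) (z + x *\<^sub>R v + y *\<^sub>R w) w"
proof -
  have f1: "(f has_derivative differential f x) (at x)" for x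
    by (rule Ck_on_has_derivative[OF f]) simp
  have fv: "Ck_on (Suc 0) UNIV (\<lambda>x. differential f x v)"
    using f by simp
  have f2: "((\<lambda>x. differential f x v) has_derivative differential (\<lambda>x. differential f x v) x) (at x)" for x
    by (rule Ck_on_has_derivative[OF fv]) simp
  have "\<exists>x. 0 < x \<and> x < t \<and>
     (f ((z + t *\<^sub>R w) + t *\<^sub>R v) - f (z + t *\<^sub>R v)) - (f ((z + t *\<^sub>R w) + 0 *\<^sub>R v) - f (z + 0 *\<^sub>R v))
      = (t - 0) * (differential f ((z + t *\<^sub>R w) + x *\<^sub>R v) v - differential f (z + x *\<^sub>R v) v)"
    by (rule MVT2[OF t]) (intro DERIV_diff has_real_derivative_line f1)
  then obtain x where x: "0 < x" "x < t" and 1: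
     "(f ((z + t *\<^sub>R w) + t *\<^sub>R v) - f (z + t *\<^sub>R v)) - (f (z + t *\<^sub>R w) - f z)
      = t * (differential f ((z + t *\<^sub>R w) + x *\<^sub>R v) v - differential f (z + x *\<^sub>R v) v)"
    by auto
  have "\<exists>y. 0 < y \<and> y < t \<and>
     differential f ((z + x *\<^sub>R v) + t *\<^sub>R w) v - differential f ((z + x *\<^sub>R v) + 0 *\<^sub>R w) v
      = (t - 0) * differential (\<lambda>x. differential f x v) ((z + x *\<^sub>R v) + y *\<^sub>R w) w"
    by (rule MVT2[OF t]) (intro has_real_derivative_line f2)
  then obtain y where y: "0 < y" "y < t" and 2:
     "differential f ((z + x *\<^sub>R v) + t *\<^sub>R w) v - differential f (z + x *\<^sub>R v) v
      = t * differential (\<lambda>x. differential f x v) ((z + x *\<^sub>R v) + y *\<^sub>R w) w"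
    by auto
  show ?thesis
    using x y 1 2 by (intro exI[of _ x] exI[of _ y]) (simp add: ac_simps)
qed

lemma second_derivative_symmetric:
  fixes f :: "'a::real_normed_vector \<Rightarrow> real"
  assumes f: "Ck_on (Suc (Suc 0)) UNIV f"
  shows "differential (\<lambda>x. differential f x v) z w = differential (\<lambda>x. differential f x w) z v"
proof (rule ccontr)
  let ?A = "\<lambda>x. differential (\<lambda>x. differential f x v) x w"
  let ?B = "\<lambda>x. differential (\<lambda>x. differential f x w) x v"
  assume ne: "?A z \<noteq> ?B z"
  define e where "e = \<bar>?A z - ?B z\<bar> / 2"
  have e: "e > 0" using ne by (simp add: e_def)
  have "continuous_on UNIV ?A" "continuous_on UNIV ?B" using f by simp_all
  then obtain d1 d2 where d: "d1 > 0" "d2 > 0"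
    and A: "\<And>x. dist x z < d1 \<Longrightarrow> dist (?A x) (?A z) < e"
    and B: "\<And>x. dist x z < d2 \<Longrightarrow> dist (?B x) (?B z) < e"
    using e unfolding continuous_on_iff by (metis UNIV_I)
  \<comment> \<open>So small that the whole parallelogram with sides \<open>t *\<^sub>R v\<close>
    and \<open>t *\<^sub>R w\<close> lies within \<open>min d1 d2\<close> of \<open>z\<close>; the
    summand 1 keeps the denominator positive.\<close>
  define t where "t = min d1 d2 / (1 + norm v + norm w)"
  have n: "1 + norm v + norm w > 0" by (simp add: add_pos_nonneg)
  have t: "t > 0" using d n by (simp add: t_def)
  have near: "dist (z + x *\<^sub>R a + y *\<^sub>R b) z < min d1 d2"
    if "0 < x" "x < t" "0 < y" "y < t" "{a, b} = {v, w}" for x y a b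
  proof -
    have "dist (z + x *\<^sub>R a + y *\<^sub>R b) z = norm (x *\<^sub>R a + y *\<^sub>R b)" by (simp add: dist_norm)
    also have "\<dots> \<le> x * norm a + y * norm b"
      using norm_triangle_ineq[of "x *\<^sub>R a" "y *\<^sub>R b"] that by simp
    also have "\<dots> \<le> t * norm a + t * norm b"
      using that by (intro add_mono mult_right_mono) auto
    also have "\<dots> = t * (norm v + norm w)" using that(5) by (auto simp: doubleton_eq_iff algebra_simps)
    also have "\<dots> < t * (1 + norm v + norm w)" using t by simp
    also have "\<dots> = min d1 d2" using n by (simp add: t_def)
    finally show ?thesis .
  qed
  obtain x y where 1: "0 < x" "x < t" "0 < y" "y < t"
    "f (z + t *\<^sub>R v + t *\<^sub>R w) - f (z + t *\<^sub>R v) - f (z + t *\<^sub>R w) + f z = t * t * ?A (z + x *\<^sub>R v + y *\<^sub>R w)"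
    using second_difference[OF f t] by metis
  obtain x' y' where 2: "0 < x'" "x' < t" "0 < y'" "y' < t"
    "f (z + t *\<^sub>R w + t *\<^sub>R v) - f (z + t *\<^sub>R w) - f (z + t *\<^sub>R v) + f z = t * t * ?B (z + x' *\<^sub>R w + y' *\<^sub>R v)"
    using second_difference[OF f t] by metis
  \<comment> \<open>One and the same second difference, read in both orders.\<close>
  have "t * t * ?A (z + x *\<^sub>R v + y *\<^sub>R w) = t * t * ?B (z + x' *\<^sub>R w + y' *\<^sub>R v)"
  proof -
    have "z + t *\<^sub>R w + t *\<^sub>R v = z + t *\<^sub>R v + t *\<^sub>R w" by (simp add: add_ac)
    with 2(5) have "f (z + t *\<^sub>R v + t *\<^sub>R w) - f (z + t *\<^sub>R w) - f (z + t *\<^sub>R v) + f z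
        = t * t * ?B (z + x' *\<^sub>R w + y' *\<^sub>R v)" by simp
    with 1(5) show ?thesis by linarith
  qed
  then have "?A (z + x *\<^sub>R v + y *\<^sub>R w) = ?B (z + x' *\<^sub>R w + y' *\<^sub>R v)" using t by simp
  moreover have "dist (?A (z + x *\<^sub>R v + y *\<^sub>R w)) (?A z) < e" using near 1 by (intro A) force
  moreover have "dist (?B (z + x' *\<^sub>R w + y' *\<^sub>R v)) (?B z) < e" using near 2 by (intro B) force
  ultimately show False unfolding e_def dist_real_def by (smt (verit) field_sum_of_halves)
qed

section \<open>Primitives\<close>

lemma FTC_unit_interval_scaled:
  fixes g :: "real \<Rightarrow> real"
  assumes "\<And>t. (g has_real_derivative g' t) (at t)"
  shows "integral {0..1} (\<lambda>t. g t + t * g' t) = g 1"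
proof -
  have "((\<lambda>t. g t + t * g' t) has_integral (1 * g 1 - 0 * g 0)) {0..1}"
  proof (rule fundamental_theorem_of_calculus)
    fix t :: real
    have "((\<lambda>t. t * g t) has_real_derivative (g t + t * g' t)) (at t)"
      using assms[of t] by (auto intro!: derivative_eq_intros)
    then show "((\<lambda>t. t * g t) has_vector_derivative (g t + t * g' t)) (at t within {0..1})"
      by (simp add: has_real_derivative_iff_has_vector_derivative has_vector_derivative_at_within)
  qed simp
  then show ?thesis by (simp add: integral_unique)
qed

lemma smooth_on_has_real_derivative_line:
  fixes g :: "'a::real_normed_vector \<Rightarrow> real"
  assumes "smooth_on UNIV g"
  shows "((\<lambda>s. g (c + s *\<^sub>R u)) has_real_derivative differential g (c + s *\<^sub>R u) u) (at s)"
  by (rule has_real_derivative_line) (rule smooth_on_has_derivative[OF assms UNIV_I])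

text \<open>\<open>G z\<close> is the integral of \<open>\<alpha>\<close> along the line in
  direction \<open>e\<close> from the hyperplane \<open>l = 0\<close> to \<open>z\<close>. Scaled to
  the unit interval it becomes \<open>l z\<close> times a parameter integral, hence smooth.\<close>

lemma directional_primitive:
  fixes \<alpha> l :: "'a::euclidean_space \<Rightarrow> real"
  assumes \<alpha>: "smooth_on UNIV \<alpha>" and l: "bounded_linear l" and le: "l e = 1"
  obtains G where "smooth_on UNIV G" "\<And>z. differential G z e = \<alpha> z"
proof
  let ?c = "\<lambda>p::'a \<times> real. fst p - l (fst p) *\<^sub>R e + (snd p * l (fst p)) *\<^sub>R e"
  define h where "h p = \<alpha> (?c p)" for p
  define I where "I z = integral {0..1} (\<lambda>t. h (z, t))" for z
  have lf: "smooth_on UNIV (\<lambda>p::'a \<times> real. l (fst p))"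
    by (intro smooth_on_bounded_linear[OF l] smooth_intros) auto
  have c: "smooth_on UNIV ?c"
    by (intro smooth_intros lf open_UNIV)
  have h: "smooth_on UNIV h"
    unfolding h_def using smooth_on_compose[OF _ _ c \<alpha>] by simp
  have I: "smooth_on UNIV I"
    unfolding I_def by (rule smooth_on_integral_param[OF _ _ h]) auto
  show G: "smooth_on UNIV (\<lambda>z. l z * I z)"
    by (intro smooth_intros smooth_on_linear[OF l] I) auto
  fix z
  interpret l: bounded_linear l by (rule l)
  have ce: "(h has_derivative (\<lambda>q. differential \<alpha> (?c p)
      (fst q - l (fst q) *\<^sub>R e + (snd p * l (fst q) + snd q * l (fst p)) *\<^sub>R e))) (at p)" for p
  proof -
    have "(?c has_derivative (\<lambda>q. fst q - l (fst q) *\<^sub>R e + (snd p * l (fst q) + snd q * l (fst p)) *\<^sub>R e)) (at p)"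
      by (auto intro!: derivative_eq_intros bounded_linear.has_derivative[OF l])
    from has_derivative_compose[OF this smooth_on_has_derivative[OF \<alpha>]] show ?thesis
      by (simp add: h_def[abs_def])
  qed
  have lin: "bounded_linear (differential \<alpha> x)" for x
    using smooth_on_has_derivative[OF \<alpha>, of x] has_derivative_bounded_linear by blast
  \<comment> \<open>Moving \<open>z\<close> along \<open>e\<close> leaves the foot point on the
    hyperplane fixed and raises \<open>l\<close> at unit rate, so the point at parameter
    \<open>t\<close> moves with velocity \<open>t *\<^sub>R e\<close>.\<close>
  have dh: "differential h (z, t) (e, 0) = t * differential \<alpha> (?c (z, t)) e" for t
    unfolding frechet_derivative_at[OF ce, symmetric]
    using linear_scale[OF bounded_linear.linear[OF lin], of "?c (z,t)" t e] by (simp add: le)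
  have Id: "(I has_derivative (\<lambda>v. integral {0..1} (\<lambda>t. differential h (z, t) (v, 0)))) (at z)"
    unfolding I_def by (rule has_derivative_integral_param[OF open_UNIV _ smooth_onD[OF h]]) auto
  have "((\<lambda>z. l z * I z) has_derivative
      (\<lambda>v. l z * integral {0..1} (\<lambda>t. differential h (z, t) (v, 0)) + l v * I z)) (at z)"
    using Id by (auto intro!: derivative_eq_intros bounded_linear.has_derivative[OF l])
  then have "differential (\<lambda>z. l z * I z) z e
      = l z * integral {0..1} (\<lambda>t. t * differential \<alpha> (?c (z, t)) e) + I z"
    by (simp add: frechet_derivative_at[symmetric] le dh)
  also have "\<dots> = integral {0..1} (\<lambda>t. h (z, t) + t * (l z * differential \<alpha> (?c (z, t)) e))"
  proof -
    have "continuous_on UNIV (\<lambda>p. h p)" by (rule smooth_on_continuous[OF h])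
    from continuous_on_compose2[OF this continuous_on_Pair[OF continuous_on_const continuous_on_id]]
    have "(\<lambda>t. h (z, t)) integrable_on {0..1}"
      by (intro integrable_continuous_real) simp
    moreover have "continuous_on UNIV (\<lambda>x. differential \<alpha> x e)"
      by (rule smooth_on_continuous[OF smooth_on_differential[OF \<alpha>]])
    then have "continuous_on {0..1} (\<lambda>t. differential \<alpha> (?c (z, t)) e)"
      by (rule continuous_on_compose2) (auto intro!: continuous_intros)
    then have "(\<lambda>t. t * (l z * differential \<alpha> (?c (z, t)) e)) integrable_on {0..1}"
      by (intro integrable_continuous_real continuous_intros)
    moreover have "l z * integral {0..1} (\<lambda>t. t * differential \<alpha> (?c (z, t)) e)
      = integral {0..1} (\<lambda>t. t * (l z * differential \<alpha> (?c (z, t)) e))"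
      by (subst integral_mult_right[symmetric]) (simp add: mult.left_commute)
    ultimately show ?thesis
      by (simp add: I_def integral_add)
  qed
  also have "\<dots> = h (z, 1)"
  proof (rule FTC_unit_interval_scaled)
    fix t
    have "((\<lambda>s. \<alpha> ((z - l z *\<^sub>R e) + s *\<^sub>R (l z *\<^sub>R e))) has_real_derivative
       differential \<alpha> ((z - l z *\<^sub>R e) + t *\<^sub>R (l z *\<^sub>R e)) (l z *\<^sub>R e)) (at t)"
      by (rule smooth_on_has_real_derivative_line[OF \<alpha>])
    then show "((\<lambda>t. h (z, t)) has_real_derivative l z * differential \<alpha> (?c (z, t)) e) (at t)"
      by (simp add: h_def linear_scale[OF bounded_linear.linear[OF lin]])
  qed
  also have "\<dots> = \<alpha> z" by (simp add: h_def)
  finally show "differential (\<lambda>z. l z * I z) z e = \<alpha> z" .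
qed

text \<open>Candidate potential of a one-form, with its differential computed for any smooth form.
  The Poincare lemma uses it in every direction, the polar angle along rays.\<close>

lemma radial_integral:
  fixes \<omega> :: "'a::euclidean_space \<Rightarrow> 'a \<Rightarrow> real"
  assumes \<omega>: "\<And>v. smooth_on UNIV (\<lambda>z. \<omega> z v)" and lin: "\<And>z. linear (\<omega> z)"
  defines "G \<equiv> \<lambda>z. integral {0..1} (\<lambda>t. \<omega> (t *\<^sub>R z) z)"
  shows "smooth_on UNIV G"
    and "(G has_derivative
      (\<lambda>v. integral {0..1} (\<lambda>t. \<omega> (t *\<^sub>R z) v + t * differential (\<lambda>x. \<omega> x z) (t *\<^sub>R z) v))) (at z)"
proof -
  \<comment> \<open>In \<open>\<omega> (t *\<^sub>R z) z\<close> the direction varies too, while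
    smoothness is known for fixed directions; hence the expansion over \<open>Basis\<close>.\<close>
  define h where "h p = (\<Sum>b\<in>Basis. (fst p \<bullet> b) * \<omega> (snd p *\<^sub>R fst p) b)" for p :: "'a \<times> real"
  have \<omega>': "((\<lambda>x. \<omega> x b) has_derivative differential (\<lambda>x. \<omega> x b) z) (at z)" for b z
    using smooth_on_has_derivative[OF \<omega>] by simp
  have rep: "\<omega> z v = (\<Sum>b\<in>Basis. (v \<bullet> b) * \<omega> z b)" for z v
    using linear_sum[OF lin, of z "\<lambda>b. (v \<bullet> b) *\<^sub>R b" Basis]
    by (simp add: euclidean_representation linear_scale[OF lin])
  have h\<omega>: "h (z, t) = \<omega> (t *\<^sub>R z) z" for z t
    using rep[of "t *\<^sub>R z" z] by (simp add: h_def)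
  have h: "smooth_on UNIV h"
  proof -
    have "smooth_on UNIV (\<lambda>p::'a \<times> real. (fst p \<bullet> b) * \<omega> (snd p *\<^sub>R fst p) b)" for b
      by (intro smooth_on_mult smooth_on_compose[OF _ _ _ \<omega>, of UNIV "\<lambda>p::'a \<times> real. snd p *\<^sub>R fst p"]
          smooth_on_bounded_linear[OF bounded_linear_inner_left] smooth_intros) auto
    then show ?thesis
      unfolding smooth_on_def h_def[abs_def]
      by (intro allI Ck_on_sum[OF open_UNIV]) blast
  qed
  have G: "G = (\<lambda>z. integral {0..1} (\<lambda>t. h (z, t)))"
    by (simp add: G_def h\<omega>)
  show "smooth_on UNIV G"
    unfolding G by (rule smooth_on_integral_param[OF open_UNIV _ h]) simp
  have lind: "bounded_linear (differential (\<lambda>x. \<omega> x b) x)" for b x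
    using \<omega>' has_derivative_bounded_linear by blast
  have dh: "differential h (z, t) (v, 0) = \<omega> (t *\<^sub>R z) v + t * differential (\<lambda>x. \<omega> x z) (t *\<^sub>R z) v" for t v
  proof -
    have m: "((\<lambda>p::'a \<times> real. snd p *\<^sub>R fst p) has_derivative (\<lambda>q. t *\<^sub>R fst q + snd q *\<^sub>R z)) (at (z, t))"
      by (auto intro!: derivative_eq_intros)
    have "(h has_derivative (\<lambda>q. \<Sum>b\<in>Basis. (z \<bullet> b) * differential (\<lambda>x. \<omega> x b) (t *\<^sub>R z) (t *\<^sub>R fst q + snd q *\<^sub>R z)
          + (fst q \<bullet> b) * \<omega> (t *\<^sub>R z) b)) (at (z, t))"
      unfolding h_def
      by (auto intro!: derivative_eq_intros has_derivative_compose[OF m] \<omega>')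
    then have "differential h (z, t) (v, 0) =
        (\<Sum>b\<in>Basis. (z \<bullet> b) * differential (\<lambda>x. \<omega> x b) (t *\<^sub>R z) (t *\<^sub>R v) + (v \<bullet> b) * \<omega> (t *\<^sub>R z) b)"
      by (simp add: frechet_derivative_at[symmetric])
    also have "\<dots> = \<omega> (t *\<^sub>R z) v + t * (\<Sum>b\<in>Basis. (z \<bullet> b) * differential (\<lambda>x. \<omega> x b) (t *\<^sub>R z) v)"
      using rep[of "t *\<^sub>R z" v]
      by (simp add: sum.distrib linear_scale[OF bounded_linear.linear[OF lind]] sum_distrib_left mult.left_commute)
    also have "(\<Sum>b\<in>Basis. (z \<bullet> b) * differential (\<lambda>x. \<omega> x b) (t *\<^sub>R z) v)
        = differential (\<lambda>x. \<omega> x z) (t *\<^sub>R z) v"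
    proof -
      have "((\<lambda>x. \<Sum>b\<in>Basis. (z \<bullet> b) * \<omega> x b) has_derivative
          (\<lambda>v. \<Sum>b\<in>Basis. (z \<bullet> b) * differential (\<lambda>x. \<omega> x b) (t *\<^sub>R z) v)) (at (t *\<^sub>R z))"
        by (intro has_derivative_sum has_derivative_mult_right \<omega>')
      then have "((\<lambda>x. \<omega> x z) has_derivative
          (\<lambda>v. \<Sum>b\<in>Basis. (z \<bullet> b) * differential (\<lambda>x. \<omega> x b) (t *\<^sub>R z) v)) (at (t *\<^sub>R z))"
        by (simp only: rep[symmetric])
      then show ?thesis by (simp add: frechet_derivative_at[symmetric])
    qed
    finally show ?thesis .
  qed
  show "(G has_derivative
     (\<lambda>v. integral {0..1} (\<lambda>t. \<omega> (t *\<^sub>R z) v + t * differential (\<lambda>x. \<omega> x z) (t *\<^sub>R z) v))) (at z)"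
    using has_derivative_integral_param[OF _ _ smooth_onD[OF h], of UNIV z] by (simp add: dh G)
qed

lemma integral_along_ray:
  fixes \<omega> :: "'a::euclidean_space \<Rightarrow> 'a \<Rightarrow> real"
  assumes \<omega>: "smooth_on UNIV (\<lambda>z. \<omega> z v)"
  shows "integral {0..1} (\<lambda>t. \<omega> (t *\<^sub>R z) v + t * differential (\<lambda>x. \<omega> x v) (t *\<^sub>R z) z) = \<omega> z v"
  using FTC_unit_interval_scaled[OF smooth_on_has_real_derivative_line[OF \<omega>, where c=0 and u=z]] by simp

text \<open>Closedness exchanges the two directions in the differential of the radial integral; the
  integrand then is the \<open>t\<close>-derivative of
  \<open>t * \<omega> (t *\<^sub>R z) v\<close>.\<close>

lemma Poincare_lemma:
  fixes \<omega> :: "'a::euclidean_space \<Rightarrow> 'a \<Rightarrow> real"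
  assumes \<omega>: "\<And>v. smooth_on UNIV (\<lambda>z. \<omega> z v)" and lin: "\<And>z. linear (\<omega> z)"
    and closed: "\<And>z v w. differential (\<lambda>x. \<omega> x v) z w = differential (\<lambda>x. \<omega> x w) z v"
  obtains G where "\<And>z. (G has_derivative \<omega> z) (at z)"
proof
  show "((\<lambda>z. integral {0..1} (\<lambda>t. \<omega> (t *\<^sub>R z) z)) has_derivative \<omega> z) (at z)" for z
    by (rule has_derivative_eq_rhs[OF radial_integral(2)[OF \<omega> lin]])
       (simp add: fun_eq_iff integral_along_ray[of \<omega>, OF \<omega>] closed[where v = z])
qed

section \<open>Flow of a scalar ordinary differential equation\<close>

lemma Ck_on_mult:
  fixes f g :: "'a::real_normed_vector \<Rightarrow> real"
  shows "open S \<Longrightarrow> Ck_on k S f \<Longrightarrow> Ck_on k S g \<Longrightarrow> Ck_on k S (\<lambda>z. f z * g z)"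
  by (rule Ck_on_bounded_bilinear[OF bounded_bilinear_mult])

text \<open>Written over the unit interval, the primitive vanishing at 0 covers both signs of
  \<open>x\<close> without oriented integrals and fits the lemmas on parameter integrals.\<close>

lemma has_derivative_scaled_integral:
  fixes g :: "real \<Rightarrow> real"
  assumes g: "continuous_on UNIV g"
  shows "((\<lambda>x. x * integral {0..1} (\<lambda>t. g (x * t))) has_real_derivative g x) (at x)"
proof -
  define R where "R = \<bar>x\<bar> + 1"
  define H where "H y = integral {-R..y} g" for y
  have H: "(H has_real_derivative g y) (at y)" if "y \<in> {-R<..<R}" for y
  proof -
    have "(H has_real_derivative g y) (at y within {-R..R})"
      unfolding H_def using that by (intro integral_has_real_derivative continuous_on_subset[OF g]) auto
    then show ?thesis
      using that at_within_interior[of y "{-R..R}"] by simp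
  qed
  have eq: "y * integral {0..1} (\<lambda>t. g (y * t)) = H y - H 0" if y: "y \<in> {-R<..<R}" for y
  proof -
    have "((\<lambda>t. y * g (y * t)) has_integral (H (y * 1) - H (y * 0))) {0..1}"
    proof (rule fundamental_theorem_of_calculus)
      fix t :: real assume t: "t \<in> {0..1}"
      have "\<bar>y * t\<bar> \<le> \<bar>y\<bar> * 1" unfolding abs_mult using t by (intro mult_left_mono) auto
      then have "y * t \<in> {-R<..<R}" using y by auto
      from DERIV_chain2[OF H[OF this] DERIV_cmult_Id[of y t UNIV]]
      show "((\<lambda>t. H (y * t)) has_vector_derivative y * g (y * t)) (at t within {0..1})"
        by (simp add: has_real_derivative_iff_has_vector_derivative has_vector_derivative_at_within mult.commute)
    qed simp
    from integral_unique[OF this] show ?thesis by simp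
  qed
  have "x \<in> {-R<..<R}" by (auto simp: R_def)
  from DERIV_diff[OF H[OF this] DERIV_const, of "H 0"]
  have "((\<lambda>y. H y - H 0) has_real_derivative g x) (at x)" by simp
  then show ?thesis
    by (rule has_field_derivative_transform_within_open[of _ _ _ "{-R<..<R}"])
       (auto simp: eq R_def)
qed

definition clamp_to :: "real \<Rightarrow> real \<Rightarrow> real"
  where "clamp_to r y = max (- r) (min r y)"

lemma clamp_to_bounds: "0 \<le> r \<Longrightarrow> clamp_to r y \<in> {-r..r}" "0 \<le> r \<Longrightarrow> \<bar>clamp_to r y\<bar> \<le> r"
  and clamp_to_id: "\<bar>y\<bar> \<le> r \<Longrightarrow> clamp_to r y = y"
  and clamp_to_lipschitz: "\<bar>clamp_to r y - clamp_to r z\<bar> \<le> \<bar>y - z\<bar>"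
  by (auto simp: clamp_to_def)

lemma continuous_on_clamp_to [continuous_intros]:
  "continuous_on S f \<Longrightarrow> continuous_on S (\<lambda>x. clamp_to r (f x))"
  unfolding clamp_to_def by (intro continuous_intros)

lemma continuous_on_integral_param:
  fixes f :: "'a::topological_space \<times> real \<Rightarrow> real"
  assumes "continuous_on UNIV f"
  shows "continuous_on UNIV (\<lambda>x. integral {0..1} (\<lambda>t. f (x, t)))"
proof -
  have "continuous_on (UNIV \<times> cbox 0 1) (\<lambda>(x, t). f (x, t))"
    using continuous_on_subset[OF assms] by (simp add: case_prod_unfold)
  from integral_continuous_on_param[OF this] show ?thesis by simp
qed

text \<open>The clamps make the right-hand side globally Lipschitz, so that the integral equation is a
  contraction on bounded continuous functions of time and initial value; continuity in both
  variables comes for free.\<close>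

lemma clamped_flow_exists:
  fixes mt :: "real \<times> real \<Rightarrow> real"
  assumes cont: "continuous_on UNIV mt" and bound: "\<And>p. \<bar>mt p\<bar> \<le> M"
    and lip: "\<And>x y z. \<bar>mt (x, y) - mt (x, z)\<bar> \<le> L * \<bar>y - z\<bar>"
    and d: "d > 0" "d * L \<le> 1 / 2" and r: "r \<ge> 0"
  obtains Y :: "real \<times> real \<Rightarrow> real" where "continuous_on UNIV Y"
    "\<And>x c. Y (x, c) = clamp_to r c + clamp_to d x *
        integral {0..1} (\<lambda>t. mt (clamp_to d x * t, Y (clamp_to d x * t, c)))"
proof -
  \<comment> \<open>Picard operator, the integral from 0 to the clamped time being scaled to the
    unit interval. The outer clamps of time and initial value make every image bounded, by
    \<open>r + d * M\<close>.\<close>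
  define T :: "(real \<times> real \<Rightarrow> real) \<Rightarrow> real \<times> real \<Rightarrow> real"
    where "T Y p = clamp_to r (snd p) + clamp_to d (fst p) *
        integral {0..1} (\<lambda>t. mt (clamp_to d (fst p) * t, Y (clamp_to d (fst p) * t, snd p)))" for Y p
  have comp: "continuous_on S (\<lambda>q. mt (f q, Y (f q, g q)))"
    if "continuous_on UNIV Y" "continuous_on S f" "continuous_on S g"
    for Y :: "real \<times> real \<Rightarrow> real" and f g :: "'b::topological_space \<Rightarrow> real" and S
    by (intro continuous_on_compose2[OF cont] continuous_on_compose2[OF that(1)] continuous_on_Pair that) auto
  have Tc: "continuous_on UNIV (T Y)" if "continuous_on UNIV Y" for Y
  proof -
    have "continuous_on UNIV (\<lambda>p :: (real \<times> real) \<times> real.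
        mt (clamp_to d (fst (fst p)) * snd p, Y (clamp_to d (fst (fst p)) * snd p, snd (fst p))))"
      by (rule comp[OF that]) (intro continuous_intros)+
    from continuous_on_integral_param[OF this]
    show ?thesis unfolding T_def[abs_def] by (intro continuous_intros) simp
  qed
  have int: "(\<lambda>t. mt (clamp_to d x * t, Y (clamp_to d x * t, c))) integrable_on {0..1}"
    "continuous_on {0..1} (\<lambda>t. mt (clamp_to d x * t, Y (clamp_to d x * t, c)))"
    if "continuous_on UNIV Y" for Y :: "real \<times> real \<Rightarrow> real" and x c
    using comp[OF that, of "{0..1}" "\<lambda>t. clamp_to d x * t" "\<lambda>_. c"]
    by (auto intro!: integrable_continuous_real continuous_intros)
  have Tb: "T Y \<in> bcontfun" if Y: "continuous_on UNIV Y" for Y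
  proof (rule bcontfun_normI[OF Tc[OF Y]])
    fix p
    have "norm (integral {0..1} (\<lambda>t. mt (clamp_to d (fst p) * t, Y (clamp_to d (fst p) * t, snd p)))) \<le> M * (1 - 0)"
      by (rule integral_bound) (use int(2)[OF Y] bound in auto)
    then have "\<bar>clamp_to d (fst p)\<bar> * \<bar>integral {0..1} (\<lambda>t. mt (clamp_to d (fst p) * t, Y (clamp_to d (fst p) * t, snd p)))\<bar> \<le> d * M"
      using clamp_to_bounds(2)[of d] d by (intro mult_mono) auto
    then show "norm (T Y p) \<le> r + d * M"
      using clamp_to_bounds(2)[OF r, of "snd p"] unfolding T_def real_norm_def
      by (simp add: abs_mult order_trans[OF abs_triangle_ineq])
  qed
  define TT where "TT Y = Bcontfun (T (apply_bcontfun Y))" for Y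
  have TT: "apply_bcontfun (TT Y) = T (apply_bcontfun Y)" for Y
    unfolding TT_def by (rule Bcontfun_inverse[OF Tb]) simp
  have "dist (TT Y) (TT Z) \<le> 1 / 2 * dist Y Z" for Y Z
  proof (rule dist_bound)
    fix p :: "real \<times> real"
    let ?f = "\<lambda>Y t. mt (clamp_to d (fst p) * t, apply_bcontfun Y (clamp_to d (fst p) * t, snd p))"
    have c: "continuous_on UNIV (apply_bcontfun W)" for W :: "(real \<times> real) \<Rightarrow>\<^sub>C real" by simp
    have L: "L \<ge> 0" using lip[of 0 0 1] by (simp add: order_trans[OF abs_ge_zero])
    have "T Y p - T Z p = clamp_to d (fst p) * integral {0..1} (\<lambda>t. ?f Y t - ?f Z t)"
      unfolding T_def by (simp add: integral_diff int(1)[OF c] right_diff_distrib)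
    moreover have "norm (integral {0..1} (\<lambda>t. ?f Y t - ?f Z t)) \<le> (L * dist Y Z) * (1 - 0)"
    proof (rule integral_bound)
      show "continuous_on {0..1} (\<lambda>t. ?f Y t - ?f Z t)"
        by (intro continuous_on_diff int(2)[OF c])
      fix t :: real
      have "norm (?f Y t - ?f Z t) \<le> L * dist (apply_bcontfun Y (clamp_to d (fst p) * t, snd p)) (apply_bcontfun Z (clamp_to d (fst p) * t, snd p))"
        using lip by (simp add: dist_real_def)
      also have "\<dots> \<le> L * dist Y Z" by (intro mult_left_mono dist_bounded L)
      finally show "norm (?f Y t - ?f Z t) \<le> L * dist Y Z" .
    qed simp
    ultimately have "\<bar>T Y p - T Z p\<bar> \<le> d * (L * dist Y Z)"
      using clamp_to_bounds(2)[of d "fst p"] d unfolding abs_mult by (auto simp: abs_mult intro!: mult_mono)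
    also have "\<dots> \<le> 1 / 2 * dist Y Z"
      using mult_right_mono[OF d(2), of "dist Y Z"] by (simp add: mult.assoc)
    finally show "dist (apply_bcontfun (TT Y) p) (apply_bcontfun (TT Z) p) \<le> 1 / 2 * dist Y Z"
      by (simp add: TT dist_real_def)
  qed
  then obtain Y where Y: "TT Y = Y"
    using banach_fix_type[of "1/2" TT] by auto
  show ?thesis
  proof (rule that[of "apply_bcontfun Y"])
    fix x c
    show "apply_bcontfun Y (x, c) = clamp_to r c + clamp_to d x *
        integral {0..1} (\<lambda>t. mt (clamp_to d x * t, apply_bcontfun Y (clamp_to d x * t, c)))"
      using fun_cong[OF TT[of Y], of "(x, c)"] unfolding Y T_def by simp
  qed simp
qed

lemma square_nbhd:
  fixes U :: "(real \<times> real) set"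
  assumes "open U" "(a, b) \<in> U"
  obtains r where "r > 0" "{a - r..a + r} \<times> {b - r..b + r} \<subseteq> U"
proof -
  obtain A B where AB: "open A" "open B" "(a, b) \<in> A \<times> B" "A \<times> B \<subseteq> U"
    using open_prod_elim[OF assms] by metis
  obtain r1 where r1: "r1 > 0" "cball a r1 \<subseteq> A"
    using AB(1,3) open_contains_cball by blast
  obtain r2 where r2: "r2 > 0" "cball b r2 \<subseteq> B"
    using AB(2,3) open_contains_cball by blast
  note r = r1 r2
  show ?thesis
    by (rule that[of "min r1 r2"]) (use r AB(4) in \<open>force simp: cball_eq_atLeastAtMost\<close>)+
qed

text \<open>The difference of two solutions of a scalar equation solves a linear scalar equation and is
  therefore an exponential; this gives the derivative with respect to the initial value
  explicitly, and the formula shows that it is as regular as the flow.\<close>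

lemma scalar_flow:
  fixes m :: "real \<times> real \<Rightarrow> real"
  assumes U: "open U" "(0, 0) \<in> U" and m: "smooth_on U m"
  obtains d Y E where "d > 0" "smooth_on ({-d<..<d} \<times> {-d<..<d}) Y"
    "\<And>x c. x \<in> {-d<..<d} \<Longrightarrow> c \<in> {-d<..<d} \<Longrightarrow> (x, Y (x, c)) \<in> U"
    "Y (0, 0) = 0" "\<And>p. E p > (0 :: real)"
    "\<And>x c. x \<in> {-d<..<d} \<Longrightarrow> c \<in> {-d<..<d} \<Longrightarrow>
      (Y has_derivative (\<lambda>v. m (x, Y (x, c)) * fst v + E (x, c) * snd v)) (at (x, c))"
proof -
  obtain r where r: "r > 0" and rU: "{-r..r} \<times> {-r..r} \<subseteq> U"
    using square_nbhd[OF U] by auto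
  define my where "my p = differential m p (0, 1)" for p
  have smy: "smooth_on U my" unfolding my_def by (rule smooth_on_differential[OF m])
  let ?K = "{-r..r} \<times> {-r..r}"
  have K: "compact ?K" by (intro compact_Times) auto
  have b: "\<exists>B>0. \<forall>p\<in>?K. \<bar>f p\<bar> \<le> B" if "smooth_on U f" for f :: "real \<times> real \<Rightarrow> real"
  proof -
    have "bounded (f ` ?K)"
      by (intro compact_imp_bounded compact_continuous_image K
          continuous_on_subset[OF smooth_on_continuous[OF that] rU])
    then show ?thesis unfolding bounded_pos by auto
  qed
  obtain M where M: "M > 0" "\<And>p. p \<in> ?K \<Longrightarrow> \<bar>m p\<bar> \<le> M" using b[OF m] by auto
  obtain L where L: "L > 0" "\<And>p. p \<in> ?K \<Longrightarrow> \<bar>my p\<bar> \<le> L" using b[OF smy] by auto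
  \<comment> \<open>With \<open>r / 2\<close> the initial values fill at most half of the square,
    with \<open>r / (2 * M)\<close> a solution moves by at most the other half, and
    \<open>1 / (2 * L)\<close> gives the contraction factor 1/2.\<close>
  define d where "d = min (r / 2) (min (r / (2 * M)) (1 / (2 * L)))"
  have d: "d > 0" "d \<le> r / 2" "d * M \<le> r / 2" "d * L \<le> 1 / 2"
  proof -
    show "d > 0" "d \<le> r / 2" using r M L by (simp_all add: d_def)
    have "d \<le> r / (2 * M)" "d \<le> 1 / (2 * L)" by (simp_all add: d_def)
    then show "d * M \<le> r / 2" "d * L \<le> 1 / 2" using M(1) L(1) by (simp_all add: field_simps)
  qed
  define cl where "cl p = (clamp_to r (fst p), clamp_to r (snd p))" for p
  have cl: "cl p \<in> ?K" for p using clamp_to_bounds(1)[of r] r by (simp add: cl_def)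
  have cl_id: "cl p = p" if "p \<in> ?K" for p using that by (auto simp: cl_def clamp_to_id prod_eq_iff)
  have contcl: "continuous_on UNIV (\<lambda>p. f (cl p))" if "smooth_on U f" for f :: "real \<times> real \<Rightarrow> real"
  proof -
    have "continuous_on UNIV cl" unfolding cl_def[abs_def] by (intro continuous_intros)
    then show ?thesis
      by (rule continuous_on_compose2[OF smooth_on_continuous[OF that]]) (use cl rU in blast)
  qed
  have m_dy: "((\<lambda>y. m (x, y)) has_real_derivative my (x, y)) (at y)" if "(x, y) \<in> U" for x y
  proof -
    have md: "(m has_derivative differential m (x, y)) (at (x, y))"
      by (rule smooth_on_has_derivative[OF m that])
    have l: "((\<lambda>y. (x, y)) has_derivative (\<lambda>h. (0, h))) (at y)"
      by (auto intro!: derivative_eq_intros)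
    have "differential m (x, y) (0, h) = h * my (x, y)" for h
      using linear_scale[OF bounded_linear.linear[OF has_derivative_bounded_linear[OF md]], of h "(0, 1)"]
      by (simp add: my_def)
    then show ?thesis
      by (intro has_derivative_imp_has_field_derivative[OF has_derivative_compose[OF l md]]) simp
  qed
  define mt where "mt p = m (cl p)" for p
  have lip: "\<bar>mt (x, y) - mt (x, z)\<bar> \<le> L * \<bar>y - z\<bar>" for x y z
  proof -
    let ?x = "clamp_to r x"
    have x: "?x \<in> {-r..r}" using r by (intro clamp_to_bounds) simp
    have "norm (m (?x, clamp_to r y) - m (?x, clamp_to r z)) \<le> L * norm (clamp_to r y - clamp_to r z)"
    proof (rule field_differentiable_bound[where S="{-r..r}" and f="\<lambda>y. m (?x, y)"])
      show "((\<lambda>y. m (?x, y)) has_field_derivative my (?x, t)) (at t within {-r..r})" if "t \<in> {-r..r}" for t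
        by (rule has_field_derivative_at_within[OF m_dy]) (use x that rU in blast)
      show "norm (my (?x, t)) \<le> L" if "t \<in> {-r..r}" for t
        using L(2)[of "(?x, t)"] x that by simp
    qed (use clamp_to_bounds[of r] r in auto)
    also have "\<dots> \<le> L * \<bar>y - z\<bar>" using clamp_to_lipschitz L(1) by simp
    finally show ?thesis by (simp add: mt_def cl_def)
  qed
  obtain Y where Yc: "continuous_on UNIV Y" and Yeq: "\<And>x c. Y (x, c) = clamp_to r c + clamp_to d x *
        integral {0..1} (\<lambda>t. mt (clamp_to d x * t, Y (clamp_to d x * t, c)))"
  proof (rule clamped_flow_exists[of mt M L d r])
    show "continuous_on UNIV mt" unfolding mt_def[abs_def] by (rule contcl[OF m])
    show "\<bar>mt p\<bar> \<le> M" for p unfolding mt_def by (rule M(2)[OF cl])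
    show "r \<ge> 0" using r by simp
    show "\<bar>mt (x, y) - mt (x, z)\<bar> \<le> L * \<bar>y - z\<bar>" for x y z by (rule lip)
    show "d > 0" "d * L \<le> 1 / 2" by (rule d)+
  qed blast
  have Y0: "Y (0, c) = clamp_to r c" for c
  proof -
    have "clamp_to d 0 = 0" using d by (simp add: clamp_to_id)
    from Yeq[of 0 c, unfolded this mult_zero_left add_0_right] show ?thesis .
  qed
  have scale: "\<bar>x * t\<bar> \<le> d" if "\<bar>x\<bar> \<le> d" "t \<in> {0..1}" for x t :: real
  proof -
    have "\<bar>x * t\<bar> \<le> \<bar>x\<bar> * 1" unfolding abs_mult using that by (intro mult_left_mono) auto
    then show ?thesis using that by simp
  qed
  have comp: "continuous_on UNIV (\<lambda>q. f (cl (a q, b q)))"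
    if "smooth_on U f" "continuous_on UNIV a" "continuous_on UNIV b"
    for f :: "real \<times> real \<Rightarrow> real" and a b :: "'b::topological_space \<Rightarrow> real"
    by (rule continuous_on_compose2[OF contcl[OF that(1)] continuous_on_Pair[OF that(2,3)]]) simp
  have Ycomp: "continuous_on UNIV (\<lambda>q. Y (a q, b q))" if "continuous_on UNIV a" "continuous_on UNIV b"
    for a b :: "'b::topological_space \<Rightarrow> real"
    by (rule continuous_on_compose2[OF Yc continuous_on_Pair[OF that]]) simp
  have inK: "(x, Y (x, c)) \<in> ?K" if "\<bar>x\<bar> \<le> d" "\<bar>c\<bar> \<le> d" for x c
  proof -
    have "continuous_on {0..1} (\<lambda>t. mt (x * t, Y (x * t, c)))"
      unfolding mt_def
      by (rule continuous_on_subset[OF comp[OF m]]) (auto intro!: continuous_intros Ycomp)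
    then have "norm (integral {0..1} (\<lambda>t. mt (x * t, Y (x * t, c)))) \<le> M * (1 - 0)"
      by (intro integral_bound) (auto simp: mt_def M(2)[OF cl])
    then have "\<bar>x\<bar> * \<bar>integral {0..1} (\<lambda>t. mt (x * t, Y (x * t, c)))\<bar> \<le> d * M"
      using that(1) d(1) by (intro mult_mono) simp_all
    moreover have "Y (x, c) = c + x * integral {0..1} (\<lambda>t. mt (x * t, Y (x * t, c)))"
      using Yeq[of x c] that d r by (simp add: clamp_to_id)
    ultimately have "\<bar>Y (x, c)\<bar> \<le> \<bar>c\<bar> + d * M"
      by (simp add: abs_mult[symmetric])
    then show ?thesis using that d r by auto
  qed
  define g where "g c s = mt (clamp_to d s, Y (clamp_to d s, c))" for c s
  have gc: "continuous_on UNIV (g c)" for c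
    unfolding g_def[abs_def] mt_def by (intro comp[OF m] continuous_intros Ycomp)
  have Yx: "((\<lambda>x. Y (x, c)) has_real_derivative m (x, Y (x, c))) (at x)" if "\<bar>x\<bar> < d" "\<bar>c\<bar> \<le> d" for x c
  proof -
    have "((\<lambda>x. c + x * integral {0..1} (\<lambda>t. g c (x * t))) has_real_derivative g c x) (at x)"
      using DERIV_add[OF DERIV_const has_derivative_scaled_integral[OF gc]] by simp
    moreover have "c + x * integral {0..1} (\<lambda>t. g c (x * t)) = Y (x, c)" if x: "x \<in> {-d<..<d}" for x
    proof -
      have xd: "\<bar>x\<bar> \<le> d" using x by auto
      have "integral {0..1} (\<lambda>t. g c (x * t)) = integral {0..1} (\<lambda>t. mt (x * t, Y (x * t, c)))"
        by (intro integral_cong) (simp add: g_def clamp_to_id scale[OF xd])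
      then show ?thesis using Yeq[of x c] xd \<open>\<bar>c\<bar> \<le> d\<close> d r by (simp add: clamp_to_id)
    qed
    ultimately have "((\<lambda>x. Y (x, c)) has_real_derivative g c x) (at x)"
      using that by (elim has_field_derivative_transform_within_open[where S="{-d<..<d}"]) auto
    moreover have "g c x = m (x, Y (x, c))"
      using that inK[of x c] by (simp add: g_def mt_def clamp_to_id cl_id)
    ultimately show ?thesis by simp
  qed
  \<comment> \<open>Mean of \<open>my\<close> over the segment between the solutions with initial
    values \<open>fst (snd q)\<close> and \<open>snd (snd q)\<close>: the factor by which the
    difference of the solutions becomes the difference of \<open>m\<close>
    (\<open>mdiff\<close>).\<close>
  define G where "G q = integral {0..1} (\<lambda>t. my (cl (clamp_to d (fst q),
      Y (clamp_to d (fst q), fst (snd q)) + t * (Y (clamp_to d (fst q), snd (snd q)) - Y (clamp_to d (fst q), fst (snd q))))))"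
    for q :: "real \<times> real \<times> real"
  have Gc: "continuous_on UNIV G"
    unfolding G_def[abs_def]
    by (rule continuous_on_integral_param[where f="\<lambda>q. my (cl (clamp_to d (fst (fst q)),
      Y (clamp_to d (fst (fst q)), fst (snd (fst q))) + snd q * (Y (clamp_to d (fst (fst q)), snd (snd (fst q)))
        - Y (clamp_to d (fst (fst q)), fst (snd (fst q))))))", simplified])
       (intro comp[OF smy] continuous_intros Ycomp)
  define E where "E q = exp (fst q * integral {0..1} (\<lambda>t. G (fst q * t, snd q)))" for q :: "real \<times> real \<times> real"
  have Ec: "continuous_on UNIV E"
  proof -
    have "continuous_on UNIV (\<lambda>q :: (real \<times> real \<times> real) \<times> real. G (fst (fst q) * snd q, snd (fst q)))"
      by (rule continuous_on_compose2[OF Gc]) (intro continuous_intros, simp)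
    from continuous_on_integral_param[OF this] show ?thesis
      unfolding E_def[abs_def] by (intro continuous_intros) simp
  qed
  have mdiff: "m (x, Y (x, c')) - m (x, Y (x, c)) = G (x, c, c') * (Y (x, c') - Y (x, c))"
    if x: "\<bar>x\<bar> \<le> d" and c: "\<bar>c\<bar> \<le> d" "\<bar>c'\<bar> \<le> d" for x c c'
  proof -
    let ?y = "Y (x, c)" and ?h = "Y (x, c') - Y (x, c)"
    have K: "(x, ?y + t * ?h) \<in> ?K" if t: "t \<in> {0..1}" for t
    proof -
      have "(1 - t) *\<^sub>R Y (x, c) + t *\<^sub>R Y (x, c') \<in> {-r..r}"
        using inK[OF x c(1)] inK[OF x c(2)] t
        by (intro convexD[OF convex_real_interval(5)]) auto
      then show ?thesis using inK[OF x c(1)] by (simp add: algebra_simps)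
    qed
    have "((\<lambda>t. my (x, ?y + t * ?h) * ?h) has_integral (m (x, ?y + 1 * ?h) - m (x, ?y + 0 * ?h))) {0..1}"
    proof (rule fundamental_theorem_of_calculus)
      fix t :: real assume t: "t \<in> {0..1}"
      have "((\<lambda>t. ?y + t * ?h) has_real_derivative ?h) (at t)"
        by (auto intro!: derivative_eq_intros)
      from DERIV_chain2[OF m_dy[OF subsetD[OF rU K[OF t]]] this]
      show "((\<lambda>t. m (x, ?y + t * ?h)) has_vector_derivative my (x, ?y + t * ?h) * ?h) (at t within {0..1})"
        by (simp add: has_real_derivative_iff_has_vector_derivative has_vector_derivative_at_within)
    qed simp
    from integral_unique[OF this]
    have "m (x, Y (x, c')) - m (x, Y (x, c)) = integral {0..1} (\<lambda>t. my (x, ?y + t * ?h) * ?h)"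
      by simp
    also have "\<dots> = integral {0..1} (\<lambda>t. my (x, ?y + t * ?h)) * ?h" by simp
    also have "integral {0..1} (\<lambda>t. my (x, ?y + t * ?h)) = G (x, c, c')"
      unfolding G_def using x by (intro integral_cong) (simp add: clamp_to_id cl_id[OF K])
    finally show ?thesis .
  qed
  have Ydiff: "Y (x, c') - Y (x, c) = (c' - c) * E (x, c, c')"
    if x: "\<bar>x\<bar> < d" and c: "\<bar>c\<bar> \<le> d" "\<bar>c'\<bar> \<le> d" for x c c'
  proof -
    define P where "P x = x * integral {0..1} (\<lambda>t. G (x * t, c, c'))" for x
    have "continuous_on UNIV (\<lambda>s. G (s, c, c'))"
      by (rule continuous_on_compose2[OF Gc]) (intro continuous_intros, simp)
    from has_derivative_scaled_integral[OF this]
    have P: "(P has_real_derivative G (x, c, c')) (at x)" for x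
      unfolding P_def .
    \<comment> \<open>Integrating factor for the linear equation of the difference:
      \<open>?Q\<close> is constant in time, with value \<open>c' - c\<close> at time 0.\<close>
    let ?Q = "\<lambda>x. (Y (x, c') - Y (x, c)) * exp (- P x)"
    have "(?Q has_real_derivative 0) (at s within {-d<..<d})" if s: "s \<in> {-d<..<d}" for s
    proof -
      have s': "\<bar>s\<bar> < d" using s by auto
      have "(?Q has_real_derivative (m (s, Y (s, c')) - m (s, Y (s, c))) * exp (- P s)
          + exp (- P s) * - G (s, c, c') * (Y (s, c') - Y (s, c))) (at s)"
        by (intro DERIV_mult DERIV_diff Yx s' c DERIV_fun_exp DERIV_minus P)
      moreover have "(m (s, Y (s, c')) - m (s, Y (s, c))) * exp (- P s)
          + exp (- P s) * - G (s, c, c') * (Y (s, c') - Y (s, c)) = 0"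
        unfolding mdiff[OF less_imp_le[OF s'] c] by simp
      ultimately show ?thesis
        by (metis has_field_derivative_at_within)
    qed
    then have "\<exists>k. \<forall>s\<in>{-d<..<d}. ?Q s = k"
      by (intro has_field_derivative_zero_constant convex_real_interval)
    then obtain k where k: "\<And>s. s \<in> {-d<..<d} \<Longrightarrow> ?Q s = k"
      by blast
    have "k = c' - c"
      using k[of 0] d(1) c d(2) r by (simp add: P_def clamp_to_id Y0)
    then have "(Y (x, c') - Y (x, c)) * exp (- P x) * exp (P x) = (c' - c) * exp (P x)"
      using k[of x] x by (auto simp: abs_less_iff)
    then show ?thesis
      by (simp add: mult.assoc flip: exp_add) (simp add: E_def P_def)
  qed
  let ?I = "{-d<..<d}"
  \<comment> \<open>By \<open>Ydiff\<close> the difference quotient in the initial value equals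
    \<open>E (x, c, y)\<close> exactly, so the derivative exists by continuity of
    \<open>E\<close>.\<close>
  have Yc': "((\<lambda>c. Y (x, c)) has_real_derivative E (x, c, c)) (at c)" if "x \<in> ?I" "c \<in> ?I" for x c
    unfolding has_field_derivative_iff
  proof (rule Lim_transform_within_open)
    have "continuous_on UNIV (\<lambda>y. E (x, c, y))"
      by (rule continuous_on_compose2[OF Ec]) (intro continuous_intros, simp)
    then show "((\<lambda>y. E (x, c, y)) \<longlongrightarrow> E (x, c, c)) (at c)"
      by (simp add: continuous_on_eq_continuous_at isCont_def)
    show "E (x, c, y) = (Y (x, y) - Y (x, c)) / (y - c)" if "y \<in> ?I" "y \<noteq> c" for y
    proof -
      have "\<bar>x\<bar> < d" "\<bar>c\<bar> \<le> d" "\<bar>y\<bar> \<le> d" using that \<open>x \<in> ?I\<close> \<open>c \<in> ?I\<close> by auto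
      from Ydiff[OF this] show ?thesis using that by simp
    qed
  qed (use that in auto)
  \<comment> \<open>Partial derivatives combine to a total one as soon as one of them is continuous,
    here that in the initial value.\<close>
  have Yd: "(Y has_derivative (\<lambda>v. m (x, Y (x, c)) * fst v + E (x, c, c) * snd v)) (at (x, c))"
    if xc: "x \<in> ?I" "c \<in> ?I" for x c
  proof -
    have "((\<lambda>(x, c). Y (x, c)) has_derivative (\<lambda>(tx, ty). m (x, Y (x, c)) * tx + blinfun_mult_right (E (x, c, c)) ty))
        (at (x, c) within ?I \<times> ?I)"
    proof (rule has_derivative_partialsI)
      show "((\<lambda>x. Y (x, c)) has_derivative (*) (m (x, Y (x, c)))) (at x within ?I)"
        using Yx[of x c] xc by (auto simp: has_field_derivative_def abs_less_iff intro: has_derivative_at_withinI)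
      show "((\<lambda>y. Y (x, y)) has_derivative blinfun_apply (blinfun_mult_right (E (x, y, y)))) (at y within ?I)"
        if "x \<in> ?I" "y \<in> ?I" for x y
        using Yc'[OF that] by (auto simp: has_field_derivative_def intro: has_derivative_at_withinI)
      have "continuous_on UNIV (\<lambda>p. E (fst p, snd p, snd p))"
        by (rule continuous_on_compose2[OF Ec]) (intro continuous_intros, simp)
      then have "continuous_on UNIV (\<lambda>p. blinfun_mult_right (E (fst p, snd p, snd p)))"
        by (intro continuous_intros)
      then show "continuous (at (x, c) within ?I \<times> ?I) (\<lambda>(x, y). blinfun_mult_right (E (x, y, y)))"
        by (auto simp: case_prod_unfold continuous_on_eq_continuous_at intro: continuous_at_imp_continuous_at_within)
    qed (use xc in auto)
    then have "(Y has_derivative (\<lambda>v. m (x, Y (x, c)) * fst v + E (x, c, c) * snd v)) (at (x, c) within ?I \<times> ?I)"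
      by (simp add: case_prod_unfold)
    then show ?thesis
      using xc by (subst (asm) at_within_open) (auto intro: open_Times)
  qed
  have oI: "open (?I \<times> ?I)" by (intro open_Times open_greaterThanLessThan)
  have YU: "(x, Y (x, c)) \<in> U" if "x \<in> ?I" "c \<in> ?I" for x c
    using inK[of x c] that rU by auto
  \<comment> \<open>On the diagonal the segment collapses, and \<open>E\<close> becomes the
    exponential of the integral of \<open>my\<close> along the solution. This expresses the
    derivative of \<open>Y\<close> through \<open>Y\<close>, as the bootstrap requires.\<close>
  have Ediag: "E (x, c, c) = exp (x * integral {0..1} (\<lambda>t. my (x * t, Y (x * t, c))))" if "x \<in> ?I" "c \<in> ?I" for x c
  proof -
    have xc: "\<bar>x\<bar> \<le> d" "\<bar>c\<bar> \<le> d" using that by auto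
    have "G (x * t, c, c) = my (x * t, Y (x * t, c))" if t: "t \<in> {0..1}" for t
      using scale[OF xc(1) t] cl_id[OF inK[OF scale[OF xc(1) t] xc(2)]]
      by (simp add: G_def clamp_to_id)
    then have "integral {0..1} (\<lambda>t. G (x * t, c, c)) = integral {0..1} (\<lambda>t. my (x * t, Y (x * t, c)))"
      by (intro integral_cong) simp
    then show ?thesis by (simp add: E_def)
  qed
  have sY: "smooth_on (?I \<times> ?I) Y"
  proof (rule smooth_on_bootstrap[OF oI])
    fix z assume z: "z \<in> ?I \<times> ?I"
    then show "(Y has_derivative (\<lambda>v. m (fst z, Y z) * fst v + E (fst z, snd z, snd z) * snd v)) (at z)"
      using Yd[of "fst z" "snd z"] by auto
  next
    fix k and v :: "real \<times> real"
    assume Yk: "Ck_on k (?I \<times> ?I) Y"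
    note cf = smooth_onD[OF smooth_on_fst[OF _ smooth_on_id]]
    have 1: "Ck_on k (?I \<times> ?I) (\<lambda>z. m (fst z, Y z))"
      by (rule Ck_on_compose[OF oI _ Ck_on_Pair[OF oI cf[OF oI oI] Yk] smooth_onD[OF m]])
         (use YU in force)
    \<comment> \<open>An open set around the square times the unit interval on which the rescaled
      time stays admissible.\<close>
    define T where "T = {q :: (real \<times> real) \<times> real. fst (fst q) * snd q \<in> ?I \<and> snd (fst q) \<in> ?I}"
    have T: "open T"
      unfolding T_def greaterThanLessThan_iff
      by (intro open_Collect_conj open_Collect_less continuous_intros)
    have sT: "smooth_on T (\<lambda>q. fst (fst q) * snd q)" "smooth_on T (\<lambda>q. snd (fst q))"
      by (intro smooth_intros T)+
    have YT: "Ck_on k T (\<lambda>q. Y (fst (fst q) * snd q, snd (fst q)))"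
      by (rule Ck_on_compose[OF T _ Ck_on_Pair[OF T smooth_onD[OF sT(1)] smooth_onD[OF sT(2)]] Yk])
         (auto simp: T_def)
    have "Ck_on k T (\<lambda>q. my (fst (fst q) * snd q, Y (fst (fst q) * snd q, snd (fst q))))"
      by (rule Ck_on_compose[OF T _ Ck_on_Pair[OF T smooth_onD[OF sT(1)] YT] smooth_onD[OF smy]])
         (use YU in \<open>force simp: T_def\<close>)
    moreover have "(?I \<times> ?I) \<times> {0..1} \<subseteq> T"
    proof
      fix q assume "q \<in> (?I \<times> ?I) \<times> {0..1::real}"
      then obtain x c t where q: "q = ((x, c), t)" "x \<in> ?I" "c \<in> ?I" "t \<in> {0..1}" by auto
      have "\<bar>x * t\<bar> \<le> \<bar>x\<bar> * 1" unfolding abs_mult using q by (intro mult_left_mono) auto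
      then show "q \<in> T" using q by (auto simp: T_def)
    qed
    ultimately have "Ck_on k (?I \<times> ?I) (\<lambda>z. integral {0..1} (\<lambda>t. my (fst z * t, Y (fst z * t, snd z))))"
      using Ck_on_integral_param[OF oI, of T k "\<lambda>q. my (fst (fst q) * snd q, Y (fst (fst q) * snd q, snd (fst q)))"]
      by simp
    then have "Ck_on k (?I \<times> ?I) (\<lambda>z. fst z * integral {0..1} (\<lambda>t. my (fst z * t, Y (fst z * t, snd z))))"
      by (intro Ck_on_mult oI cf)
    from Ck_on_compose[OF oI _ this smooth_onD[OF smooth_on_exp_real]]
    have "Ck_on k (?I \<times> ?I) (\<lambda>z. exp (fst z * integral {0..1} (\<lambda>t. my (fst z * t, Y (fst z * t, snd z)))))"
      by simp
    then have 2: "Ck_on k (?I \<times> ?I) (\<lambda>z. E (fst z, snd z, snd z))"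
      by (rule Ck_on_cong[OF oI, rotated]) (auto simp: Ediag)
    show "Ck_on k (?I \<times> ?I) (\<lambda>z. m (fst z, Y z) * fst v + E (fst z, snd z, snd z) * snd v)"
      by (intro Ck_on_add Ck_on_mult oI 1 2 Ck_on_const)
  qed
  show ?thesis
  proof (rule that[OF d(1) sY YU])
    show "Y (0, 0) = 0" using r by (simp add: clamp_to_id Y0)
    show "E (fst p, snd p, snd p) > 0" for p by (simp add: E_def)
    show "(Y has_derivative (\<lambda>v. m (x, Y (x, c)) * fst v + E (fst (x, c), snd (x, c), snd (x, c)) * snd v)) (at (x, c))"
      if "x \<in> ?I" "c \<in> ?I" for x c using Yd[OF that] by simp
  qed
qed

section \<open>Smooth inverse functions in the plane\<close>

lemma Ck_on_divide:
  fixes f g :: "'a::real_normed_vector \<Rightarrow> real"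
  assumes "open S" "Ck_on k S f" "Ck_on k S g" "\<And>z. z \<in> S \<Longrightarrow> g z \<noteq> 0"
  shows "Ck_on k S (\<lambda>z. f z / g z)"
proof -
  have "Ck_on k S (\<lambda>z. inverse (g z))"
    by (rule Ck_on_compose[OF assms(1) _ assms(3) smooth_onD[OF smooth_on_inverse_real]])
       (use assms(4) in auto)
  then show ?thesis
    unfolding divide_inverse by (rule Ck_on_mult[OF assms(1,2)])
qed

lemma smooth_on_sqrt_real: "smooth_on {0<..} sqrt"
proof (rule smooth_on_bootstrap[where D="\<lambda>z v. v / (2 * sqrt z)"])
  show "(sqrt has_derivative (\<lambda>v. v / (2 * sqrt z))) (at z)" if "z \<in> {0<..}" for z
    using DERIV_real_sqrt[of z] that
    by (intro has_derivative_eq_rhs[OF has_field_derivative_imp_has_derivative]) (auto simp: field_simps)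
  show "Ck_on k {0<..} (\<lambda>z. v / (2 * sqrt z))" if "Ck_on k {0<..} sqrt" for k v
    by (intro Ck_on_divide Ck_on_mult Ck_on_const that) auto
qed auto

text \<open>Replaces the abstract inverse by quotients of matrix entries, whose regularity in a
  parameter is visible.\<close>

lemma Cramer_plane:
  fixes L :: "real \<times> real \<Rightarrow> real \<times> real"
  assumes lin: "linear L" and bij: "bij L"
  defines "\<delta> \<equiv> fst (L (1, 0)) * snd (L (0, 1)) - snd (L (1, 0)) * fst (L (0, 1))"
  shows "\<delta> \<noteq> 0"
    "inv L v = ((fst v * snd (L (0, 1)) - snd v * fst (L (0, 1))) / \<delta>,
      (fst (L (1, 0)) * snd v - snd (L (1, 0)) * fst v) / \<delta>)"
proof -
  let ?a = "L (1, 0)" and ?b = "L (0, 1)"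
  have L: "L u = fst u *\<^sub>R ?a + snd u *\<^sub>R ?b" for u
  proof -
    have "u = fst u *\<^sub>R (1, 0) + snd u *\<^sub>R (0, 1)" by (simp add: prod_eq_iff)
    then have "L u = L (fst u *\<^sub>R (1, 0) + snd u *\<^sub>R (0, 1))" by simp
    then show ?thesis by (simp only: linear_add[OF lin] linear_scale[OF lin])
  qed
  have inj: "L u = 0 \<Longrightarrow> u = 0" for u
    using linear_injective_0[OF lin] bij_is_inj[OF bij] by blast
  show \<delta>: "\<delta> \<noteq> 0"
  proof
    assume "\<delta> = 0"
    then have d: "fst ?a * snd ?b = snd ?a * fst ?b" by (simp add: \<delta>_def)
    have "snd ?b *\<^sub>R ?a + (- snd ?a) *\<^sub>R ?b = 0" "fst ?b *\<^sub>R ?a + (- fst ?a) *\<^sub>R ?b = 0"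
      using d by (auto simp: prod_eq_iff mult.commute)
    then have "L (snd ?b, - snd ?a) = 0" "L (fst ?b, - fst ?a) = 0"
      by (subst L, simp)+
    then have "(snd ?b, - snd ?a) = 0" "(fst ?b, - fst ?a) = 0" by (blast intro: inj)+
    then have "?a = 0" by (simp add: prod_eq_iff zero_prod_def)
    then have "(1, 0) = (0 :: real \<times> real)" by (rule inj)
    then show False by (simp add: zero_prod_def)
  qed
  show "inv L v = ((fst v * snd ?b - snd v * fst ?b) / \<delta>, (fst ?a * snd v - snd ?a * fst v) / \<delta>)"
  proof (rule inv_f_eq[OF bij_is_inj[OF bij]])
    have "L ((fst v * snd ?b - snd v * fst ?b) / \<delta>, (fst ?a * snd v - snd ?a * fst v) / \<delta>)
      = (1 / \<delta>) *\<^sub>R ((fst v * snd ?b - snd v * fst ?b) *\<^sub>R ?a + (fst ?a * snd v - snd ?a * fst v) *\<^sub>R ?b)"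
      by (subst L) (simp add: scaleR_add_right)
    also have "(fst v * snd ?b - snd v * fst ?b) *\<^sub>R ?a + (fst ?a * snd v - snd ?a * fst v) *\<^sub>R ?b = \<delta> *\<^sub>R v"
      by (simp add: prod_eq_iff \<delta>_def algebra_simps)
    finally show "L ((fst v * snd ?b - snd v * fst ?b) / \<delta>, (fst ?a * snd v - snd ?a * fst v) / \<delta>) = v"
      using \<delta> by simp
  qed
qed

text \<open>The inverse function theorem supplies \<open>g\<close> with one derivative, the inverse
  of the differential of \<open>f\<close> at \<open>g y\<close>. By Cramer's rule it is rational in
  first derivatives of \<open>f\<close> composed with \<open>g\<close>, so bootstrapping
  applies.\<close>

lemma smooth_inverse_function:
  fixes f :: "real \<times> real \<Rightarrow> real \<times> real"
  assumes U: "open U" "z0 \<in> U" and f: "smooth_on U f" and inj: "\<And>v. differential f z0 v = 0 \<Longrightarrow> v = 0"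
  obtains U' V g where "open U'" "U' \<subseteq> U" "z0 \<in> U'" "open V" "f z0 \<in> V" "homeomorphism U' V f g" "smooth_on V g"
proof -
  define f' where "f' z = Blinfun (differential f z)" for z
  have fd: "(f has_derivative differential f z) (at z)" if "z \<in> U" for z
    by (rule smooth_on_has_derivative[OF f that])
  have f': "blinfun_apply (f' z) = differential f z" if "z \<in> U" for z
    unfolding f'_def by (rule bounded_linear_Blinfun_apply[OF has_derivative_bounded_linear[OF fd[OF that]]])
  have f'c: "continuous_on U f'"
  proof (rule continuous_on_blinfun_componentwise)
    fix i :: "real \<times> real"
    show "continuous_on U (\<lambda>z. blinfun_apply (f' z) i)"
      by (rule continuous_on_eq[OF smooth_on_continuous[OF smooth_on_differential[OF f]]]) (simp add: f')
  qed
  have lin: "linear (differential f z)" if "z \<in> U" for z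
    by (rule bounded_linear.linear[OF has_derivative_bounded_linear[OF fd[OF that]]])
  obtain h where h: "linear h" "h \<circ> differential f z0 = id"
    using linear_injective_left_inverse[OF lin[OF U(2)]] inj linear_injective_0[OF lin[OF U(2)]] by blast
  have "Blinfun h o\<^sub>L f' z0 = id_blinfun"
  proof (rule blinfun_eqI)
    fix i
    have "bounded_linear h" using h(1) by (simp add: linear_conv_bounded_linear)
    then show "blinfun_apply (Blinfun h o\<^sub>L f' z0) i = blinfun_apply id_blinfun i"
      using fun_cong[OF h(2), of i] by (simp add: bounded_linear_Blinfun_apply f'[OF U(2)])
  qed
  then obtain U' V g g' where o: "open U'" "U' \<subseteq> U" "z0 \<in> U'" "open V" "f z0 \<in> V" and hom: "homeomorphism U' V f g"
    and gd: "\<And>y. y \<in> V \<Longrightarrow> (g has_derivative (g' y)) (at y)"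
    and g': "\<And>y. y \<in> V \<Longrightarrow> g' y = inv (blinfun_apply (f'(g y)))"
    and bij: "\<And>y. y \<in> V \<Longrightarrow> bij (blinfun_apply (f'(g y)))"
    using inverse_function_theorem[OF U(1) _ f'c U(2), of f "Blinfun h"] fd f' by metis
  have gU: "g y \<in> U" if "y \<in> V" for y
    using hom that o(2) unfolding homeomorphism_def by blast
  define a b \<delta> where "a y = differential f (g y) (1, 0)" and "b y = differential f (g y) (0, 1)"
    and "\<delta> y = fst (a y) * snd (b y) - snd (a y) * fst (b y)" for y
  have bij': "bij (differential f (g y))" if "y \<in> V" for y
    using bij[OF that] f'[OF gU[OF that]] by simp
  note Cr = Cramer_plane[OF lin[OF gU] bij', folded a_def b_def, folded \<delta>_def]
  have gd': "(g has_derivative (\<lambda>v. ((fst v * snd (b y) - snd v * fst (b y)) / \<delta> y,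
      (fst (a y) * snd v - snd (a y) * fst v) / \<delta> y))) (at y)" if "y \<in> V" for y
    by (rule has_derivative_eq_rhs[OF gd[OF that]])
       (simp add: g'[OF that] f'[OF gU[OF that]] Cr(2)[OF that that] fun_eq_iff)
  have "smooth_on V g"
  proof (rule smooth_on_bootstrap[OF o(4) gd'])
    fix k v assume g: "Ck_on k V g"
    have ab: "Ck_on k V a" "Ck_on k V b"
      unfolding a_def b_def
      by (rule Ck_on_compose[OF o(4) _ g smooth_onD[OF smooth_on_differential[OF f]]]; use gU in blast)+
    note l = Ck_on_bounded_linear[OF bounded_linear_fst o(4)] Ck_on_bounded_linear[OF bounded_linear_snd o(4)]
    have d: "Ck_on k V \<delta>"
      unfolding \<delta>_def diff_conv_add_uminus
      by (intro Ck_on_add o(4) Ck_on_mult l ab Ck_on_bounded_linear[OF bounded_linear_minus[OF bounded_linear_ident]])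
    show "Ck_on k V (\<lambda>y. ((fst v * snd (b y) - snd v * fst (b y)) / \<delta> y,
      (fst (a y) * snd v - snd (a y) * fst v) / \<delta> y))"
      unfolding diff_conv_add_uminus
      by (intro Ck_on_Pair Ck_on_divide Ck_on_add o(4) Ck_on_mult l ab d Ck_on_const Cr(1)
          Ck_on_bounded_linear[OF bounded_linear_minus[OF bounded_linear_ident]])
  qed
  then show ?thesis by (rule that[OF o hom])
qed

section \<open>Null coordinates of a Lorentzian metric\<close>

text \<open>The coordinate is the initial value of the solution of \<open>dy/dx = m\<close> through a point.\<close>

lemma straightening_coordinate:
  fixes m :: "real \<times> real \<Rightarrow> real"
  assumes U: "open U" "(0, 0) \<in> U" and m: "smooth_on U m"
  obtains V w where "open V" "(0, 0) \<in> V" "V \<subseteq> U" "smooth_on V w"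
    "\<And>p. p \<in> V \<Longrightarrow> differential w p (1, m p) = 0" "\<And>p. p \<in> V \<Longrightarrow> differential w p (0, 1) \<noteq> (0 :: real)"
proof -
  obtain d Y E where d: "d > 0" and Y: "smooth_on ({-d<..<d} \<times> {-d<..<d}) Y"
    and YU: "\<And>x c. x \<in> {-d<..<d} \<Longrightarrow> c \<in> {-d<..<d} \<Longrightarrow> (x, Y (x, c)) \<in> U"
    and Y0: "Y (0, 0) = 0" and E: "\<And>p. E p > (0 :: real)"
    and Yd: "\<And>x c. x \<in> {-d<..<d} \<Longrightarrow> c \<in> {-d<..<d} \<Longrightarrow>
      (Y has_derivative (\<lambda>v. m (x, Y (x, c)) * fst v + E (x, c) * snd v)) (at (x, c))"
    by (rule scalar_flow[OF U m]) blast
  let ?S = "{-d<..<d} \<times> {-d<..<d}"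
  have S: "open ?S" by (intro open_Times open_greaterThanLessThan)
  define f where "f p = (fst p, Y p)" for p
  have f: "smooth_on ?S f"
    unfolding f_def[abs_def] by (intro smooth_intros S Y)
  have fd: "(f has_derivative (\<lambda>v. (fst v, m (f p) * fst v + E p * snd v))) (at p)" if "p \<in> ?S" for p
  proof -
    have "(Y has_derivative (\<lambda>v. m (f p) * fst v + E p * snd v)) (at p)"
      using Yd[of "fst p" "snd p"] that by (auto simp: f_def)
    then show ?thesis unfolding f_def[abs_def] by (auto intro!: derivative_eq_intros)
  qed
  have z: "(0, 0) \<in> ?S" using d by simp
  have "v = 0" if "differential f (0, 0) v = 0" for v
    using that frechet_derivative_at[OF fd[OF z], symmetric] E[of "(0, 0)"]
    by (auto simp: prod_eq_iff zero_prod_def)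
  then obtain U' V g where o: "open U'" "U' \<subseteq> ?S" "(0, 0) \<in> U'" "open V" "f (0, 0) \<in> V"
    and hom: "homeomorphism U' V f g" and g: "smooth_on V g"
    by (rule smooth_inverse_function[OF S z f]) blast
  have fU': "f p \<in> V" "g (f p) = p" if "p \<in> U'" for p
    using hom that unfolding homeomorphism_def by auto
  have gV: "g q \<in> U'" "f (g q) = q" if "q \<in> V" for q
    using hom that unfolding homeomorphism_def by auto
  define w where "w q = snd (g q)" for q
  have sw: "smooth_on V w" unfolding w_def[abs_def] by (intro smooth_intros o g)
  \<comment> \<open>Obtained by differentiating \<open>w (f (x, c)) = c\<close>: the map
    \<open>f\<close> sends the \<open>x\<close>-direction to \<open>(1, m)\<close>, tangent to the
    solution curves, and the \<open>c\<close>-direction to \<open>(0, E)\<close>.\<close>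
  have key: "differential w q (fst v, m q * fst v + E (g q) * snd v) = snd v" if q: "q \<in> V" for q v
  proof -
    have p: "g q \<in> ?S" using gV(1)[OF q] o(2) by blast
    have wd: "(w has_derivative differential w q) (at q)" by (rule smooth_on_has_derivative[OF sw q])
    have "((\<lambda>p. w (f p)) has_derivative (\<lambda>v. differential w q (fst v, m q * fst v + E (g q) * snd v))) (at (g q))"
      using has_derivative_compose[OF fd[OF p], of w "differential w q"] wd by (simp add: gV(2)[OF q])
    moreover have "((\<lambda>p. w (f p)) has_derivative snd) (at (g q))"
    proof (rule has_derivative_transform_within_open[OF _ o(1) gV(1)[OF q]])
      show "(snd has_derivative snd) (at (g q))" by (auto intro!: derivative_eq_intros)
      show "snd p = w (f p)" if "p \<in> U'" for p using fU'[OF that] by (simp add: w_def)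
    qed
    ultimately have "(\<lambda>v. differential w q (fst v, m q * fst v + E (g q) * snd v)) = snd"
      by (rule has_derivative_unique)
    then show ?thesis by (rule fun_cong)
  qed
  show ?thesis
  proof (rule that[OF o(4) _ _ sw])
    show "(0, 0) \<in> V" using o(5) Y0 by (simp add: f_def)
    show "V \<subseteq> U"
    proof
      fix q assume q: "q \<in> V"
      have "g q \<in> ?S" using gV(1)[OF q] o(2) by blast
      then have "(fst (g q), Y (fst (g q), snd (g q))) \<in> U" by (intro YU) auto
      then show "q \<in> U" using gV(2)[OF q] by (simp add: f_def)
    qed
    fix q assume q: "q \<in> V"
    show "differential w q (1, m q) = 0" using key[OF q, of "(1, 0)"] by simp
    show "differential w q (0, 1) \<noteq> 0"
    proof
      assume 0: "differential w q (0, 1) = 0"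
      have "linear (differential w q)"
        by (rule bounded_linear.linear[OF has_derivative_bounded_linear[OF smooth_on_has_derivative[OF sw q]]])
      from linear_scale[OF this, of "E (g q)" "(0, 1)"] have "differential w q (0, E (g q)) = 0" using 0 by simp
      then show False using key[OF q, of "(0, 1)"] by simp
    qed
  qed
qed

text \<open>These identities factor the form \<open>a x^2 + 2 b x y + c y^2\<close> as
  \<open>r (x + (c/r) y) ((a/r) x + y)\<close>. Here \<open>r\<close> is the larger root of
  \<open>r^2 - 2 b r + a c = 0\<close>, chosen because it stays positive where \<open>a\<close> or
  \<open>c\<close> vanishes.\<close>

lemma null_slopes:
  fixes a b c :: real
  assumes "a * c < b * b" "b > 0"
  defines "r \<equiv> b + sqrt (b * b - a * c)"
  shows "r > 0" "a = r * (a / r)" "c = r * (c / r)" "r * (1 + (a / r) * (c / r)) = 2 * b"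
proof -
  show r: "r > 0" using assms(1,2) by (simp add: r_def add_pos_pos)
  then show "a = r * (a / r)" "c = r * (c / r)" by simp_all
  have "(r - b) * (r - b) = b * b - a * c"
    using assms(1) by (simp add: r_def)
  then have "r * r + a * c = 2 * b * r" by (simp add: algebra_simps)
  then show "r * (1 + (a / r) * (c / r)) = 2 * b" using r by (simp add: field_simps)
qed

text \<open>The axes are null at the origin, so nearby one null direction is spanned by
  \<open>(1, m)\<close> and the other by \<open>(n, 1)\<close>, with \<open>m\<close> and
  \<open>n\<close> smooth. A function constant along each of them gives the two coordinates.\<close>

lemma null_coordinates:
  fixes A B C :: "real \<times> real \<Rightarrow> real"
  assumes U: "open U" "(0, 0) \<in> U" and A: "smooth_on U A" and B: "smooth_on U B" and C: "smooth_on U C"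
    and 0: "A (0, 0) = 0" "C (0, 0) = 0" "B (0, 0) > 0"
  obtains U' V W G \<rho> where "open U'" "U' \<subseteq> U" "(0, 0) \<in> U'" "open V" "homeomorphism U' V W G"
    "smooth_on U' W" "smooth_on V G"
    "\<And>p v w. p \<in> U' \<Longrightarrow> A p * (fst v * fst w) + B p * (fst v * snd w + snd v * fst w) + C p * (snd v * snd w)
      = \<rho> p * (fst (differential W p v) * snd (differential W p w) + snd (differential W p v) * fst (differential W p w))"
    "\<And>p. p \<in> U' \<Longrightarrow> \<rho> p \<noteq> (0 :: real)"
proof -
  \<comment> \<open>Keeps the radicand positive, where \<open>sqrt\<close> is smooth, and
    \<open>B\<close> positive, so that \<open>r\<close> does not vanish.\<close>
  define U1 where "U1 = {p \<in> U. B p \<in> {0<..} \<and> B p * B p - A p * C p \<in> {0<..}}"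
  have U1eq: "U1 = (U \<inter> B -` {0<..}) \<inter> (U \<inter> (\<lambda>p. B p * B p - A p * C p) -` {0<..})"
    by (auto simp: U1_def)
  have U1: "open U1"
    unfolding U1eq
    by (intro open_Int continuous_open_preimage smooth_on_continuous U A B C smooth_on_diff smooth_on_mult open_greaterThan)
  have "U1 \<subseteq> U" by (auto simp: U1_def)
  have z1: "(0, 0) \<in> U1" using U(2) 0 by (simp add: U1_def)
  define r where "r p = B p + sqrt (B p * B p - A p * C p)" for p
  note s1 = A[THEN smooth_on_subset, OF \<open>U1 \<subseteq> U\<close>] B[THEN smooth_on_subset, OF \<open>U1 \<subseteq> U\<close>]
    C[THEN smooth_on_subset, OF \<open>U1 \<subseteq> U\<close>]
  have sr: "smooth_on U1 r"
    unfolding r_def[abs_def]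
    by (intro smooth_on_add U1 s1 smooth_on_compose[OF U1 _ _ smooth_on_sqrt_real] smooth_on_diff smooth_on_mult)
       (auto simp: U1_def)
  have ac: "A p * C p < B p * B p" "B p > 0" if "p \<in> U1" for p using that by (auto simp: U1_def)
  note ns = null_slopes[OF ac, folded r_def]
  define m where "m p = - (A p / r p)" for p
  define n where "n p = - (C p / r p)" for p
  have r0: "r p \<noteq> 0" if "p \<in> U1" for p using ns(1)[OF that that] by simp
  have sm: "smooth_on U1 m" "smooth_on U1 n"
    unfolding m_def[abs_def] n_def[abs_def] by (intro smooth_intros U1 s1 sr r0; assumption)+
  obtain V1 w1 where V1: "open V1" "(0, 0) \<in> V1" "V1 \<subseteq> U1" "smooth_on V1 w1"
    and w1: "\<And>p. p \<in> V1 \<Longrightarrow> differential w1 p (1, m p) = 0" "\<And>p. p \<in> V1 \<Longrightarrow> differential w1 p (0, 1) \<noteq> (0 :: real)"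
    using straightening_coordinate[OF U1 z1 sm(1)] by metis
  \<comment> \<open>The second null direction is a graph over the second axis; the axes are
    exchanged before it is straightened.\<close>
  define sw :: "real \<times> real \<Rightarrow> real \<times> real" where "sw p = (snd p, fst p)" for p
  have bsw: "bounded_linear sw"
    unfolding sw_def[abs_def] by (intro bounded_linear_Pair bounded_linear_fst bounded_linear_snd)
  have swsw: "sw (sw p) = p" for p by (simp add: sw_def)
  have osw: "open (sw -` S)" if "open S" for S
    by (rule open_vimage[OF that linear_continuous_on[OF bsw]])
  have ssw: "smooth_on (sw -` S) (\<lambda>p. h (sw p))" if "open S" "smooth_on S h" for S and h :: "real \<times> real \<Rightarrow> real"
    by (rule smooth_on_compose[OF osw[OF that(1)] _ smooth_on_linear[OF bsw osw[OF that(1)]] that(2)]) auto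
  have z1': "(0, 0) \<in> sw -` U1" using z1 by (simp add: sw_def)
  obtain V2 w2 where V2: "open V2" "(0, 0) \<in> V2" "V2 \<subseteq> sw -` U1" "smooth_on V2 w2"
    and w2: "\<And>p. p \<in> V2 \<Longrightarrow> differential w2 p (1, n (sw p)) = 0" "\<And>p. p \<in> V2 \<Longrightarrow> differential w2 p (0, 1) \<noteq> (0 :: real)"
    using straightening_coordinate[OF osw[OF U1] z1' ssw[OF U1 sm(2)]] by metis
  define N where "N = V1 \<inter> sw -` V2"
  have N: "open N" "(0, 0) \<in> N" "N \<subseteq> U1"
    using V1 V2(1,2) osw[OF V2(1)] by (auto simp: N_def sw_def)
  define W where "W p = (w1 p, w2 (sw p))" for p
  have sW1: "smooth_on N w1" and sW2: "smooth_on N (\<lambda>p. w2 (sw p))"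
    using smooth_on_subset[OF V1(4)] smooth_on_subset[OF ssw[OF V2(1,4)]] by (auto simp: N_def)
  have sW: "smooth_on N W"
    unfolding W_def[abs_def] by (intro smooth_intros N sW1 sW2)
  define k1 where "k1 p = differential w1 p (0, 1)" for p
  define k2 where "k2 p = differential w2 (sw p) (0, 1)" for p
  have linw: "differential h p v = fst v * differential h p (1, s) + (snd v - s * fst v) * differential h p (0, 1)"
    if "smooth_on S h" "p \<in> S" for S p v s and h :: "real \<times> real \<Rightarrow> real"
  proof -
    have l: "linear (differential h p)"
      by (rule bounded_linear.linear[OF has_derivative_bounded_linear[OF smooth_on_has_derivative[OF that]]])
    have "v = fst v *\<^sub>R (1, s) + (snd v - s * fst v) *\<^sub>R (0, 1)" by (simp add: prod_eq_iff)
    then have "differential h p v = differential h p (fst v *\<^sub>R (1, s) + (snd v - s * fst v) *\<^sub>R (0, 1))" by simp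
    then show ?thesis by (simp only: linear_add[OF l] linear_scale[OF l] real_scaleR_def)
  qed
  have dW: "differential W p v = (k1 p * (snd v - m p * fst v), k2 p * (fst v - n p * snd v))" if p: "p \<in> N" for p v
  proof -
    have p1: "p \<in> V1" and p2: "sw p \<in> V2" using p by (auto simp: N_def)
    have d2: "((\<lambda>p. w2 (sw p)) has_derivative (\<lambda>v. differential w2 (sw p) (sw v))) (at p)"
      by (rule has_derivative_compose[OF bounded_linear_imp_has_derivative[OF bsw] smooth_on_has_derivative[OF V2(4) p2]])
    have "(W has_derivative (\<lambda>v. (differential w1 p v, differential w2 (sw p) (sw v)))) (at p)"
      unfolding W_def[abs_def] by (intro has_derivative_Pair d2 smooth_on_has_derivative[OF V1(4) p1])
    then have "differential W p v = (differential w1 p v, differential w2 (sw p) (sw v))"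
      by (simp add: frechet_derivative_at[symmetric])
    also have "differential w1 p v = k1 p * (snd v - m p * fst v)"
      using linw[OF V1(4) p1, of v "m p"] w1(1)[OF p1] by (simp add: k1_def)
    also have "differential w2 (sw p) (sw v) = k2 p * (fst v - n p * snd v)"
      using linw[OF V2(4) p2, of "sw v" "n p"] w2(1)[OF p2] by (simp add: k2_def swsw) (simp add: sw_def)
    finally show ?thesis .
  qed
  have k: "k1 p \<noteq> 0" "k2 p \<noteq> 0" if "p \<in> N" for p
    using that w1(2) w2(2) by (auto simp: N_def k1_def k2_def)
  have "v = 0" if "differential W (0, 0) v = 0" for v
    using that k[OF N(2)] unfolding dW[OF N(2)]
    by (simp add: m_def n_def 0 prod_eq_iff zero_prod_def)
  then obtain U' V G where o: "open U'" "U' \<subseteq> N" "(0, 0) \<in> U'" "open V" and hom: "homeomorphism U' V W G" and G: "smooth_on V G"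
    by (rule smooth_inverse_function[OF N(1,2) sW]) blast
  \<comment> \<open>The differential of \<open>W\<close> is
    \<open>(k1 (dy - m dx), k2 (dx - n dy))\<close>; dividing by \<open>k1 k2\<close> leaves the
    linear factors of the form, and the 2 offsets the symmetrised product.\<close>
  define \<rho> where "\<rho> p = r p / (2 * (k1 p * k2 p))" for p
  show ?thesis
  proof (rule that[OF o(1) _ o(3,4) hom smooth_on_subset[OF sW o(2)] G])
    show "U' \<subseteq> U" using o(2) N(3) \<open>U1 \<subseteq> U\<close> by blast
    fix p assume "p \<in> U'"
    then have p: "p \<in> N" "p \<in> U1" using o(2) N(3) by auto
    show "\<rho> p \<noteq> 0" using k[OF p(1)] r0[OF p(2)] by (simp add: \<rho>_def)
    fix v w
    have e: "A p = - (r p * m p)" "C p = - (r p * n p)" "2 * B p = r p * (1 + m p * n p)"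
      using ns(4)[OF p(2) p(2)] r0[OF p(2)] by (simp_all add: m_def n_def)
    have "\<rho> p * (fst (differential W p v) * snd (differential W p w) + snd (differential W p v) * fst (differential W p w))
      = (\<rho> p * (k1 p * k2 p)) * ((snd v - m p * fst v) * (fst w - n p * snd w) + (fst v - n p * snd v) * (snd w - m p * fst w))"
      unfolding dW[OF p(1)] by (simp add: algebra_simps)
    also have "\<rho> p * (k1 p * k2 p) = r p / 2" using k[OF p(1)] by (simp add: \<rho>_def)
    also have "r p / 2 * ((snd v - m p * fst v) * (fst w - n p * snd w) + (fst v - n p * snd v) * (snd w - m p * fst w))
      = A p * (fst v * fst w) + (2 * B p) / 2 * (fst v * snd w + snd v * fst w) + C p * (snd v * snd w)"
      unfolding e by (simp add: field_simps)
    finally show "A p * (fst v * fst w) + B p * (fst v * snd w + snd v * fst w) + C p * (snd v * snd w)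
      = \<rho> p * (fst (differential W p v) * snd (differential W p w) + snd (differential W p v) * fst (differential W p w))"
      by simp
  qed
qed

section \<open>Lorentz numbers in the idempotent basis\<close>

definition lp :: "lorentz \<Rightarrow> real" where "lp a = upart a + vpart a"
definition lm :: "lorentz \<Rightarrow> real" where "lm a = upart a - vpart a"
text \<open>\<open>lnull 1 0\<close> and \<open>lnull 0 1\<close> are the two idempotents. As
  tangent vectors they are the directions of differentiation by the null coordinates
  \<open>s\<close> = \<open>lp\<close> and \<open>t\<close> = \<open>lm\<close>.\<close>

definition lnull :: "real \<Rightarrow> real \<Rightarrow> lorentz" where "lnull s t = Lorentz ((s + t) / 2) ((s - t) / 2)"

lemma lp_lm_simps [simp]:
  "lp 0 = 0" "lm 0 = 0" "lp 1 = 1" "lm 1 = 1" "lp lsigma = 1" "lm lsigma = -1"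
  "lp (a + b) = lp a + lp b" "lm (a + b) = lm a + lm b"
  "lp (a - b) = lp a - lp b" "lm (a - b) = lm a - lm b"
  "lp (- a) = - lp a" "lm (- a) = - lm a"
  "lp (a * b) = lp a * lp b" "lm (a * b) = lm a * lm b"
  "lp (r *\<^sub>R a) = r * lp a" "lm (r *\<^sub>R a) = r * lm a"
  "lp (lcnj a) = lm a" "lm (lcnj a) = lp a"
  "lp (lnull s t) = s" "lm (lnull s t) = t"
  "lp (of_real r) = r" "lm (of_real r) = r"
  by (simp_all add: lp_def lm_def lnull_def field_simps of_real_def)

lemma lorentz_null_eq_iff: "a = b \<longleftrightarrow> lp a = lp b \<and> lm a = lm b"
  by (auto simp: lorentz_eq_iff lp_def lm_def)

lemma lnull_lp_lm [simp]: "lnull (lp a) (lm a) = a"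
  by (simp add: lorentz_null_eq_iff)

lemma lsq_null: "lsq a = lp a * lm a"
  by (simp add: lsq_def lp_def lm_def algebra_simps)

lemma da_dahat_null: "da_dahat v w = (lp v * lm w + lm v * lp w) / 2"
  by (simp add: da_dahat_def lp_def lm_def algebra_simps)

lemma bounded_linear_lp: "bounded_linear lp" and bounded_linear_lm: "bounded_linear lm"
  by (simp_all add: linear_conv_bounded_linear[symmetric] linear_iff)

lemma lnull_conv: "lnull s t = s *\<^sub>R lnull 1 0 + t *\<^sub>R lnull 0 1"
  by (simp add: lorentz_null_eq_iff)

lemma smooth_on_lp: "open S \<Longrightarrow> smooth_on S f \<Longrightarrow> smooth_on S (\<lambda>z. lp (f z))"
  and smooth_on_lm: "open S \<Longrightarrow> smooth_on S f \<Longrightarrow> smooth_on S (\<lambda>z. lm (f z))"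
  by (auto intro: smooth_on_bounded_linear bounded_linear_lp bounded_linear_lm)

lemma smooth_on_lnull:
  assumes "open S" "smooth_on S f" "smooth_on S g" shows "smooth_on S (\<lambda>z. lnull (f z) (g z))"
  by (subst lnull_conv) (intro smooth_intros assms)

lemma has_derivative_lnull:
  assumes "(f has_derivative f') F" "(g has_derivative g') F"
  shows "((\<lambda>z. lnull (f z) (g z)) has_derivative (\<lambda>v. lnull (f' v) (g' v))) F"
  by (subst (1 2) lnull_conv) (intro derivative_intros assms)

lemma linear_null_expand:
  assumes "linear D" shows "D v = lp v *\<^sub>R D (lnull 1 0) + lm v *\<^sub>R D (lnull 0 1)"
proof -
  have "D v = D (lp v *\<^sub>R lnull 1 0 + lm v *\<^sub>R lnull 0 1)"
    using lnull_conv[of "lp v" "lm v"] by simp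
  then show ?thesis by (simp add: linear_add[OF assms] linear_scale[OF assms])
qed

lemma differential_bounded_linear:
  assumes L: "bounded_linear L" and f: "(f has_derivative D) (at z)"
  shows "differential (\<lambda>z. L (f z)) z v = L (differential f z v)"
  using frechet_derivative_at[OF bounded_linear.has_derivative[OF L f]] frechet_derivative_at[OF f]
  by metis

text \<open>Multiplication by \<open>lsigma\<close> is +1 on the \<open>lp\<close> entry and -1 on
  the \<open>lm\<close> entry, so \<open>d_a\<close> differentiates the two entries by s and by t
  respectively, and \<open>d_ahat\<close> the other way round. This decouples the Dirac
  equations.\<close>

lemma d_a_null:
  assumes "smooth_on UNIV f"
  shows "lp (d_a f z) = differential (\<lambda>z. lp (f z)) z (lnull 1 0)"
    "lm (d_a f z) = differential (\<lambda>z. lm (f z)) z (lnull 0 1)"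
    "lp (d_ahat f z) = differential (\<lambda>z. lp (f z)) z (lnull 0 1)"
    "lm (d_ahat f z) = differential (\<lambda>z. lm (f z)) z (lnull 1 0)"
proof -
  have f: "(f has_derivative differential f z) (at z)"
    by (rule smooth_on_has_derivative[OF assms UNIV_I])
  note e = linear_null_expand[OF bounded_linear.linear[OF has_derivative_bounded_linear[OF f]]]
  show "lp (d_a f z) = differential (\<lambda>z. lp (f z)) z (lnull 1 0)"
    "lm (d_a f z) = differential (\<lambda>z. lm (f z)) z (lnull 0 1)"
    "lp (d_ahat f z) = differential (\<lambda>z. lp (f z)) z (lnull 0 1)"
    "lm (d_ahat f z) = differential (\<lambda>z. lm (f z)) z (lnull 1 0)"
    by (simp_all add: differential_bounded_linear[OF bounded_linear_lp f]
        differential_bounded_linear[OF bounded_linear_lm f] d_a_def d_ahat_def e[of 1] e[of lsigma])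
qed

section \<open>The split form of the metric of signature (2,2)\<close>

text \<open>In the matrix coordinates \<open>c11, c12, c21, c22\<close> the form \<open>inner22\<close> is the polarised
  determinant, so null vectors are matrices of rank one.\<close>

definition c11 :: "real ^ 4 \<Rightarrow> real" where "c11 x = - (x $ 0 + x $ 1)"
definition c12 :: "real ^ 4 \<Rightarrow> real" where "c12 x = x $ 2 + x $ 3"
definition c21 :: "real ^ 4 \<Rightarrow> real" where "c21 x = x $ 2 - x $ 3"
definition c22 :: "real ^ 4 \<Rightarrow> real" where "c22 x = x $ 0 - x $ 1"

lemmas c_defs = c11_def c12_def c21_def c22_def

definition mat22 :: "real \<Rightarrow> real \<Rightarrow> real \<Rightarrow> real \<Rightarrow> real ^ 4"
  where "mat22 a b c d = a *\<^sub>R (\<chi> i. if i = 0 \<or> i = 1 then - 1 / 2 else 0)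
    + b *\<^sub>R (\<chi> i. if i = 0 \<or> i = 1 then 0 else 1 / 2)
    + c *\<^sub>R (\<chi> i. if i = 2 then 1 / 2 else if i = 3 then - 1 / 2 else 0)
    + d *\<^sub>R (\<chi> i. if i = 0 then 1 / 2 else if i = 1 then - 1 / 2 else 0)"

lemma four_eq_zero: "(4::4) = 0" by simp

lemma c_simps [simp]:
  "c11 (x + y) = c11 x + c11 y" "c12 (x + y) = c12 x + c12 y"
  "c21 (x + y) = c21 x + c21 y" "c22 (x + y) = c22 x + c22 y"
  "c11 (x - y) = c11 x - c11 y" "c12 (x - y) = c12 x - c12 y"
  "c21 (x - y) = c21 x - c21 y" "c22 (x - y) = c22 x - c22 y"
  "c11 (r *\<^sub>R x) = r * c11 x" "c12 (r *\<^sub>R x) = r * c12 x"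
  "c21 (r *\<^sub>R x) = r * c21 x" "c22 (r *\<^sub>R x) = r * c22 x"
  "c11 (- x) = - c11 x" "c12 (- x) = - c12 x" "c21 (- x) = - c21 x" "c22 (- x) = - c22 x"
  "c11 0 = 0" "c12 0 = 0" "c21 0 = 0" "c22 0 = 0"
  by (simp_all add: c_defs algebra_simps)

lemma c_mat22 [simp]:
  "c11 (mat22 a b c d) = a" "c12 (mat22 a b c d) = b" "c21 (mat22 a b c d) = c" "c22 (mat22 a b c d) = d"
  by (simp_all add: c_defs mat22_def)

lemma c_eqI: "c11 x = c11 y \<Longrightarrow> c12 x = c12 y \<Longrightarrow> c21 x = c21 y \<Longrightarrow> c22 x = c22 y \<Longrightarrow> x = y"
  by (auto simp: c_defs vec_eq_iff forall_4 four_eq_zero)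

lemma inner22_c: "inner22 x y = (c11 x * c22 y + c22 x * c11 y - c12 x * c21 y - c21 x * c12 y) / 2"
  by (simp add: inner22_def c_defs algebra_simps)

lemma bounded_linear_c: "bounded_linear c11" "bounded_linear c12" "bounded_linear c21" "bounded_linear c22"
  by (simp_all add: linear_conv_bounded_linear[symmetric] linear_iff)

lemma inner22_simps [simp]:
  "inner22 (x + y) z = inner22 x z + inner22 y z" "inner22 z (x + y) = inner22 z x + inner22 z y"
  "inner22 (x - y) z = inner22 x z - inner22 y z" "inner22 z (x - y) = inner22 z x - inner22 z y"
  "inner22 (r *\<^sub>R x) z = r * inner22 x z" "inner22 z (r *\<^sub>R x) = r * inner22 z x"
  by (simp_all add: inner22_c field_simps)

lemma smooth_on_c:
  assumes "open S" "smooth_on S F"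
  shows "smooth_on S (\<lambda>z. c11 (F z))" "smooth_on S (\<lambda>z. c12 (F z))"
    "smooth_on S (\<lambda>z. c21 (F z))" "smooth_on S (\<lambda>z. c22 (F z))"
  using assms bounded_linear_c by (auto intro: smooth_on_bounded_linear)

lemma smooth_on_mat22:
  assumes "open S" "smooth_on S a" "smooth_on S b" "smooth_on S c" "smooth_on S d"
  shows "smooth_on S (\<lambda>z. mat22 (a z) (b z) (c z) (d z))"
  unfolding mat22_def by (intro smooth_intros assms)

lemma has_derivative_mat22:
  assumes "(a has_derivative a') F" "(b has_derivative b') F"
    "(c has_derivative c') F" "(d has_derivative d') F"
  shows "((\<lambda>z. mat22 (a z) (b z) (c z) (d z)) has_derivative
    (\<lambda>v. mat22 (a' v) (b' v) (c' v) (d' v))) F"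
  unfolding mat22_def by (intro derivative_intros assms)

section \<open>Conformal maps and their mean curvature\<close>

lemma da_dahat_nondegenerate: "(\<And>w. da_dahat v w = 0) \<Longrightarrow> v = 0"
  using da_dahat_null[of v "lnull 1 0"] da_dahat_null[of v "lnull 0 1"]
  by (simp add: lorentz_null_eq_iff)

lemma da_dahat_diff: "da_dahat (v - v') w = da_dahat v w - da_dahat v' w"
  by (simp add: da_dahat_null field_simps)

text \<open>The metric pairs each null direction only with the other one, so the coefficient along s
  of the tangential part comes from the product with the t-direction and conversely; the 2 appears
  because \<open>da_dahat\<close> pairs the two directions to 1/2.\<close>

lemma normal_part_conformal:
  assumes lin: "linear (differential F z)" and \<rho>: "\<rho> \<noteq> 0"
    and conf: "\<And>v w. induced_metric F z v w = \<rho> * da_dahat v w"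
  shows "normal_part F z y = y - differential F z
    (lnull (2 * inner22 y (differential F z (lnull 0 1)) / \<rho>) (2 * inner22 y (differential F z (lnull 1 0)) / \<rho>))"
proof -
  let ?D = "differential F z"
  define k where "k = lnull (2 * inner22 y (?D (lnull 0 1)) / \<rho>) (2 * inner22 y (?D (lnull 1 0)) / \<rho>)"
  have tang: "inner22 (?D a) (?D b) = \<rho> * da_dahat a b" for a b
    using conf by (simp add: induced_metric_def)
  have yk: "inner22 y (?D v) = \<rho> * da_dahat k v" for v
  proof -
    have "?D v = lp v *\<^sub>R ?D (lnull 1 0) + lm v *\<^sub>R ?D (lnull 0 1)"
      by (rule linear_null_expand[OF lin])
    then show ?thesis using \<rho> by (simp add: k_def da_dahat_null field_simps)
  qed
  show ?thesis
    unfolding normal_part_def k_def[symmetric]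
  proof (rule the_equality)
    show "(\<forall>v. inner22 (y - ?D k) (?D v) = 0) \<and> y - (y - ?D k) \<in> range ?D"
      using yk tang by simp
  next
    fix n assume n: "(\<forall>v. inner22 n (?D v) = 0) \<and> y - n \<in> range ?D"
    then obtain k' where k': "n = y - ?D k'" by (metis add_diff_cancel_left' diff_add_cancel rangeE)
    have "k - k' = 0"
    proof (rule da_dahat_nondegenerate)
      fix w
      have "inner22 (y - ?D k') (?D w) = 0" using n k' by simp
      then have "\<rho> * da_dahat (k - k') w = 0" using yk tang by (simp add: da_dahat_diff right_diff_distrib)
      then show "da_dahat (k - k') w = 0" using \<rho> by simp
    qed
    then show "n = y - ?D k" using k' \<open>k - k' = 0\<close> by simp
  qed
qed

text \<open>For a multiple of \<open>da_dahat\<close> the trace is the difference of the two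
  diagonal values of the second fundamental form, divided by \<open>\<rho>\<close>. Taking normal
  parts is additive, and \<open>U\<close> is already normal, so the projection leaves it
  alone.\<close>

lemma mean_curvature_conformal:
  assumes lin: "linear (differential F z)" and \<rho>: "\<rho> \<noteq> 0"
    and conf: "\<And>v w. induced_metric F z v w = \<rho> * da_dahat v w"
    and U: "U = differential (\<lambda>x. differential F x 1) z 1 - differential (\<lambda>x. differential F x lsigma) z lsigma"
    and normal: "inner22 U (differential F z (lnull 1 0)) = 0" "inner22 U (differential F z (lnull 0 1)) = 0"
  shows "mean_curvature F z = (1 / (2 * \<rho>)) *\<^sub>R U"
proof -
  note np = normal_part_conformal[OF lin \<rho> conf]
  let ?B = "second_fundamental_form F z"
  let ?D = "differential F z"
  have diff: "normal_part F z x - normal_part F z y = normal_part F z (x - y)" for x y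
  proof -
    have "lnull (2 * inner22 (x - y) (?D (lnull 0 1)) / \<rho>) (2 * inner22 (x - y) (?D (lnull 1 0)) / \<rho>)
      = lnull (2 * inner22 x (?D (lnull 0 1)) / \<rho>) (2 * inner22 x (?D (lnull 1 0)) / \<rho>)
      - lnull (2 * inner22 y (?D (lnull 0 1)) / \<rho>) (2 * inner22 y (?D (lnull 1 0)) / \<rho>)"
      by (simp add: lorentz_null_eq_iff diff_divide_distrib right_diff_distrib)
    then show ?thesis unfolding np by (simp add: linear_diff[OF lin])
  qed
  have "normal_part F z U = U"
    unfolding np normal using linear_0[OF lin] by (simp add: lnull_def lorentz_eq_iff zero_lorentz_def)
  then have BB: "?B 1 1 - ?B lsigma lsigma = U"
    unfolding second_fundamental_form_def diff U by simp
  have "mean_curvature F z = (1 / 2) *\<^sub>R ((1 / (\<rho> * - \<rho>)) *\<^sub>R (- \<rho> *\<^sub>R ?B 1 1 + \<rho> *\<^sub>R ?B lsigma lsigma))"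
    by (simp add: mean_curvature_def metric_trace_def conf da_dahat_null)
  also have "- \<rho> *\<^sub>R ?B 1 1 + \<rho> *\<^sub>R ?B lsigma lsigma = (- \<rho>) *\<^sub>R U"
    by (simp add: BB[symmetric] algebra_simps)
  finally show ?thesis using \<rho> by (simp add: field_simps)
qed

section \<open>Line integrals\<close>

text \<open>The fundamental theorem of calculus along the path. Off a finite set and the end points
  the derivative within \<open>{0..1}\<close> is the two-sided one, which suffices.\<close>

lemma has_path_integral_primitive:
  assumes X: "\<And>z. (X has_derivative (\<lambda>v. f z * v + h z * lcnj v)) (at z)" and "valid_path \<gamma>"
  shows "has_path_integral f h \<gamma> (X (pathfinish \<gamma>) - X (pathstart \<gamma>))"
proof -
  obtain S where S: "finite S" and c: "continuous_on {0..1} \<gamma>" and d: "\<gamma> C1_differentiable_on ({0..1} - S)"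
    using assms(2) unfolding valid_path_def piecewise_C1_differentiable_on_def by blast
  obtain D where D: "\<And>t. t \<in> {0..1} - S \<Longrightarrow> (\<gamma> has_vector_derivative D t) (at t)"
    using d unfolding C1_differentiable_on_def by blast
  have Xc: "continuous_on UNIV X"
    using X has_derivative_continuous by (blast intro: continuous_at_imp_continuous_on)
  show ?thesis
    unfolding has_path_integral_def pathfinish_def pathstart_def
  proof (rule fundamental_theorem_of_calculus_interior_strong[OF S])
    show "continuous_on {0..1} (\<lambda>t. X (\<gamma> t))"
      by (rule continuous_on_compose2[OF Xc c]) simp
    fix t assume t: "t \<in> {0<..<1} - S"
    have vd: "vector_derivative \<gamma> (at t within {0..1}) = D t"
      using t by (intro vector_derivative_at_within_ivl D) auto
    have dt: "(\<gamma> has_derivative (\<lambda>x. x *\<^sub>R D t)) (at t)"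
      using D[of t] t by (simp add: has_vector_derivative_def)
    have "((\<lambda>t. X (\<gamma> t)) has_derivative (\<lambda>x. f (\<gamma> t) * (x *\<^sub>R D t) + h (\<gamma> t) * lcnj (x *\<^sub>R D t))) (at t)"
      by (rule has_derivative_compose[OF dt X])
    moreover have "f (\<gamma> t) * (x *\<^sub>R D t) + h (\<gamma> t) * lcnj (x *\<^sub>R D t) = x *\<^sub>R (f (\<gamma> t) * D t + h (\<gamma> t) * lcnj (D t))" for x
      by (simp add: lorentz_null_eq_iff algebra_simps)
    ultimately show "((\<lambda>t. X (\<gamma> t)) has_vector_derivative
        (let v = vector_derivative \<gamma> (at t within {0..1}) in f (\<gamma> t) * v + h (\<gamma> t) * lcnj v)) (at t)"
      by (simp add: has_vector_derivative_def vd Let_def)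
  qed simp
qed

text \<open>The differential of the surface given by the representation formulas, in matrix coordinates:
  its columns along the two null directions have rank one.\<close>

definition spinor_differential ::
    "(lorentz \<Rightarrow> lorentz) \<Rightarrow> (lorentz \<Rightarrow> lorentz) \<Rightarrow> (lorentz \<Rightarrow> lorentz) \<Rightarrow> (lorentz \<Rightarrow> lorentz) \<Rightarrow>
      lorentz \<Rightarrow> lorentz \<Rightarrow> real ^ 4"
  where "spinor_differential \<phi>1 \<phi>2 \<psi>1 \<psi>2 z v = mat22
    (lp (\<psi>1 z) * lm (\<phi>1 z) * lp v + lp (\<phi>1 z) * lm (\<psi>1 z) * lm v)
    (lp (\<psi>1 z) * lm (\<phi>2 z) * lp v + lp (\<phi>1 z) * lm (\<psi>2 z) * lm v)
    (lp (\<psi>2 z) * lm (\<phi>1 z) * lp v + lp (\<phi>2 z) * lm (\<psi>1 z) * lm v)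
    (lp (\<psi>2 z) * lm (\<phi>2 z) * lp v + lp (\<phi>2 z) * lm (\<psi>2 z) * lm v)"

text \<open>In the idempotent basis the four prescribed values have the entries
  \<open>(c11, c11)\<close>, \<open>(c22, c22)\<close>, \<open>(c12, c21)\<close> and
  \<open>(c21, c12)\<close>, and the integrands are the matching components of the spinor
  differential.\<close>

lemma weierstrass_formulas_primitive:
  assumes F: "\<And>z. (F has_derivative spinor_differential \<phi>1 \<phi>2 \<psi>1 \<psi>2 z) (at z)" and "F a\<^sub>0 = 0"
  shows "weierstrass_formulas a\<^sub>0 \<phi>1 \<phi>2 \<psi>1 \<psi>2 F"
proof -
  note b = bounded_linear.has_derivative[OF _ F]
  have e: "- of_real (X $ 0 + X $ 1) = lnull (c11 X) (c11 X)" "of_real (X $ 0 - X $ 1) = lnull (c22 X) (c22 X)"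
    "of_real (X $ 2) + lsigma * of_real (X $ 3) = lnull (c12 X) (c21 X)"
    "of_real (X $ 2) - lsigma * of_real (X $ 3) = lnull (c21 X) (c12 X)" for X :: "real ^ 4"
    by (simp_all add: lorentz_null_eq_iff c_defs)
  have 1: "((\<lambda>z. lnull (c11 (F z)) (c11 (F z))) has_derivative
      (\<lambda>v. \<psi>1 z * lcnj (\<phi>1 z) * v + lcnj (\<psi>1 z) * \<phi>1 z * lcnj v)) (at z)" for z
    by (rule has_derivative_eq_rhs[OF has_derivative_lnull[OF b b]])
       (auto simp: bounded_linear_c lorentz_null_eq_iff spinor_differential_def fun_eq_iff mult_ac)
  have 2: "((\<lambda>z. lnull (c22 (F z)) (c22 (F z))) has_derivative
      (\<lambda>v. \<psi>2 z * lcnj (\<phi>2 z) * v + lcnj (\<psi>2 z) * \<phi>2 z * lcnj v)) (at z)" for z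
    by (rule has_derivative_eq_rhs[OF has_derivative_lnull[OF b b]])
       (auto simp: bounded_linear_c lorentz_null_eq_iff spinor_differential_def fun_eq_iff mult_ac)
  have 3: "((\<lambda>z. lnull (c12 (F z)) (c21 (F z))) has_derivative
      (\<lambda>v. \<psi>1 z * lcnj (\<phi>2 z) * v + lcnj (\<psi>2 z) * \<phi>1 z * lcnj v)) (at z)" for z
    by (rule has_derivative_eq_rhs[OF has_derivative_lnull[OF b b]])
       (auto simp: bounded_linear_c lorentz_null_eq_iff spinor_differential_def fun_eq_iff mult_ac)
  have 4: "((\<lambda>z. lnull (c21 (F z)) (c12 (F z))) has_derivative
      (\<lambda>v. \<psi>2 z * lcnj (\<phi>1 z) * v + lcnj (\<psi>1 z) * \<phi>2 z * lcnj v)) (at z)" for z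
    by (rule has_derivative_eq_rhs[OF has_derivative_lnull[OF b b]])
       (auto simp: bounded_linear_c lorentz_null_eq_iff spinor_differential_def fun_eq_iff mult_ac)
  have z: "lnull 0 0 = 0" by (simp add: lorentz_null_eq_iff)
  show ?thesis
    unfolding weierstrass_formulas_def Let_def e
    using has_path_integral_primitive[OF 1] has_path_integral_primitive[OF 2]
      has_path_integral_primitive[OF 3] has_path_integral_primitive[OF 4] assms(2) z
    by fastforce
qed

text \<open>The straight path from the base point to \<open>z\<close> already fixes the value at
  \<open>z\<close>.\<close>

lemma weierstrass_formulas_unique:
  assumes "weierstrass_formulas a\<^sub>0 \<phi>1 \<phi>2 \<psi>1 \<psi>2 F" "weierstrass_formulas a\<^sub>0 \<phi>1 \<phi>2 \<psi>1 \<psi>2 G"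
  shows "F = G"
proof
  fix z
  have u: "I = J" if "has_path_integral f h \<gamma> I" "has_path_integral f h \<gamma> J" for f h \<gamma> I J
    using that has_integral_unique unfolding has_path_integral_def by blast
  have v: "valid_path (linepath a\<^sub>0 z) \<and> pathstart (linepath a\<^sub>0 z) = a\<^sub>0" by simp
  note w = assms[unfolded weierstrass_formulas_def Let_def, rule_format, OF v, simplified]
  have "F z $ 0 + F z $ 1 = G z $ 0 + G z $ 1"
    using u[of _ _ _ "- of_real (F z $ 0 + F z $ 1)" "- of_real (G z $ 0 + G z $ 1)"] w
    by (force simp: lorentz_null_eq_iff)
  moreover have "F z $ 0 - F z $ 1 = G z $ 0 - G z $ 1"
    using u[of _ _ _ "of_real (F z $ 0 - F z $ 1)" "of_real (G z $ 0 - G z $ 1)"] w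
    by (force simp: lorentz_null_eq_iff)
  moreover have "of_real (F z $ 2) + lsigma * of_real (F z $ 3) = of_real (G z $ 2) + lsigma * of_real (G z $ 3)"
    using u w by blast
  ultimately show "F z = G z"
    by (intro c_eqI) (auto simp: c_defs lorentz_null_eq_iff)
qed

section \<open>From spinors to the surface\<close>

lemma smooth_on_UNIV_has_derivative: "smooth_on UNIV f \<Longrightarrow> (f has_derivative differential f z) (at z)"
  by (rule smooth_on_has_derivative[OF _ UNIV_I])

lemma differential_eqI: "(f has_derivative D) (at z) \<Longrightarrow> differential f z v = D v"
  by (simp add: frechet_derivative_at[symmetric])

lemma differential_mult:
  fixes f g :: "'a::real_normed_vector \<Rightarrow> real"
  assumes "smooth_on UNIV f" "smooth_on UNIV g"
  shows "differential (\<lambda>z. f z * g z) z v = f z * differential g z v + differential f z v * g z"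
  by (rule differential_eqI[OF has_derivative_mult[OF assms[THEN smooth_on_UNIV_has_derivative]]])

lemma linear_differential: "smooth_on UNIV f \<Longrightarrow> linear (differential f z)"
  by (rule bounded_linear.linear[OF has_derivative_bounded_linear[OF smooth_on_UNIV_has_derivative]])

lemma Poincare_null:
  assumes A: "smooth_on UNIV A" and B: "smooth_on UNIV B"
    and closed: "\<And>z. differential A z (lnull 0 1) = differential B z (lnull 1 0)"
  obtains G where "\<And>z. (G has_derivative (\<lambda>v. A z * lp v + B z * lm v)) (at z)"
proof -
  have d: "differential (\<lambda>x. A x * lp v + B x * lm v) z w
      = (lp w * differential A z (lnull 1 0) + lm w * differential A z (lnull 0 1)) * lp v
      + (lp w * differential B z (lnull 1 0) + lm w * differential B z (lnull 0 1)) * lm v" for z v w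
  proof -
    have "((\<lambda>x. A x * lp v + B x * lm v) has_derivative
        (\<lambda>w. differential A z w * lp v + differential B z w * lm v)) (at z)"
      by (intro has_derivative_add has_derivative_mult_left smooth_on_UNIV_has_derivative A B)
    then have "differential (\<lambda>x. A x * lp v + B x * lm v) z w
        = differential A z w * lp v + differential B z w * lm v"
      by (rule differential_eqI)
    then show ?thesis
      using linear_null_expand[OF linear_differential[OF A], of z w]
        linear_null_expand[OF linear_differential[OF B], of z w] by simp
  qed
  obtain G where "\<And>z. (G has_derivative (\<lambda>v. A z * lp v + B z * lm v)) (at z)"
  proof (rule Poincare_lemma[of "\<lambda>z v. A z * lp v + B z * lm v"])
    show "smooth_on UNIV (\<lambda>z. A z * lp v + B z * lm v)" for v
      by (intro smooth_intros A B open_UNIV)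
    show "linear (\<lambda>v. A z * lp v + B z * lm v)" for z
      by (simp add: linear_iff algebra_simps)
    show "differential (\<lambda>x. A x * lp v + B x * lm v) z w = differential (\<lambda>x. A x * lp w + B x * lm w) z v" for z v w
      unfolding d closed by (simp add: algebra_simps)
  qed blast
  then show ?thesis by (rule that)
qed

lemma dirac_null_iff:
  assumes "smooth_on UNIV \<phi>" "smooth_on UNIV \<psi>"
  shows "d_a \<phi> z = - (p *\<^sub>R \<psi> z) \<and> d_ahat \<psi> z = - (q *\<^sub>R \<phi> z) \<longleftrightarrow>
    differential (\<lambda>z. lp (\<phi> z)) z (lnull 1 0) = - (p * lp (\<psi> z)) \<and>
    differential (\<lambda>z. lm (\<phi> z)) z (lnull 0 1) = - (p * lm (\<psi> z)) \<and>
    differential (\<lambda>z. lp (\<psi> z)) z (lnull 0 1) = - (q * lp (\<phi> z)) \<and>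
    differential (\<lambda>z. lm (\<psi> z)) z (lnull 1 0) = - (q * lm (\<phi> z))"
  by (simp add: lorentz_null_eq_iff d_a_null[OF assms(1)] d_a_null[OF assms(2)])

text \<open>By the Dirac equations both mixed derivatives equal
  \<open>- q * lp \<phi>i * lm \<phi>j - p * lp \<psi>i * lm \<psi>j\<close>, so the form is closed.
  Each choice of the two indices yields one matrix coordinate of the surface.\<close>

lemma weierstrass_primitive_exists:
  assumes \<phi>i: "smooth_on UNIV \<phi>i" and \<psi>i: "smooth_on UNIV \<psi>i"
    and \<phi>j: "smooth_on UNIV \<phi>j" and \<psi>j: "smooth_on UNIV \<psi>j"
    and i: "\<And>z. d_a \<phi>i z = - (p z *\<^sub>R \<psi>i z) \<and> d_ahat \<psi>i z = - (q z *\<^sub>R \<phi>i z)"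
    and j: "\<And>z. d_a \<phi>j z = - (p z *\<^sub>R \<psi>j z) \<and> d_ahat \<psi>j z = - (q z *\<^sub>R \<phi>j z)"
  obtains G where "\<And>z. (G has_derivative
    (\<lambda>v. lp (\<psi>i z) * lm (\<phi>j z) * lp v + lp (\<phi>i z) * lm (\<psi>j z) * lm v)) (at z)"
proof (rule Poincare_null[of "\<lambda>z. lp (\<psi>i z) * lm (\<phi>j z)" "\<lambda>z. lp (\<phi>i z) * lm (\<psi>j z)"])
  note sm = smooth_on_lp[OF open_UNIV] smooth_on_lm[OF open_UNIV]
  show "smooth_on UNIV (\<lambda>z. lp (\<psi>i z) * lm (\<phi>j z))" "smooth_on UNIV (\<lambda>z. lp (\<phi>i z) * lm (\<psi>j z))"
    by (intro smooth_on_mult sm assms open_UNIV)+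
  show "differential (\<lambda>z. lp (\<psi>i z) * lm (\<phi>j z)) z (lnull 0 1)
      = differential (\<lambda>z. lp (\<phi>i z) * lm (\<psi>j z)) z (lnull 1 0)" for z
    using i[of z, unfolded dirac_null_iff[OF \<phi>i \<psi>i]] j[of z, unfolded dirac_null_iff[OF \<phi>j \<psi>j]]
    by (simp add: differential_mult sm assms)
qed (rule that)

lemma weierstrass_surface_exists:
  assumes "weierstrass_data \<phi>1 \<phi>2 \<psi>1 \<psi>2 p q"
  obtains F where "\<And>z. (F has_derivative spinor_differential \<phi>1 \<phi>2 \<psi>1 \<psi>2 z) (at z)" "F a\<^sub>0 = 0"
proof -
  have d: "smooth_on UNIV \<phi>1" "smooth_on UNIV \<phi>2" "smooth_on UNIV \<psi>1" "smooth_on UNIV \<psi>2"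
    "\<And>z. d_a \<phi>1 z = - (p z *\<^sub>R \<psi>1 z) \<and> d_ahat \<psi>1 z = - (q z *\<^sub>R \<phi>1 z)"
    "\<And>z. d_a \<phi>2 z = - (p z *\<^sub>R \<psi>2 z) \<and> d_ahat \<psi>2 z = - (q z *\<^sub>R \<phi>2 z)"
    using assms by (auto simp: weierstrass_data_def)
  obtain G11 where G11:
    "\<And>z. (G11 has_derivative (\<lambda>v. lp (\<psi>1 z) * lm (\<phi>1 z) * lp v + lp (\<phi>1 z) * lm (\<psi>1 z) * lm v)) (at z)"
    by (rule weierstrass_primitive_exists[OF d(1,3,1,3,5,5)]) (blast intro: that)
  obtain G12 where G12:
    "\<And>z. (G12 has_derivative (\<lambda>v. lp (\<psi>1 z) * lm (\<phi>2 z) * lp v + lp (\<phi>1 z) * lm (\<psi>2 z) * lm v)) (at z)"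
    by (rule weierstrass_primitive_exists[OF d(1,3,2,4,5,6)]) (blast intro: that)
  obtain G21 where G21:
    "\<And>z. (G21 has_derivative (\<lambda>v. lp (\<psi>2 z) * lm (\<phi>1 z) * lp v + lp (\<phi>2 z) * lm (\<psi>1 z) * lm v)) (at z)"
    by (rule weierstrass_primitive_exists[OF d(2,4,1,3,6,5)]) (blast intro: that)
  obtain G22 where G22:
    "\<And>z. (G22 has_derivative (\<lambda>v. lp (\<psi>2 z) * lm (\<phi>2 z) * lp v + lp (\<phi>2 z) * lm (\<psi>2 z) * lm v)) (at z)"
    by (rule weierstrass_primitive_exists[OF d(2,4,2,4,6,6)]) (blast intro: that)
  define F where "F z = mat22 (G11 z) (G12 z) (G21 z) (G22 z)" for z
  have F: "(F has_derivative spinor_differential \<phi>1 \<phi>2 \<psi>1 \<psi>2 z) (at z)" for z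
    unfolding F_def spinor_differential_def by (intro has_derivative_mat22 G11 G12 G21 G22)
  show ?thesis
  proof (rule that)
    show "((\<lambda>z. F z - F a\<^sub>0) has_derivative spinor_differential \<phi>1 \<phi>2 \<psi>1 \<psi>2 z) (at z)" for z
      using has_derivative_diff[OF F has_derivative_const] by simp
  qed simp
qed

lemma spinor_surface_conformal:
  fixes \<phi>1 \<phi>2 \<psi>1 \<psi>2 p q
  defines "\<rho> \<equiv> \<lambda>z. - lsq (\<psi>2 z * \<phi>1 z - \<psi>1 z * \<phi>2 z)"
  assumes data: "weierstrass_data \<phi>1 \<phi>2 \<psi>1 \<psi>2 p q"
    and F: "\<And>z. (F has_derivative spinor_differential \<phi>1 \<phi>2 \<psi>1 \<psi>2 z) (at z)"
  shows "induced_metric F z v w = \<rho> z * da_dahat v w" "conformal_immersion F"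
    "inner22 (mean_curvature F z) (mean_curvature F z) = - 4 * p z * q z / \<rho> z"
proof -
  have sm: "smooth_on UNIV \<phi>1" "smooth_on UNIV \<phi>2" "smooth_on UNIV \<psi>1" "smooth_on UNIV \<psi>2"
    using data by (auto simp: weierstrass_data_def)
  note sml = sm[THEN smooth_on_lp[OF open_UNIV]] sm[THEN smooth_on_lm[OF open_UNIV]]
  have dF: "differential F z = spinor_differential \<phi>1 \<phi>2 \<psi>1 \<psi>2 z" for z
    by (rule frechet_derivative_at[OF F, symmetric])
  have metric: "induced_metric F z v w = \<rho> z * da_dahat v w" for z v w
    by (simp add: induced_metric_def dF spinor_differential_def inner22_c \<rho>_def lsq_null da_dahat_null
        field_simps)
  then show "induced_metric F z v w = \<rho> z * da_dahat v w" .
  have \<rho>: "\<rho> z \<noteq> 0" for z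
    using data by (auto simp: weierstrass_data_def \<rho>_def)
  have sW: "smooth_on UNIV (\<lambda>z. spinor_differential \<phi>1 \<phi>2 \<psi>1 \<psi>2 z v)" for v
    unfolding spinor_differential_def by (intro smooth_on_mat22 smooth_intros sml open_UNIV)
  have sF: "smooth_on UNIV F"
    by (rule smooth_on_derivI[OF open_UNIV F sW])
  have lin: "linear (differential F z)" for z
    by (rule linear_differential[OF sF])
  have "inj (differential F z)" for z
  proof (rule injI)
    fix v w assume vw: "differential F z v = differential F z w"
    have "v - w = 0"
    proof (rule da_dahat_nondegenerate)
      fix u
      have "induced_metric F z (v - w) u = 0"
        by (simp add: induced_metric_def linear_diff[OF lin] vw inner22_c)
      then show "da_dahat (v - w) u = 0" using metric \<rho> by simp
    qed
    then show "v = w" by simp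
  qed
  then show "conformal_immersion F"
    unfolding conformal_immersion_def using sF metric \<rho> by blast
  let ?D = "\<lambda>f v. differential f z v"
  \<comment> \<open>The value of F_uu - F_vv, which is 4 F_st because s = u + v and t = u -
    v.\<close>
  define U where "U = - 4 *\<^sub>R mat22
    (q z * lp (\<phi>1 z) * lm (\<phi>1 z) + p z * lp (\<psi>1 z) * lm (\<psi>1 z))
    (q z * lp (\<phi>1 z) * lm (\<phi>2 z) + p z * lp (\<psi>1 z) * lm (\<psi>2 z))
    (q z * lp (\<phi>2 z) * lm (\<phi>1 z) + p z * lp (\<psi>2 z) * lm (\<psi>1 z))
    (q z * lp (\<phi>2 z) * lm (\<phi>2 z) + p z * lp (\<psi>2 z) * lm (\<psi>2 z))"
  have dirac: "d_a \<phi>1 z = - (p z *\<^sub>R \<psi>1 z) \<and> d_ahat \<psi>1 z = - (q z *\<^sub>R \<phi>1 z)"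
    "d_a \<phi>2 z = - (p z *\<^sub>R \<psi>2 z) \<and> d_ahat \<psi>2 z = - (q z *\<^sub>R \<phi>2 z)"
    using data by (auto simp: weierstrass_data_def)
  note dirac = dirac(1)[unfolded dirac_null_iff[OF sm(1,3)]] dirac(2)[unfolded dirac_null_iff[OF sm(2,4)]]
  \<comment> \<open>All four matrix coordinates \<open>L\<close> follow one pattern: the
    differential has coefficient \<open>x1 * y2\<close> along s and \<open>x2 * y1\<close> along t,
    and the Dirac equations evaluate the mixed derivative.\<close>
  have second: "L (differential (\<lambda>x. differential F x 1) z 1 - differential (\<lambda>x. differential F x lsigma) z lsigma) = L U"
    if L: "bounded_linear L" and c: "\<And>z v. L (spinor_differential \<phi>1 \<phi>2 \<psi>1 \<psi>2 z v) = x1 z * y2 z * lp v + x2 z * y1 z * lm v"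
      and s: "smooth_on UNIV x1" "smooth_on UNIV x2" "smooth_on UNIV y1" "smooth_on UNIV y2"
      and e: "differential x1 z (lnull 0 1) = - q z * x2 z" "differential y2 z (lnull 0 1) = - p z * y1 z"
         "differential x2 z (lnull 1 0) = - p z * x1 z" "differential y1 z (lnull 1 0) = - q z * y2 z"
      and LU: "L U = - 4 * (q z * x2 z * y2 z + p z * x1 z * y1 z)" for L x1 x2 y1 y2
  proof -
    have s1: "smooth_on UNIV (\<lambda>z. x1 z * y2 z)" "smooth_on UNIV (\<lambda>z. x2 z * y1 z)"
      by (intro smooth_intros s open_UNIV)+
    have D: "L (differential (\<lambda>x. differential F x w) z v)
        = lp w * ?D (\<lambda>z. x1 z * y2 z) v + lm w * ?D (\<lambda>z. x2 z * y1 z) v" for v w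
    proof -
      have "L (differential (\<lambda>x. differential F x w) z v)
          = differential (\<lambda>z. L (spinor_differential \<phi>1 \<phi>2 \<psi>1 \<psi>2 z w)) z v"
        unfolding dF by (rule differential_bounded_linear[OF L smooth_on_UNIV_has_derivative[OF sW], symmetric])
      also have "\<dots> = differential (\<lambda>z. (x1 z * y2 z) * lp w + (x2 z * y1 z) * lm w) z v"
        unfolding c ..
      also have "((\<lambda>z. (x1 z * y2 z) * lp w + (x2 z * y1 z) * lm w) has_derivative
          (\<lambda>v. ?D (\<lambda>z. x1 z * y2 z) v * lp w + ?D (\<lambda>z. x2 z * y1 z) v * lm w)) (at z)"
        by (intro has_derivative_add has_derivative_mult_left smooth_on_UNIV_has_derivative s1)
      then have "differential (\<lambda>z. (x1 z * y2 z) * lp w + (x2 z * y1 z) * lm w) z v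
          = ?D (\<lambda>z. x1 z * y2 z) v * lp w + ?D (\<lambda>z. x2 z * y1 z) v * lm w"
        by (rule differential_eqI)
      finally show ?thesis by simp
    qed
    note ex = linear_null_expand[OF linear_differential[OF s1(1)], of z]
      linear_null_expand[OF linear_differential[OF s1(2)], of z]
    have "L (differential (\<lambda>x. differential F x 1) z 1 - differential (\<lambda>x. differential F x lsigma) z lsigma)
        = 2 * ?D (\<lambda>z. x1 z * y2 z) (lnull 0 1) + 2 * ?D (\<lambda>z. x2 z * y1 z) (lnull 1 0)"
      unfolding linear_diff[OF bounded_linear.linear[OF L]] D
      by (simp add: ex(1)[of 1] ex(2)[of 1] ex(1)[of lsigma] ex(2)[of lsigma])
    then show ?thesis
      unfolding LU by (simp add: differential_mult s e algebra_simps)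
  qed
  have U: "U = differential (\<lambda>x. differential F x 1) z 1 - differential (\<lambda>x. differential F x lsigma) z lsigma"
  proof (rule c_eqI)
    show "c11 U = c11 (differential (\<lambda>x. differential F x 1) z 1 - differential (\<lambda>x. differential F x lsigma) z lsigma)"
      by (rule second[of _ "\<lambda>z. lp (\<psi>1 z)" "\<lambda>z. lm (\<phi>1 z)" "\<lambda>z. lp (\<phi>1 z)" "\<lambda>z. lm (\<psi>1 z)", symmetric])
         (simp_all add: bounded_linear_c sml dirac spinor_differential_def U_def)
    show "c12 U = c12 (differential (\<lambda>x. differential F x 1) z 1 - differential (\<lambda>x. differential F x lsigma) z lsigma)"
      by (rule second[of _ "\<lambda>z. lp (\<psi>1 z)" "\<lambda>z. lm (\<phi>2 z)" "\<lambda>z. lp (\<phi>1 z)" "\<lambda>z. lm (\<psi>2 z)", symmetric])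
         (simp_all add: bounded_linear_c sml dirac spinor_differential_def U_def)
    show "c21 U = c21 (differential (\<lambda>x. differential F x 1) z 1 - differential (\<lambda>x. differential F x lsigma) z lsigma)"
      by (rule second[of _ "\<lambda>z. lp (\<psi>2 z)" "\<lambda>z. lm (\<phi>1 z)" "\<lambda>z. lp (\<phi>2 z)" "\<lambda>z. lm (\<psi>1 z)", symmetric])
         (simp_all add: bounded_linear_c sml dirac spinor_differential_def U_def)
    show "c22 U = c22 (differential (\<lambda>x. differential F x 1) z 1 - differential (\<lambda>x. differential F x lsigma) z lsigma)"
      by (rule second[of _ "\<lambda>z. lp (\<psi>2 z)" "\<lambda>z. lm (\<phi>2 z)" "\<lambda>z. lp (\<phi>2 z)" "\<lambda>z. lm (\<psi>2 z)", symmetric])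
         (simp_all add: bounded_linear_c sml dirac spinor_differential_def U_def)
  qed
  \<comment> \<open>\<open>U\<close> combines Z Y^T and X W^T. Each shares a factor with both
    tangent columns X Y^T and Z W^T, and rank-one matrices with a common factor are orthogonal for
    the polarised determinant.\<close>
  have "inner22 U (differential F z (lnull 1 0)) = 0" "inner22 U (differential F z (lnull 0 1)) = 0"
    by (simp_all add: dF spinor_differential_def U_def inner22_c algebra_simps)
  from mean_curvature_conformal[OF lin \<rho> metric U this]
  have "inner22 (mean_curvature F z) (mean_curvature F z) = inner22 U U / (2 * \<rho> z * (2 * \<rho> z))"
    by simp
  \<comment> \<open>Rank-one matrices are null, so only the cross term survives. Its 16, over the 4
    from the square of \<open>2 * \<rho> z\<close>, leaves the constant 4.\<close>
  also have "inner22 U U = - 16 * p z * q z * \<rho> z"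
    by (simp add: U_def inner22_c \<rho>_def lsq_null field_simps)
  finally show "inner22 (mean_curvature F z) (mean_curvature F z) = - 4 * p z * q z / \<rho> z"
    using \<rho>[of z] by (simp add: field_simps)
qed

theorem weierstrass_direct:
  assumes "weierstrass_data \<phi>1 \<phi>2 \<psi>1 \<psi>2 p q"
  shows "\<exists>!F. weierstrass_formulas a\<^sub>0 \<phi>1 \<phi>2 \<psi>1 \<psi>2 F"
    and "weierstrass_formulas a\<^sub>0 \<phi>1 \<phi>2 \<psi>1 \<psi>2 F \<Longrightarrow>
      conformal_immersion F \<and>
      (\<forall>z v w. induced_metric F z v w = - lsq (\<psi>2 z * \<phi>1 z - \<psi>1 z * \<phi>2 z) * da_dahat v w) \<and>
      (\<forall>z. inner22 (mean_curvature F z) (mean_curvature F z) =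
          4 * p z * q z / lsq (\<psi>2 z * \<phi>1 z - \<psi>1 z * \<phi>2 z))"
proof -
  obtain F0 where F0: "\<And>z. (F0 has_derivative spinor_differential \<phi>1 \<phi>2 \<psi>1 \<psi>2 z) (at z)" "F0 a\<^sub>0 = 0"
    using weierstrass_surface_exists[OF assms] by metis
  note w = weierstrass_formulas_primitive[OF F0]
  then show "\<exists>!F. weierstrass_formulas a\<^sub>0 \<phi>1 \<phi>2 \<psi>1 \<psi>2 F"
    using weierstrass_formulas_unique by blast
  assume "weierstrass_formulas a\<^sub>0 \<phi>1 \<phi>2 \<psi>1 \<psi>2 F"
  then have "F = F0" using w weierstrass_formulas_unique by blast
  then show "conformal_immersion F \<and>
      (\<forall>z v w. induced_metric F z v w = - lsq (\<psi>2 z * \<phi>1 z - \<psi>1 z * \<phi>2 z) * da_dahat v w) \<and>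
      (\<forall>z. inner22 (mean_curvature F z) (mean_curvature F z) =
          4 * p z * q z / lsq (\<psi>2 z * \<phi>1 z - \<psi>1 z * \<phi>2 z))"
    using spinor_surface_conformal[OF assms F0(1)] by simp
qed

section \<open>Rank-one factorisation\<close>

text \<open>An angle must satisfy d\<theta> = P dQ - Q dP, so it is obtained by integrating this
  form along rays from 0. Agreement with \<open>P\<close> and \<open>Q\<close> is tested along rays
  too: the inner product of \<open>(P, Q)\<close> with \<open>(cos \<theta>, sin \<theta>)\<close>
  is constant there, and two unit vectors with inner product 1 coincide.\<close>

lemma polar_angle_exists:
  fixes P Q :: "'a::euclidean_space \<Rightarrow> real"
  assumes P: "smooth_on UNIV P" and Q: "smooth_on UNIV Q" and PQ: "\<And>z. P z * P z + Q z * Q z = 1"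
  obtains \<theta> where "smooth_on UNIV \<theta>" "\<And>z. P z = cos (\<theta> z)" "\<And>z. Q z = sin (\<theta> z)"
proof -
  define \<omega> where "\<omega> z v = P z * differential Q z v - Q z * differential P z v" for z v
  define G where "G z = integral {0..1} (\<lambda>t. \<omega> (t *\<^sub>R z) z)" for z
  have \<omega>: "smooth_on UNIV (\<lambda>z. \<omega> z v)" for v
    unfolding \<omega>_def by (intro smooth_intros smooth_on_differential P Q open_UNIV)
  have lin: "linear (\<omega> z)" for z
    using linear_differential[OF P, of z] linear_differential[OF Q, of z]
    by (auto simp: \<omega>_def linear_iff algebra_simps)
  note G = radial_integral[of \<omega>, OF \<omega> lin, folded G_def]
  have Gz: "differential G z z = \<omega> z z" for z
    by (rule trans[OF differential_eqI[OF G(2)] integral_along_ray[of \<omega>, OF \<omega>]])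
  obtain \<theta>0 where \<theta>0: "P 0 = cos \<theta>0" "Q 0 = sin \<theta>0"
    using sincos_total_2pi[of "P 0" "Q 0"] PQ[of 0] by (metis power2_eq_square)
  define \<theta> where "\<theta> z = \<theta>0 + G z" for z
  have unit: "P z * cos (\<theta> z) + Q z * sin (\<theta> z) = 1" for z
  proof -
    define C where "C t = P (t *\<^sub>R z) * cos (\<theta> (t *\<^sub>R z)) + Q (t *\<^sub>R z) * sin (\<theta> (t *\<^sub>R z))" for t
    have line: "((\<lambda>s. g (s *\<^sub>R z)) has_real_derivative differential g (t *\<^sub>R z) z) (at t)"
      if "smooth_on UNIV g" for g :: "'a \<Rightarrow> real" and t
      using smooth_on_has_real_derivative_line[OF that, of 0 z] by simp
    have C: "(C has_real_derivative 0) (at t)" if t: "0 < t" for t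
    proof -
      let ?p = "P (t *\<^sub>R z)" and ?q = "Q (t *\<^sub>R z)"
      let ?p' = "differential P (t *\<^sub>R z) z" and ?q' = "differential Q (t *\<^sub>R z) z"
      \<comment> \<open>\<open>Gz\<close> at the point \<open>t *\<^sub>R z\<close> gives the
        derivative in direction \<open>t *\<^sub>R z\<close>; dividing by \<open>t > 0\<close> gives
        it along \<open>z\<close>. Continuity of \<open>C\<close> later covers
        \<open>t = 0\<close>.\<close>
      have "t * differential G (t *\<^sub>R z) z = t * \<omega> (t *\<^sub>R z) z"
        using Gz[of "t *\<^sub>R z"] linear_scale[OF linear_differential[OF G(1)], of "t *\<^sub>R z" t z]
          linear_scale[OF lin, of "t *\<^sub>R z" t z] by simp
      then have T: "differential G (t *\<^sub>R z) z = ?p * ?q' - ?q * ?p'"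
        using t by (simp add: \<omega>_def)
      have "((\<lambda>s. P (s *\<^sub>R z) * P (s *\<^sub>R z) + Q (s *\<^sub>R z) * Q (s *\<^sub>R z)) has_real_derivative
          (?p' * ?p + ?p' * ?p) + (?q' * ?q + ?q' * ?q)) (at t)"
        by (intro DERIV_add DERIV_mult line P Q)
      then have "((\<lambda>s. 1) has_real_derivative (?p' * ?p + ?p' * ?p) + (?q' * ?q + ?q' * ?q)) (at t)"
        by (simp only: PQ)
      then have pq': "?p * ?p' + ?q * ?q' = 0"
        using DERIV_unique[OF _ DERIV_const] by fastforce
      \<comment> \<open>The derivative of a unit vector is orthogonal to it, hence a multiple of its
        quarter turn \<open>(- ?q, ?p)\<close>.\<close>
      have p': "?p' = - ?q * (?p * ?q' - ?q * ?p')"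
      proof -
        have "?p' = ?p' * (?p * ?p + ?q * ?q)" by (simp add: PQ)
        also have "\<dots> = - ?q * (?p * ?q' - ?q * ?p') + ?p * (?p * ?p' + ?q * ?q')"
          by (simp add: algebra_simps)
        finally show ?thesis using pq' by simp
      qed
      have q': "?q' = ?p * (?p * ?q' - ?q * ?p')"
      proof -
        have "?q' = ?q' * (?p * ?p + ?q * ?q)" by (simp add: PQ)
        also have "\<dots> = ?p * (?p * ?q' - ?q * ?p') + ?q * (?p * ?p' + ?q * ?q')"
          by (simp add: algebra_simps)
        finally show ?thesis using pq' by simp
      qed
      define w where "w = ?p * ?q' - ?q * ?p'"
      have "(C has_real_derivative (?p' * cos (\<theta> (t *\<^sub>R z)) + - sin (\<theta> (t *\<^sub>R z)) * w * ?p)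
          + (?q' * sin (\<theta> (t *\<^sub>R z)) + cos (\<theta> (t *\<^sub>R z)) * w * ?q)) (at t)"
        unfolding C_def \<theta>_def
        by (intro DERIV_add DERIV_mult line P Q DERIV_fun_sin DERIV_fun_cos
            DERIV_cong[OF DERIV_add[OF DERIV_const line[OF G(1)]]]) (simp_all add: T w_def)
      moreover have "?p' = - ?q * w" "?q' = ?p * w" unfolding w_def by (fact p', fact q')
      ultimately show ?thesis by (simp add: algebra_simps)
    qed
    have "continuous_on UNIV (\<lambda>z. P z * cos (\<theta> z) + Q z * sin (\<theta> z))"
      unfolding \<theta>_def by (intro continuous_intros smooth_on_continuous P Q G(1))
    then have "continuous_on {0..1} C"
      unfolding C_def by (rule continuous_on_compose2) (auto intro!: continuous_intros)
    then have "C 1 = C 0"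
      using C by (intro DERIV_isconst_end) auto
    also have "C 0 = 1"
      using \<theta>0 by (simp add: C_def \<theta>_def G_def \<omega>_def linear_0[OF linear_differential[OF P]]
          linear_0[OF linear_differential[OF Q]] flip: power2_eq_square)
    finally show ?thesis by (simp add: C_def)
  qed
  have "P z = cos (\<theta> z) \<and> Q z = sin (\<theta> z)" for z
  proof -
    have "(P z - cos (\<theta> z)) * (P z - cos (\<theta> z)) + (Q z - sin (\<theta> z)) * (Q z - sin (\<theta> z))
      = (P z * P z + Q z * Q z) + ((cos (\<theta> z))\<^sup>2 + (sin (\<theta> z))\<^sup>2) - 2 * (P z * cos (\<theta> z) + Q z * sin (\<theta> z))"
      by (simp add: algebra_simps power2_eq_square)
    also have "\<dots> = 0" by (simp only: unit PQ sin_cos_squared_add2)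
    finally show ?thesis by (simp add: sum_squares_eq_zero_iff)
  qed
  moreover have "smooth_on UNIV \<theta>"
    unfolding \<theta>_def by (intro smooth_intros G(1) open_UNIV)
  ultimately show ?thesis using that by blast
qed

text \<open>The column space of a nonvanishing rank-one matrix \<open>A\<close> is spanned by
  \<open>(cos (\<theta>/2), sin (\<theta>/2))\<close>, where \<open>\<theta>\<close> is the angle of the trace-free part of \<open>A A\<^sup>T\<close>.\<close>

lemma rank_one_factorisation:
  fixes a11 a12 a21 a22 :: "'a::euclidean_space \<Rightarrow> real"
  assumes a: "smooth_on UNIV a11" "smooth_on UNIV a12" "smooth_on UNIV a21" "smooth_on UNIV a22"
    and det: "\<And>z. a11 z * a22 z = a12 z * a21 z"
    and nz: "\<And>z. a11 z \<noteq> 0 \<or> a12 z \<noteq> 0 \<or> a21 z \<noteq> 0 \<or> a22 z \<noteq> 0"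
  obtains x1 x2 y1 y2 where "smooth_on UNIV x1" "smooth_on UNIV x2" "smooth_on UNIV y1" "smooth_on UNIV y2"
    "\<And>z. a11 z = x1 z * y1 z" "\<And>z. a12 z = x1 z * y2 z" "\<And>z. a21 z = x2 z * y1 z" "\<And>z. a22 z = x2 z * y2 z"
proof -
  \<comment> \<open>\<open>N1\<close>, \<open>N2\<close> and \<open>K\<close> are the entries of A
    A^T. Its trace does not vanish and its determinant does, so \<open>(N1 - N2, 2 K)\<close>
    divided by the trace lies on the unit circle.\<close>
  define N1 where "N1 z = a11 z * a11 z + a12 z * a12 z" for z
  define N2 where "N2 z = a21 z * a21 z + a22 z * a22 z" for z
  define K where "K z = a11 z * a21 z + a12 z * a22 z" for z
  have N: "N1 z + N2 z \<noteq> 0" for z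
  proof
    assume "N1 z + N2 z = 0"
    moreover have "N1 z \<ge> 0" "N2 z \<ge> 0" by (simp_all add: N1_def N2_def)
    ultimately have "N1 z = 0" "N2 z = 0" by linarith+
    then show False using nz[of z] by (simp add: N1_def N2_def sum_squares_eq_zero_iff)
  qed
  have NK: "N1 z * N2 z = K z * K z" for z
  proof -
    have "N1 z * N2 z - K z * K z = (a11 z * a22 z - a12 z * a21 z) * (a11 z * a22 z - a12 z * a21 z)"
      by (simp add: N1_def N2_def K_def algebra_simps)
    then show ?thesis by (simp add: det)
  qed
  have sm: "smooth_on UNIV N1" "smooth_on UNIV N2" "smooth_on UNIV K"
    unfolding N1_def[abs_def] N2_def[abs_def] K_def[abs_def] by (intro smooth_intros a open_UNIV)+
  obtain \<theta> where \<theta>: "smooth_on UNIV \<theta>" "\<And>z. (N1 z - N2 z) / (N1 z + N2 z) = cos (\<theta> z)"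
    "\<And>z. 2 * K z / (N1 z + N2 z) = sin (\<theta> z)"
  proof (rule polar_angle_exists)
    show "smooth_on UNIV (\<lambda>z. (N1 z - N2 z) / (N1 z + N2 z))" "smooth_on UNIV (\<lambda>z. 2 * K z / (N1 z + N2 z))"
      by (intro smooth_intros sm N open_UNIV)+
    fix z
    have "(N1 z - N2 z) * (N1 z - N2 z) + 4 * (K z * K z) = (N1 z + N2 z) * (N1 z + N2 z)"
      unfolding NK[symmetric] by (simp add: algebra_simps)
    then show "(N1 z - N2 z) / (N1 z + N2 z) * ((N1 z - N2 z) / (N1 z + N2 z)) +
         2 * K z / (N1 z + N2 z) * (2 * K z / (N1 z + N2 z)) = 1"
      using N[of z] by (simp add: add_divide_distrib[symmetric])
  qed blast
  define c where "c z = cos (\<theta> z / 2)" for z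
  define s where "s z = sin (\<theta> z / 2)" for z
  have cs: "smooth_on UNIV c" "smooth_on UNIV s"
    unfolding c_def[abs_def] s_def[abs_def] by (intro smooth_intros \<theta> open_UNIV; simp)+
  have cs1: "c z * c z + s z * s z = 1" for z
    using sin_cos_squared_add2[of "\<theta> z / 2"] by (simp add: c_def s_def power2_eq_square)
  \<comment> \<open>The row \<open>(- s, c)\<close> annihilates A: the squared length of the product
    is a quadratic form in A A^T, and the double angle formulas show that it vanishes. Hence A = X
    Y^T with the unit vector X = (c, s) and Y = A^T X.\<close>
  have "- s z * a11 z + c z * a21 z = 0 \<and> - s z * a12 z + c z * a22 z = 0" for z
  proof -
    have c2: "2 * (c z * c z) = 1 + cos (\<theta> z)" and s2: "2 * (s z * s z) = 1 - cos (\<theta> z)"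
      and sc: "2 * (s z * c z) = sin (\<theta> z)"
      using cos_double_cos[of "\<theta> z / 2"] cos_double_sin[of "\<theta> z / 2"] sin_double[of "\<theta> z / 2"]
      by (simp_all add: c_def s_def power2_eq_square)
    have "2 * ((- s z * a11 z + c z * a21 z) * (- s z * a11 z + c z * a21 z)
        + (- s z * a12 z + c z * a22 z) * (- s z * a12 z + c z * a22 z))
      = (2 * (s z * s z)) * N1 z - (2 * (s z * c z)) * (2 * K z) + (2 * (c z * c z)) * N2 z"
      by (simp add: N1_def N2_def K_def algebra_simps)
    also have "\<dots> = (N1 z + N2 z) - cos (\<theta> z) * (N1 z - N2 z) - sin (\<theta> z) * (2 * K z)"
      unfolding c2 s2 sc by (simp add: algebra_simps)
    also have "cos (\<theta> z) * (N1 z - N2 z) + sin (\<theta> z) * (2 * K z)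
      = ((N1 z - N2 z) * (N1 z - N2 z) + 4 * (K z * K z)) / (N1 z + N2 z)"
      unfolding \<theta>(2,3)[symmetric] by (simp add: add_divide_distrib)
    then have "(N1 z + N2 z) - cos (\<theta> z) * (N1 z - N2 z) - sin (\<theta> z) * (2 * K z)
      = (N1 z + N2 z) - ((N1 z - N2 z) * (N1 z - N2 z) + 4 * (K z * K z)) / (N1 z + N2 z)" by linarith
    also have "(N1 z - N2 z) * (N1 z - N2 z) + 4 * (K z * K z) = (N1 z + N2 z) * (N1 z + N2 z)"
      unfolding NK[symmetric] by (simp add: algebra_simps)
    also have "(N1 z + N2 z) - (N1 z + N2 z) * (N1 z + N2 z) / (N1 z + N2 z) = 0" using N[of z] by simp
    finally show ?thesis by (simp only: mult_eq_0_iff sum_squares_eq_zero_iff) simp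
  qed
  then have p: "s z * a11 z = c z * a21 z" "s z * a12 z = c z * a22 z" for z by (simp_all add: algebra_simps)
  show ?thesis
  proof (rule that[OF cs])
    show "smooth_on UNIV (\<lambda>z. c z * a11 z + s z * a21 z)" "smooth_on UNIV (\<lambda>z. c z * a12 z + s z * a22 z)"
      by (intro smooth_intros cs a open_UNIV)+
    fix z
    have "(c z * c z + s z * s z) * a11 z = c z * (c z * a11 z) + s z * (s z * a11 z)" by (simp add: algebra_simps)
    then show "a11 z = c z * (c z * a11 z + s z * a21 z)" unfolding p cs1 by (simp add: algebra_simps)
    have "(c z * c z + s z * s z) * a12 z = c z * (c z * a12 z) + s z * (s z * a12 z)" by (simp add: algebra_simps)
    then show "a12 z = c z * (c z * a12 z + s z * a22 z)" unfolding p cs1 by (simp add: algebra_simps)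
    have "(c z * c z + s z * s z) * a21 z = c z * (c z * a21 z) + s z * (s z * a21 z)" by (simp add: algebra_simps)
    then show "a21 z = s z * (c z * a11 z + s z * a21 z)" unfolding p[symmetric] cs1 by (simp add: algebra_simps)
    have "(c z * c z + s z * s z) * a22 z = c z * (c z * a22 z) + s z * (s z * a22 z)" by (simp add: algebra_simps)
    then show "a22 z = s z * (c z * a12 z + s z * a22 z)" unfolding p[symmetric] cs1 by (simp add: algebra_simps)
  qed
qed

section \<open>Spinors of a conformal immersion of the plane\<close>

text \<open>In the basis X, Z the derivative of X along \<open>e\<close> is \<alpha> X + \<beta> Z,
  with \<open>\<alpha>\<close> from Cramer's rule. The derivative of \<kappa> X is parallel to Z
  when that of \<kappa> is - \<alpha> \<kappa>, which \<open>exp (- G)\<close> solves if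
  \<open>G\<close> has derivative \<open>\<alpha>\<close> along \<open>e\<close>.\<close>

lemma parallel_rescaling:
  fixes x1 x2 z1 z2 l :: "'a::euclidean_space \<Rightarrow> real"
  assumes s: "smooth_on UNIV x1" "smooth_on UNIV x2" "smooth_on UNIV z1" "smooth_on UNIV z2"
    and \<delta>: "\<And>z. x1 z * z2 z \<noteq> x2 z * z1 z" and l: "bounded_linear l" "l e = 1"
  obtains \<kappa> :: "'a \<Rightarrow> real" where "smooth_on UNIV \<kappa>" "\<And>z. \<kappa> z \<noteq> 0"
    "\<And>z. differential (\<lambda>z. \<kappa> z * x1 z) z e * z2 z = differential (\<lambda>z. \<kappa> z * x2 z) z e * z1 z"
proof -
  define \<alpha> where "\<alpha> z = (differential x1 z e * z2 z - differential x2 z e * z1 z) / (x1 z * z2 z - x2 z * z1 z)" for z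
  have "smooth_on UNIV \<alpha>"
    unfolding \<alpha>_def[abs_def] using \<delta> by (intro smooth_intros smooth_on_differential s open_UNIV) simp
  then obtain G where G: "smooth_on UNIV G" "\<And>z. differential G z e = \<alpha> z"
    using directional_primitive[OF _ l] by metis
  have sl: "smooth_on UNIV (\<lambda>z. exp (- G z))"
    by (intro smooth_intros G open_UNIV)
  have dl: "differential (\<lambda>z. exp (- G z)) z e = - \<alpha> z * exp (- G z)" for z
  proof -
    have "((\<lambda>z. exp (- G z)) has_derivative (\<lambda>v. exp (- G z) * - differential G z v)) (at z)"
      using DERIV_compose_FDERIV[OF DERIV_exp has_derivative_minus[OF smooth_on_UNIV_has_derivative[OF G(1)]], of z]
      by (simp add: mult.commute)
    from differential_eqI[OF this] show ?thesis by (simp add: G(2))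
  qed
  show ?thesis
  proof (rule that[OF sl])
    fix z
    have d: "x1 z * z2 z - x2 z * z1 z \<noteq> 0" using \<delta>[of z] by simp
    have \<alpha>: "\<alpha> z * (x1 z * z2 z - x2 z * z1 z) = differential x1 z e * z2 z - differential x2 z e * z1 z"
      using d by (simp add: \<alpha>_def)
    have "differential (\<lambda>z. exp (- G z) * x1 z) z e * z2 z - differential (\<lambda>z. exp (- G z) * x2 z) z e * z1 z
       = exp (- G z) * ((differential x1 z e * z2 z - differential x2 z e * z1 z) - \<alpha> z * (x1 z * z2 z - x2 z * z1 z))"
      unfolding differential_mult[OF sl s(1)] differential_mult[OF sl s(2)] dl by (simp add: algebra_simps)
    then show "differential (\<lambda>z. exp (- G z) * x1 z) z e * z2 z = differential (\<lambda>z. exp (- G z) * x2 z) z e * z1 z"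
      by (simp add: \<alpha>)
  qed simp
qed

text \<open>The determinant with a vector c transverse to b reads off the factor between the
  parallel vectors a and b.\<close>

lemma proportional:
  fixes a1 a2 b1 b2 c1 c2 :: real
  assumes "a1 * b2 = a2 * b1" "b1 * c2 - b2 * c1 \<noteq> 0"
  shows "a1 = (a1 * c2 - a2 * c1) / (b1 * c2 - b2 * c1) * b1" "a2 = (a1 * c2 - a2 * c1) / (b1 * c2 - b2 * c1) * b2"
proof -
  have "a1 * (b1 * c2 - b2 * c1) = (a1 * c2 - a2 * c1) * b1"
    using assms(1) by algebra
  then show "a1 = (a1 * c2 - a2 * c1) / (b1 * c2 - b2 * c1) * b1" using assms(2) by (simp add: field_simps)
  have "a2 * (b1 * c2 - b2 * c1) = (a1 * c2 - a2 * c1) * b2"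
    using assms(1) by algebra
  then show "a2 = (a1 * c2 - a2 * c1) / (b1 * c2 - b2 * c1) * b2" using assms(2) by (simp add: field_simps)
qed

text \<open>The integrability condition \<open>X' Y\<^sup>T + X Y'\<^sup>T = Z' W\<^sup>T + Z W'\<^sup>T\<close> of the two rank-one columns
  \<open>X Y\<^sup>T\<close> and \<open>Z W\<^sup>T\<close>, evaluated in the bases \<open>X, Z\<close> and \<open>Y, W\<close>.\<close>

lemma integrability_algebra:
  fixes x1 x2 y1 y2 z1 z2 w1 w2 :: real
  assumes e11: "x1' * y1 + x1 * y1' = z1' * w1 + z1 * w1'" and e12: "x1' * y2 + x1 * y2' = z1' * w2 + z1 * w2'"
    and e21: "x2' * y1 + x2 * y1' = z2' * w1 + z2 * w1'" and e22: "x2' * y2 + x2 * y2' = z2' * w2 + z2 * w2'"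
    and \<delta>: "x1 * z2 - x2 * z1 \<noteq> 0" and \<eta>: "y1 * w2 - y2 * w1 \<noteq> 0"
    and px: "x1' * z2 = x2' * z1" and pz: "z1' * x2 = z2' * x1"
  defines "p \<equiv> (y1' * y2 - y2' * y1) / (y1 * w2 - y2 * w1)" and "q \<equiv> (x1' * x2 - x2' * x1) / (x1 * z2 - x2 * z1)"
  shows "x1' = - q * z1" "x2' = - q * z2" "y1' = - p * w1" "y2' = - p * w2"
    "z1' = - p * x1" "z2' = - p * x2" "w1' = - q * y1" "w2' = - q * y2"
proof -
  \<comment> \<open>Determinants with Z on the left and W on the right kill every term except X
    Y'^T, as X' is parallel to Z; so Y' is parallel to W. The next identity uses X and Y to show
    that W' is parallel to Y.\<close>
  have "(x1 * z2 - x2 * z1) * (y1' * w2 - y2' * w1) =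
    ((x1' * y1 + x1 * y1') * z2 - (x2' * y1 + x2 * y1') * z1) * w2
    - ((x1' * y2 + x1 * y2') * z2 - (x2' * y2 + x2 * y2') * z1) * w1
    - (x1' * z2 - x2' * z1) * (y1 * w2 - y2 * w1)" by algebra
  also have "\<dots> = 0" unfolding e11 e12 e21 e22 px by algebra
  finally have py: "y1' * w2 = y2' * w1" using \<delta> by simp
  have "(z1 * x2 - z2 * x1) * (w1' * y2 - w2' * y1) =
    ((z1' * w1 + z1 * w1') * x2 - (z2' * w1 + z2 * w1') * x1) * y2
    - ((z1' * w2 + z1 * w2') * x2 - (z2' * w2 + z2 * w2') * x1) * y1
    - (z1' * x2 - z2' * x1) * (w1 * y2 - w2 * y1)" by algebra
  also have "\<dots> = 0" unfolding e11[symmetric] e12[symmetric] e21[symmetric] e22[symmetric] pz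
    by (simp add: algebra_simps)
  finally have pw: "w1' * y2 = w2' * y1" using \<delta> by (simp add: mult.commute)
  have q: "(x1' * x2 - x2' * x1) / (z1 * x2 - z2 * x1) = - q"
    unfolding q_def using \<delta> by (simp add: field_simps)
  show x: "x1' = - q * z1" "x2' = - q * z2"
    using proportional[OF px, of x2 x1] \<delta> unfolding q by (simp_all add: mult.commute)
  have p: "(y1' * y2 - y2' * y1) / (w1 * y2 - w2 * y1) = - p"
    unfolding p_def using \<eta> by (simp add: field_simps)
  show y: "y1' = - p * w1" "y2' = - p * w2"
    using proportional[OF py, of y2 y1] \<eta> unfolding p by (simp_all add: mult.commute)
  define p' where "p' = (z1' * z2 - z2' * z1) / (x1 * z2 - x2 * z1)"
  define q' where "q' = (w1' * w2 - w2' * w1) / (y1 * w2 - y2 * w1)"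
  have z: "z1' = p' * x1" "z2' = p' * x2"
    using proportional[OF pz, of z2 z1] \<delta> by (simp_all add: p'_def)
  have w: "w1' = q' * y1" "w2' = q' * y2"
    using proportional[OF pw, of w2 w1] \<eta> by (simp_all add: q'_def)
  \<comment> \<open>After substitution the condition reads (p + p') X W^T + (q + q') Z Y^T = 0, and
    the two matrices are independent.\<close>
  have "(p + p') * ((x1 * z2 - x2 * z1) * (y1 * w2 - y2 * w1)) = 0"
    using e11 e12 e21 e22 unfolding x y z w by algebra
  then have p': "p' = - p" using \<delta> \<eta> by simp
  have "(q + q') * ((x1 * z2 - x2 * z1) * (y1 * w2 - y2 * w1)) = 0"
    using e11 e12 e21 e22 unfolding x y z w by algebra
  then have q': "q' = - q" using \<delta> \<eta> by simp
  show "z1' = - p * x1" "z2' = - p * x2" "w1' = - q * y1" "w2' = - q * y2"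
    using z w p' q' by simp_all
qed

lemma conformal_immersion_spinors:
  assumes F: "smooth_on UNIV F"
    and conf: "\<And>z v w. induced_metric F z v w = \<rho> z * da_dahat v w" and \<rho>: "\<And>z. \<rho> z \<noteq> 0"
  obtains \<phi>1 \<phi>2 \<psi>1 \<psi>2 p q where "weierstrass_data \<phi>1 \<phi>2 \<psi>1 \<psi>2 p q"
    "\<And>z. (F has_derivative spinor_differential \<phi>1 \<phi>2 \<psi>1 \<psi>2 z) (at z)"
proof -
  define D where "D z = differential F z" for z
  have FD: "(F has_derivative D z) (at z)" for z
    unfolding D_def by (rule smooth_on_UNIV_has_derivative[OF F])
  have sD: "smooth_on UNIV (\<lambda>z. D z v)" for v
    unfolding D_def by (rule smooth_on_differential[OF F])
  have linD: "linear (D z)" for z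
    unfolding D_def by (rule linear_differential[OF F])
  have metric: "inner22 (D z v) (D z w) = \<rho> z * da_dahat v w" for z v w
    using conf by (simp add: induced_metric_def D_def)
  let ?s = "lnull 1 0" and ?t = "lnull 0 1"
  have ss: "inner22 (D z ?s) (D z ?s) = 0" and tt: "inner22 (D z ?t) (D z ?t) = 0"
    and st: "inner22 (D z ?s) (D z ?t) = \<rho> z / 2" for z
    by (simp_all add: metric da_dahat_null)
  note sc = smooth_on_c[OF open_UNIV sD]
  obtain x1 x2 y1 y2 where x: "smooth_on UNIV x1" "smooth_on UNIV x2" and y: "smooth_on UNIV y1" "smooth_on UNIV y2"
    and xy: "\<And>z. c11 (D z ?s) = x1 z * y1 z" "\<And>z. c12 (D z ?s) = x1 z * y2 z"
      "\<And>z. c21 (D z ?s) = x2 z * y1 z" "\<And>z. c22 (D z ?s) = x2 z * y2 z"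
  proof (rule rank_one_factorisation[OF sc])
    show "c11 (D z ?s) * c22 (D z ?s) = c12 (D z ?s) * c21 (D z ?s)" for z
      using ss[of z] by (simp add: inner22_c mult.commute)
    show "c11 (D z ?s) \<noteq> 0 \<or> c12 (D z ?s) \<noteq> 0 \<or> c21 (D z ?s) \<noteq> 0 \<or> c22 (D z ?s) \<noteq> 0" for z
      using st[of z] \<rho>[of z] by (auto simp: inner22_c)
  qed blast
  obtain z1 z2 w1 w2 where z: "smooth_on UNIV z1" "smooth_on UNIV z2" and w: "smooth_on UNIV w1" "smooth_on UNIV w2"
    and zw: "\<And>z. c11 (D z ?t) = z1 z * w1 z" "\<And>z. c12 (D z ?t) = z1 z * w2 z"
      "\<And>z. c21 (D z ?t) = z2 z * w1 z" "\<And>z. c22 (D z ?t) = z2 z * w2 z"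
  proof (rule rank_one_factorisation[OF sc])
    show "c11 (D z ?t) * c22 (D z ?t) = c12 (D z ?t) * c21 (D z ?t)" for z
      using tt[of z] by (simp add: inner22_c mult.commute)
    show "c11 (D z ?t) \<noteq> 0 \<or> c12 (D z ?t) \<noteq> 0 \<or> c21 (D z ?t) \<noteq> 0 \<or> c22 (D z ?t) \<noteq> 0" for z
      using st[of z] \<rho>[of z] by (auto simp: inner22_c)
  qed blast
  \<comment> \<open>The polarised determinant of X Y^T and Z W^T is half the product of the two
    determinants, and the metric makes it \<open>\<rho> z / 2\<close>; so neither determinant
    vanishes.\<close>
  have \<delta>\<eta>: "(x1 z * z2 z - x2 z * z1 z) * (y1 z * w2 z - y2 z * w1 z) = \<rho> z" for z
    using st[of z] by (simp add: inner22_c xy zw algebra_simps)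
  have \<delta>: "x1 z * z2 z \<noteq> x2 z * z1 z" "z1 z * x2 z \<noteq> z2 z * x1 z"
    and \<eta>: "y1 z * w2 z - y2 z * w1 z \<noteq> 0" for z
    using \<delta>\<eta>[of z] \<rho>[of z] by (auto simp: mult.commute)
  \<comment> \<open>Being parallel to Z does not depend on the scale of Z, so the normalisations of
    X by \<open>\<kappa>\<close> and of Z by \<open>\<mu>\<close> do not interfere.\<close>
  obtain \<kappa> where \<kappa>: "smooth_on UNIV \<kappa>" "\<And>z. \<kappa> z \<noteq> 0"
    "\<And>z. differential (\<lambda>z. \<kappa> z * x1 z) z ?t * z2 z = differential (\<lambda>z. \<kappa> z * x2 z) z ?t * z1 z"
    by (rule parallel_rescaling[OF x z \<delta>(1) bounded_linear_lm, of ?t]) (simp, blast)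
  obtain \<mu> where \<mu>: "smooth_on UNIV \<mu>" "\<And>z. \<mu> z \<noteq> 0"
    "\<And>z. differential (\<lambda>z. \<mu> z * z1 z) z ?s * x2 z = differential (\<lambda>z. \<mu> z * z2 z) z ?s * x1 z"
    by (rule parallel_rescaling[OF z x \<delta>(2) bounded_linear_lp, of ?s]) (simp, blast)
  define X1 where "X1 z = \<kappa> z * x1 z" for z
  define X2 where "X2 z = \<kappa> z * x2 z" for z
  define Y1 where "Y1 z = y1 z / \<kappa> z" for z
  define Y2 where "Y2 z = y2 z / \<kappa> z" for z
  define Z1 where "Z1 z = \<mu> z * z1 z" for z
  define Z2 where "Z2 z = \<mu> z * z2 z" for z
  define W1 where "W1 z = w1 z / \<mu> z" for z
  define W2 where "W2 z = w2 z / \<mu> z" for z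
  note defs = X1_def X2_def Y1_def Y2_def Z1_def Z2_def W1_def W2_def
  have sX: "smooth_on UNIV X1" "smooth_on UNIV X2" "smooth_on UNIV Y1" "smooth_on UNIV Y2"
    "smooth_on UNIV Z1" "smooth_on UNIV Z2" "smooth_on UNIV W1" "smooth_on UNIV W2"
    unfolding defs[abs_def] by (intro smooth_intros open_UNIV x y z w \<kappa>(1,2) \<mu>(1,2))+
  have XY: "c11 (D z ?s) = X1 z * Y1 z" "c12 (D z ?s) = X1 z * Y2 z"
      "c21 (D z ?s) = X2 z * Y1 z" "c22 (D z ?s) = X2 z * Y2 z"
    and ZW: "c11 (D z ?t) = Z1 z * W1 z" "c12 (D z ?t) = Z1 z * W2 z"
      "c21 (D z ?t) = Z2 z * W1 z" "c22 (D z ?t) = Z2 z * W2 z" for z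
    using \<kappa>(2)[of z] \<mu>(2)[of z] by (simp_all add: xy zw defs)
  have \<delta>': "X1 z * Z2 z - X2 z * Z1 z \<noteq> 0" and \<eta>': "Y1 z * W2 z - Y2 z * W1 z \<noteq> 0" for z
    using \<kappa>(2)[of z] \<mu>(2)[of z] \<delta>(1)[of z] \<eta>[of z] by (simp_all add: defs field_simps)
  have px: "differential X1 z ?t * Z2 z = differential X2 z ?t * Z1 z" for z
    using \<kappa>(3)[of z] unfolding defs[abs_def] by (simp add: mult.left_commute)
  have pz: "differential Z1 z ?s * X2 z = differential Z2 z ?s * X1 z" for z
    using \<mu>(3)[of z] unfolding defs[abs_def] by (simp add: mult.left_commute)
  \<comment> \<open>Symmetry of the second derivatives of the surface, one matrix coordinate
    \<open>L\<close> at a time.\<close>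
  have integ: "differential a z ?t * b z + a z * differential b z ?t
      = differential c z ?s * d z + c z * differential d z ?s"
    if L: "bounded_linear L" and s: "smooth_on UNIV a" "smooth_on UNIV b" "smooth_on UNIV c" "smooth_on UNIV d"
      and ab: "\<And>z. L (D z ?s) = a z * b z" and cd: "\<And>z. L (D z ?t) = c z * d z" for L :: "real ^ 4 \<Rightarrow> real" and a b c d z
  proof -
    have sL: "smooth_on UNIV (\<lambda>z. L (F z))" by (rule smooth_on_bounded_linear[OF L open_UNIV F])
    have dL: "differential (\<lambda>z. L (F z)) z v = L (D z v)" for z v
      using differential_bounded_linear[OF L FD] by (simp add: D_def)
    have "differential (\<lambda>z. a z * b z) z ?t = differential (\<lambda>z. c z * d z) z ?s"
      using second_derivative_symmetric[OF smooth_onD[OF sL], of ?s z ?t] by (simp add: dL ab cd)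
    then show ?thesis by (simp add: differential_mult s add.commute)
  qed
  define p where "p z = (differential Y1 z ?t * Y2 z - differential Y2 z ?t * Y1 z) / (Y1 z * W2 z - Y2 z * W1 z)" for z
  define q where "q z = (differential X1 z ?t * X2 z - differential X2 z ?t * X1 z) / (X1 z * Z2 z - X2 z * Z1 z)" for z
  have spq: "smooth_on UNIV p" "smooth_on UNIV q"
    unfolding p_def[abs_def] q_def[abs_def]
    by (intro smooth_intros smooth_on_differential sX \<delta>' \<eta>' open_UNIV)+
  note eqs = integrability_algebra[OF
      integ[OF bounded_linear_c(1) sX(1,3,5,7) XY(1) ZW(1)] integ[OF bounded_linear_c(2) sX(1,4,5,8) XY(2) ZW(2)]
      integ[OF bounded_linear_c(3) sX(2,3,6,7) XY(3) ZW(3)] integ[OF bounded_linear_c(4) sX(2,4,6,8) XY(4) ZW(4)]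
      \<delta>' \<eta>' px pz, folded p_def q_def]
  define \<phi>1 where "\<phi>1 z = lnull (Z1 z) (Y1 z)" for z
  define \<phi>2 where "\<phi>2 z = lnull (Z2 z) (Y2 z)" for z
  define \<psi>1 where "\<psi>1 z = lnull (X1 z) (W1 z)" for z
  define \<psi>2 where "\<psi>2 z = lnull (X2 z) (W2 z)" for z
  note sdefs = \<phi>1_def \<phi>2_def \<psi>1_def \<psi>2_def
  have sm: "smooth_on UNIV \<phi>1" "smooth_on UNIV \<phi>2" "smooth_on UNIV \<psi>1" "smooth_on UNIV \<psi>2"
    unfolding sdefs[abs_def] by (intro smooth_on_lnull open_UNIV sX)+
  have d1: "d_a \<phi>1 z = - (p z *\<^sub>R \<psi>1 z) \<and> d_ahat \<psi>1 z = - (q z *\<^sub>R \<phi>1 z)" for z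
    unfolding dirac_null_iff[OF sm(1,3)] by (simp add: sdefs eqs)
  have d2: "d_a \<phi>2 z = - (p z *\<^sub>R \<psi>2 z) \<and> d_ahat \<psi>2 z = - (q z *\<^sub>R \<phi>2 z)" for z
    unfolding dirac_null_iff[OF sm(2,4)] by (simp add: sdefs eqs)
  have nd: "lsq (\<psi>2 z * \<phi>1 z - \<psi>1 z * \<phi>2 z) \<noteq> 0" for z
    using \<delta>'[of z] \<eta>'[of z] by (auto simp: lsq_null sdefs mult.commute)
  have data: "weierstrass_data \<phi>1 \<phi>2 \<psi>1 \<psi>2 p q"
    unfolding weierstrass_data_def using sm spq d1 d2 nd by blast
  have "D z = spinor_differential \<phi>1 \<phi>2 \<psi>1 \<psi>2 z" for z
  proof
    fix v
    show "D z v = spinor_differential \<phi>1 \<phi>2 \<psi>1 \<psi>2 z v"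
      by (subst linear_null_expand[OF linD], rule c_eqI)
         (simp_all add: XY ZW spinor_differential_def sdefs algebra_simps)
  qed
  then show ?thesis using that[OF data] FD by simp
qed

section \<open>Conformal coordinates with image the whole plane\<close>

lemma differential_compose:
  assumes "(f has_derivative f') (at z)" "(h has_derivative h') (at (f z))"
  shows "differential (\<lambda>z. h (f z)) z v = h' (f' v)"
  by (rule differential_eqI[OF has_derivative_compose[OF assms]])

text \<open>Changing each null coordinate on its own preserves both null directions. So a small
  square in null coordinates can be stretched to the whole plane while the metric stays a multiple
  of \<open>da_dahat\<close>.\<close>

lemma conformal_plane_coordinates:
  fixes g :: "lorentz \<Rightarrow> lorentz \<Rightarrow> lorentz \<Rightarrow> real"
  assumes U: "open U" "z0 \<in> U" and sg: "\<And>v w. smooth_on U (\<lambda>z. g z v w)"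
    and bil: "\<And>z. z \<in> U \<Longrightarrow> bilinear (g z)" and sym: "\<And>z v w. z \<in> U \<Longrightarrow> g z v w = g z w v"
    and e: "g z0 e1 e1 = 1" "g z0 e2 e2 = -1" "g z0 e1 e2 = 0"
  obtains N K K' \<rho> where "open N" "z0 \<in> N" "N \<subseteq> U" "smooth_on N K" "smooth_on UNIV K'"
    "\<And>z. z \<in> N \<Longrightarrow> K' (K z) = z" "\<And>u. K' u \<in> N" "\<And>u. K (K' u) = u" "\<And>u. \<rho> u \<noteq> (0 :: real)"
    "\<And>u v w. g (K' u) (differential K' u v) (differential K' u w) = \<rho> u * da_dahat v w"
proof -
  \<comment> \<open>\<open>n1\<close> and \<open>n2\<close> are null with product 1 - (-1) = 2. In
    affine coordinates along them the metric at the origin has the shape that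
    \<open>null_coordinates\<close> expects.\<close>
  define n1 where "n1 = e1 + e2"
  define n2 where "n2 = e1 - e2"
  note b0 = bil[OF U(2)]
  note bsimps = bilinear_ladd[OF b0] bilinear_radd[OF b0] bilinear_lsub[OF b0] bilinear_rsub[OF b0]
  have gn: "g z0 n1 n1 = 0" "g z0 n2 n2 = 0" "g z0 n1 n2 = 2"
    using e sym[OF U(2), of e2 e1] by (simp_all add: n1_def n2_def bsimps)
  define \<delta> where "\<delta> = upart n1 * vpart n2 - vpart n1 * upart n2"
  have \<delta>: "\<delta> \<noteq> 0"
  proof
    assume "\<delta> = 0"
    then have "vpart n2 *\<^sub>R n1 = vpart n1 *\<^sub>R n2" "upart n2 *\<^sub>R n1 = upart n1 *\<^sub>R n2"
      by (simp_all add: \<delta>_def lorentz_eq_iff mult.commute)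
    then have "vpart n2 * g z0 n1 n2 = vpart n1 * g z0 n2 n2" "upart n2 * g z0 n1 n2 = upart n1 * g z0 n2 n2"
      using bilinear_lmul[OF b0, of _ _ n2] by (metis real_scaleR_def)+
    then have "n2 = 0" using gn by (simp add: lorentz_eq_iff)
    then show False using gn(3) bilinear_rzero[OF b0] by simp
  qed
  define l where "l p = z0 + (fst p *\<^sub>R n1 + snd p *\<^sub>R n2)" for p :: "real \<times> real"
  define li where "li z = ((upart (z - z0) * vpart n2 - vpart (z - z0) * upart n2) / \<delta>,
      (upart n1 * vpart (z - z0) - vpart n1 * upart (z - z0)) / \<delta>)" for z
  have l_li: "l (li z) = z" for z
  proof -
    have "((upart (z - z0) * vpart n2 - vpart (z - z0) * upart n2) / \<delta>) *\<^sub>R n1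
        + ((upart n1 * vpart (z - z0) - vpart n1 * upart (z - z0)) / \<delta>) *\<^sub>R n2
      = (1 / \<delta>) *\<^sub>R ((upart (z - z0) * vpart n2 - vpart (z - z0) * upart n2) *\<^sub>R n1
        + (upart n1 * vpart (z - z0) - vpart n1 * upart (z - z0)) *\<^sub>R n2)"
      by (simp add: scaleR_add_right)
    also have "(upart (z - z0) * vpart n2 - vpart (z - z0) * upart n2) *\<^sub>R n1
        + (upart n1 * vpart (z - z0) - vpart n1 * upart (z - z0)) *\<^sub>R n2 = \<delta> *\<^sub>R (z - z0)"
      by (simp add: lorentz_eq_iff \<delta>_def algebra_simps)
    finally show ?thesis using \<delta> by (simp add: l_def li_def)
  qed
  have li_l: "li (l p) = p" for p
    using \<delta> by (simp add: l_def li_def prod_eq_iff field_simps) (simp add: \<delta>_def algebra_simps)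
  have ld: "(l has_derivative (\<lambda>v. fst v *\<^sub>R n1 + snd v *\<^sub>R n2)) (at p)" for p
    unfolding l_def[abs_def] by (auto intro!: derivative_eq_intros)
  have sl: "smooth_on S l" if "open S" for S
    unfolding l_def[abs_def] by (intro smooth_intros that)
  have buv: "bounded_linear upart" "bounded_linear vpart"
    by (simp_all add: linear_conv_bounded_linear[symmetric] linear_iff)
  have sli: "smooth_on S li" if "open S" for S
    unfolding li_def[abs_def]
    by (intro smooth_intros smooth_on_bounded_linear[OF buv(1)] smooth_on_bounded_linear[OF buv(2)] that \<delta>)
  have cl: "continuous_on S l" "continuous_on S' li" for S S'
    using smooth_on_continuous[OF sl[OF open_UNIV]] smooth_on_continuous[OF sli[OF open_UNIV]]
    by (auto intro: continuous_on_subset)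
  have U1: "open (l -` U)" by (rule open_vimage[OF U(1) cl(1)])
  have z1: "(0, 0) \<in> l -` U" using U(2) by (simp add: l_def)
  have l0: "l (0, 0) = z0" by (simp add: l_def)
  have sgl: "smooth_on (l -` U) (\<lambda>p. g (l p) v w)" for v w
    by (rule smooth_on_compose[OF U1 _ sl[OF U1] sg]) auto
  obtain U' V W G \<rho> where o: "open U'" "U' \<subseteq> l -` U" "(0, 0) \<in> U'" "open V" and hom: "homeomorphism U' V W G"
    and sW: "smooth_on U' W" and sG: "smooth_on V G"
    and form: "\<And>p v w. p \<in> U' \<Longrightarrow> g (l p) n1 n1 * (fst v * fst w) + g (l p) n1 n2 * (fst v * snd w + snd v * fst w) + g (l p) n2 n2 * (snd v * snd w)
      = \<rho> p * (fst (differential W p v) * snd (differential W p w) + snd (differential W p v) * fst (differential W p w))"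
    and \<rho>: "\<And>p. p \<in> U' \<Longrightarrow> \<rho> p \<noteq> (0 :: real)"
  proof (rule null_coordinates[OF U1 z1 sgl sgl sgl])
    show "g (l (0, 0)) n1 n1 = 0" "g (l (0, 0)) n2 n2 = 0" "g (l (0, 0)) n1 n2 > 0"
      unfolding l0 gn by simp_all
  qed blast
  have WG: "W p \<in> V" "G (W p) = p" if "p \<in> U'" for p
    using hom that unfolding homeomorphism_def by auto
  have GW: "G q \<in> U'" "W (G q) = q" if "q \<in> V" for q
    using hom that unfolding homeomorphism_def by auto
  obtain s0 t0 where st: "W (0, 0) = (s0, t0)" by fastforce
  then obtain \<epsilon> where \<epsilon>: "\<epsilon> > 0" "{s0 - \<epsilon>..s0 + \<epsilon>} \<times> {t0 - \<epsilon>..t0 + \<epsilon>} \<subseteq> V"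
    using square_nbhd[OF o(4)] WG(1)[OF o(3)] by metis
  \<comment> \<open>Makes \<open>k * arctan\<close> a bijection from the line onto the open interval
    of radius \<open>\<epsilon>\<close>.\<close>
  define k where "k = 2 * \<epsilon> / pi"
  have k: "k > 0" "k * (pi / 2) = \<epsilon>" using \<epsilon> by (simp_all add: k_def)
  define Q where "Q = {s0 - \<epsilon><..<s0 + \<epsilon>} \<times> {t0 - \<epsilon><..<t0 + \<epsilon>}"
  have Q: "open Q" "Q \<subseteq> V"
    using \<epsilon>(2) unfolding Q_def by (intro open_Times open_greaterThanLessThan, fastforce)
  define \<Sigma> where "\<Sigma> u = (s0 + k * arctan (lp u), t0 + k * arctan (lm u))" for u
  define \<Theta> where "\<Theta> q = lnull (tan ((fst q - s0) / k)) (tan ((snd q - t0) / k))" for q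
  have arc: "\<bar>k * arctan x\<bar> < \<epsilon>" for x
  proof -
    have "\<bar>arctan x\<bar> < pi / 2" using arctan_bounded[of x] by (auto simp: abs_less_iff)
    from mult_strict_left_mono[OF this k(1)] have "k * \<bar>arctan x\<bar> < \<epsilon>" by (simp only: k(2))
    then show ?thesis using k(1) by (simp add: abs_mult)
  qed
  have \<Sigma>Q: "\<Sigma> u \<in> Q" for u
    using arc[of "lp u"] arc[of "lm u"] by (auto simp: \<Sigma>_def Q_def abs_less_iff)
  have \<Theta>\<Sigma>: "\<Theta> (\<Sigma> u) = u" for u
    using k(1) by (simp add: \<Theta>_def \<Sigma>_def tan_arctan)
  have rng: "(x - y) / k \<in> {- (pi / 2)<..<pi / 2}" if "x \<in> {y - \<epsilon><..<y + \<epsilon>}" for x y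
    using that k by (auto simp: field_simps)
  have \<Sigma>\<Theta>: "\<Sigma> (\<Theta> q) = q" if "q \<in> Q" for q
    using that k(1) rng[of "fst q" s0] rng[of "snd q" t0]
    by (auto simp: \<Theta>_def \<Sigma>_def Q_def arctan_tan)
  have s\<Theta>: "smooth_on Q \<Theta>"
    unfolding \<Theta>_def[abs_def]
    by (intro smooth_on_lnull Q smooth_on_compose[OF Q(1) _ _ smooth_on_tan] smooth_intros)
       (use k(1) rng in \<open>auto simp: Q_def\<close>)
  have s\<Sigma>: "smooth_on UNIV \<Sigma>"
    unfolding \<Sigma>_def[abs_def]
    by (intro smooth_intros open_UNIV smooth_on_compose[OF open_UNIV _ _ smooth_on_arctan]
        smooth_on_lp smooth_on_lm) auto
  have d\<Sigma>: "(\<Sigma> has_derivative (\<lambda>v. (k * (inverse (1 + (lp u)\<^sup>2) * lp v), k * (inverse (1 + (lm u)\<^sup>2) * lm v)))) (at u)" for u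
  proof -
    have a: "((\<lambda>u. arctan (L u)) has_derivative (\<lambda>v. inverse (1 + (L u)\<^sup>2) * L v)) (at u)"
      if "bounded_linear L" for L
      using DERIV_compose_FDERIV[OF DERIV_arctan bounded_linear_imp_has_derivative[OF that]] by (simp add: mult.commute)
    show ?thesis
      unfolding \<Sigma>_def[abs_def]
      using has_derivative_Pair[OF
          has_derivative_add[OF has_derivative_const has_derivative_mult_right[OF a[OF bounded_linear_lp]]]
          has_derivative_add[OF has_derivative_const has_derivative_mult_right[OF a[OF bounded_linear_lm]]]]
      by simp
  qed
  define N1 where "N1 = U' \<inter> W -` Q"
  have N1: "open N1"
    unfolding N1_def by (rule continuous_open_preimage[OF smooth_on_continuous[OF sW] o(1) Q(1)])
  define N where "N = li -` N1"
  have N: "open N" unfolding N_def by (rule open_vimage[OF N1 cl(2)])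
  define K where "K z = \<Theta> (W (li z))" for z
  define K' where "K' u = l (G (\<Sigma> u))" for u
  have \<Sigma>V: "\<Sigma> u \<in> V" for u using \<Sigma>Q Q(2) by blast
  have sK: "smooth_on N K"
    unfolding K_def[abs_def]
    by (rule smooth_on_compose[OF N _ smooth_on_compose[OF N _ sli[OF N] sW] s\<Theta>]) (auto simp: N_def N1_def)
  have sG\<Sigma>: "smooth_on UNIV (\<lambda>u. G (\<Sigma> u))"
    by (rule smooth_on_compose[OF open_UNIV _ s\<Sigma> sG]) (use \<Sigma>V in auto)
  have sK': "smooth_on UNIV K'"
    unfolding K'_def[abs_def] by (rule smooth_on_compose[OF open_UNIV _ sG\<Sigma> sl[OF open_UNIV]]) simp
  \<comment> \<open>Factor of the null form times the derivatives of the two arctangent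
    substitutions; the 2 undoes the halving in \<open>da_dahat\<close>.\<close>
  define \<kappa> where "\<kappa> u = \<rho> (G (\<Sigma> u)) * (2 * (k * inverse (1 + (lp u)\<^sup>2)) * (k * inverse (1 + (lm u)\<^sup>2)))" for u
  show ?thesis
  proof (rule that[OF N _ _ sK sK'])
    show "z0 \<in> N"
      using o(3) st \<epsilon>(1) li_l[of "(0, 0)"] unfolding l0 by (simp add: N_def N1_def Q_def)
    show "N \<subseteq> U"
    proof
      fix z assume "z \<in> N"
      then have "l (li z) \<in> U" using o(2) by (auto simp: N_def N1_def)
      then show "z \<in> U" by (simp add: l_li)
    qed
    show "K' (K z) = z" if "z \<in> N" for z
      using that by (simp add: N_def N1_def K_def K'_def \<Sigma>\<Theta> WG l_li)
    show "K' u \<in> N" for u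
      using GW[OF \<Sigma>V[of u]] \<Sigma>Q[of u] by (simp add: N_def N1_def K'_def li_l)
    show "K (K' u) = u" for u
      using GW(2)[OF \<Sigma>V[of u]] by (simp add: K_def K'_def li_l \<Theta>\<Sigma>)
    have pos: "1 + x\<^sup>2 \<noteq> 0" for x :: real by (metis add_nonneg_eq_0_iff one_neq_zero zero_le_one zero_le_power2)
    show "\<kappa> u \<noteq> 0" for u
      using \<rho>[OF GW(1)[OF \<Sigma>V]] k(1) pos by (simp add: \<kappa>_def)
    fix u v w
    let ?p = "G (\<Sigma> u)"
    have p: "?p \<in> U'" by (rule GW(1)[OF \<Sigma>V])
    have lpU: "l ?p \<in> U" using p o(2) by auto
    note b = bil[OF lpU]
    let ?DS = "\<lambda>v. (k * (inverse (1 + (lp u)\<^sup>2) * lp v), k * (inverse (1 + (lm u)\<^sup>2) * lm v))"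
    let ?v = "\<lambda>v. differential G (\<Sigma> u) (?DS v)"
    have dG: "(G has_derivative differential G (\<Sigma> u)) (at (\<Sigma> u))"
      by (rule smooth_on_has_derivative[OF sG \<Sigma>V])
    have dK': "differential K' u v = fst (?v v) *\<^sub>R n1 + snd (?v v) *\<^sub>R n2" for v
      unfolding K'_def[abs_def] by (rule differential_compose[OF has_derivative_compose[OF d\<Sigma> dG] ld])
    have DW: "differential W ?p (?v v) = ?DS v" for v
    proof -
      have "((\<lambda>q. W (G q)) has_derivative (\<lambda>v. differential W ?p (differential G (\<Sigma> u) v))) (at (\<Sigma> u))"
        by (rule has_derivative_compose[OF dG smooth_on_has_derivative[OF sW p]])
      moreover have "((\<lambda>q. W (G q)) has_derivative (\<lambda>v. v)) (at (\<Sigma> u))"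
        by (rule has_derivative_transform_within_open[OF has_derivative_ident o(4) \<Sigma>V]) (simp add: GW)
      ultimately have "(\<lambda>v. differential W ?p (differential G (\<Sigma> u) v)) = (\<lambda>v. v)"
        by (rule has_derivative_unique)
      from fun_cong[OF this, of "?DS v"] show ?thesis .
    qed
    have "g (K' u) (differential K' u v) (differential K' u w)
      = g (l ?p) n1 n1 * (fst (?v v) * fst (?v w)) + g (l ?p) n1 n2 * (fst (?v v) * snd (?v w) + snd (?v v) * fst (?v w))
        + g (l ?p) n2 n2 * (snd (?v v) * snd (?v w))"
      unfolding dK' K'_def[of u]
      using sym[OF lpU, of n2 n1]
      by (simp add: bilinear_ladd[OF b] bilinear_radd[OF b] bilinear_lmul[OF b] bilinear_rmul[OF b] algebra_simps)
    also have "\<dots> = \<rho> ?p * (fst (?DS v) * snd (?DS w) + snd (?DS v) * fst (?DS w))"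
      unfolding form[OF p] DW ..
    also have "\<dots> = \<kappa> u * da_dahat v w"
      by (simp add: \<kappa>_def da_dahat_null algebra_simps)
    finally show "g (K' u) (differential K' u v) (differential K' u w) = \<kappa> u * da_dahat v w" .
  qed
qed

section \<open>Charts\<close>

lemma smooth_surface_chart:
  assumes "smooth_surface \<A>" "c \<in> \<A>"
  shows "open (fst c)" "open (snd c ` fst c)" "continuous_on (fst c) (snd c)"
    "continuous_on (snd c ` fst c) (chart_inv c)"
    "\<And>x. x \<in> fst c \<Longrightarrow> chart_inv c (snd c x) = x"
    "\<And>z. z \<in> snd c ` fst c \<Longrightarrow> chart_inv c z \<in> fst c"
    "\<And>z. z \<in> snd c ` fst c \<Longrightarrow> snd c (chart_inv c z) = z"
  using assms unfolding smooth_surface_def homeomorphism_def by blast+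

lemma smooth_surface_transition:
  "smooth_surface \<A> \<Longrightarrow> c \<in> \<A> \<Longrightarrow> d \<in> \<A> \<Longrightarrow> smooth_on (overlap c d) (transition c d)"
  unfolding smooth_surface_def by blast

lemma chart_image_open:
  assumes "smooth_surface \<A>" "c \<in> \<A>" "open S"
  shows "open (snd c ` (fst c \<inter> S))"
proof -
  have "snd c ` (fst c \<inter> S) = snd c ` fst c \<inter> chart_inv c -` S"
    using smooth_surface_chart(5,6,7)[OF assms(1,2)] by force
  then show ?thesis
    using continuous_open_preimage[OF smooth_surface_chart(4,2)[OF assms(1,2)] assms(3)] by simp
qed

lemma overlap_open:
  "smooth_surface \<A> \<Longrightarrow> c \<in> \<A> \<Longrightarrow> d \<in> \<A> \<Longrightarrow> open (overlap c d)"
  by (rule chart_image_open) (auto intro: smooth_surface_chart)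

lemma overlap_chart_inv:
  assumes "smooth_surface \<A>" "c \<in> \<A>" "z \<in> overlap c d"
  shows "chart_inv c z \<in> fst c \<inter> fst d"
  using assms smooth_surface_chart(5)[OF assms(1,2)] by auto

text \<open>Transitions between the new chart and the atlas factor through \<open>d\<close>: towards
  \<open>e\<close> by \<open>K'\<close> followed by that from \<open>d\<close> to \<open>e\<close>,
  and back by that from \<open>e\<close> to \<open>d\<close> followed by \<open>K\<close>.
  Compatibility is thus inherited.\<close>

lemma reparametrised_chart:
  fixes \<A> :: "'m::{t2_space, second_countable_topology} chart set"
  assumes \<A>: "smooth_surface \<A>" and d: "d \<in> \<A>" and N: "open N" "N \<subseteq> snd d ` fst d"
    and K: "smooth_on N K" and K': "smooth_on UNIV K'"
    and inv: "\<forall>z\<in>N. K' (K z) = z" "\<And>u. K' u \<in> N" "\<And>u. K (K' u) = u"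
  defines "c \<equiv> (fst d \<inter> snd d -` N, \<lambda>x. K (snd d x))"
  shows "smooth_surface (insert c \<A>)" "snd c ` fst c = UNIV" "\<And>u. chart_inv c u = chart_inv d (K' u)"
    "\<And>e u. u \<in> overlap c e \<Longrightarrow> K' u \<in> overlap d e"
proof -
  note ch = smooth_surface_chart[OF \<A>] and inv = inv(1)[rule_format] inv(2,3)
  have inc: "chart_inv d (K' u) \<in> fst c" "snd c (chart_inv d (K' u)) = u" for u
  proof -
    have "K' u \<in> snd d ` fst d" using inv(2) N(2) by blast
    note u = ch(6,7)[OF d this]
    show "chart_inv d (K' u) \<in> fst c" "snd c (chart_inv d (K' u)) = u"
      using u inv(2,3) by (simp_all add: c_def)
  qed
  have inj: "inj_on (snd c) (fst c)"
  proof (rule inj_onI)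
    fix x y assume xy: "x \<in> fst c" "y \<in> fst c" "snd c x = snd c y"
    then have "K' (K (snd d x)) = K' (K (snd d y))" by (simp add: c_def)
    moreover have "snd d x \<in> N" "snd d y \<in> N" using xy(1,2) by (simp_all add: c_def)
    ultimately have eq: "snd d x = snd d y" by (simp only: inv(1))
    have "x \<in> fst d" "y \<in> fst d" using xy(1,2) by (simp_all add: c_def)
    note xy' = ch(5)[OF d this(1)] ch(5)[OF d this(2)]
    have "x = chart_inv d (snd d x)" by (rule xy'(1)[symmetric])
    also have "\<dots> = chart_inv d (snd d y)" by (rule arg_cong[OF eq])
    also have "\<dots> = y" by (rule xy'(2))
    finally show "x = y" .
  qed
  show ci: "chart_inv c u = chart_inv d (K' u)" for u
    by (rule inv_into_f_eq[OF inj inc(1) inc(2)])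
  have cif: "chart_inv c = (\<lambda>u. chart_inv d (K' u))" using ci by auto
  have ci': "chart_inv c u \<in> fst c" "snd c (chart_inv c u) = u" for u
    using inc[of u] by (simp_all only: ci)
  have cc': "chart_inv c (snd c x) = x" if "x \<in> fst c" for x
    by (rule inv_into_f_f[OF inj that])
  show im: "snd c ` fst c = UNIV"
    using ci' by (metis UNIV_eq_I image_eqI)
  have ov: "K' u \<in> overlap d e" "chart_inv d (K' u) \<in> fst e" if "u \<in> overlap c e" for e u
  proof -
    obtain x where x: "x \<in> fst c" "x \<in> fst e" "u = snd c x" using \<open>u \<in> overlap c e\<close> by blast
    then have "K' u = snd d x" "x \<in> fst d" using inv(1) by (auto simp: c_def)
    then show "K' u \<in> overlap d e" "chart_inv d (K' u) \<in> fst e" using x(2) ch(5)[OF d] by auto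
  qed
  show "K' u \<in> overlap d e" if "u \<in> overlap c e" for e u by (rule ov(1)[OF that])
  have oc: "open (fst c)"
    unfolding c_def fst_conv by (rule continuous_open_preimage[OF ch(3)[OF d] ch(1)[OF d] N(1)])
  have cc: "continuous_on (fst c) (snd c)"
    unfolding c_def fst_conv snd_conv
    by (rule continuous_on_compose2[OF smooth_on_continuous[OF K] continuous_on_subset[OF ch(3)[OF d]]]) auto
  have cci: "continuous_on UNIV (chart_inv c)"
    unfolding cif
    by (rule continuous_on_compose2[OF ch(4)[OF d] smooth_on_continuous[OF K']]) (use inv(2) N(2) in blast)
  have hom: "homeomorphism (fst c) (snd c ` fst c) (snd c) (chart_inv c)"
  proof -
    have "chart_inv c ` UNIV = fst c"
      using ci'(1) cc' by (metis UNIV_I image_eqI image_subsetI subsetI subset_antisym)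
    then show ?thesis
      unfolding homeomorphism_def im using im cc cci ci' cc' by simp
  qed
  have tcc: "smooth_on (overlap c c) (transition c c)"
  proof -
    have "snd c \<circ> chart_inv c = (\<lambda>u. u)" using ci'(2) by (simp only: o_def)
    then show ?thesis by (simp only: Int_absorb im smooth_on_id[OF open_UNIV])
  qed
  have oce: "open (overlap c e)" if e: "e \<in> \<A>" for e
  proof -
    have "overlap c e = chart_inv c -` (fst c \<inter> fst e)"
    proof (intro set_eqI iffI)
      fix u assume "u \<in> overlap c e"
      then obtain x where "x \<in> fst c" "x \<in> fst e" "u = snd c x" by blast
      then show "u \<in> chart_inv c -` (fst c \<inter> fst e)" using cc'[of x] by simp
    next
      fix u assume "u \<in> chart_inv c -` (fst c \<inter> fst e)"
      then show "u \<in> overlap c e" using ci'(2)[of u] by (metis image_eqI vimage_eq)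
    qed
    then show ?thesis
      using open_vimage[OF open_Int[OF oc ch(1)[OF e]] cci] by simp
  qed
  have tce: "smooth_on (overlap c e) (transition c e)" if e: "e \<in> \<A>" for e
  proof (rule smooth_on_cong[OF _ oce[OF e]])
    show "smooth_on (overlap c e) (\<lambda>u. transition d e (K' u))"
      by (rule smooth_on_compose[OF oce[OF e] _ smooth_on_subset[OF K' subset_UNIV] smooth_surface_transition[OF \<A> d e]])
         (use ov(1) in blast)
  qed (simp add: ci)
  have tec: "smooth_on (overlap e c) (transition e c)" if e: "e \<in> \<A>" for e
  proof -
    have o: "open (overlap e c)" by (rule chart_image_open[OF \<A> e oc])
    have sub: "overlap e c \<subseteq> overlap e d" by (auto simp: c_def)
    have "transition e d ` overlap e c \<subseteq> N"
      using ch(5)[OF e] by (auto simp: c_def)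
    then have "smooth_on (overlap e c) (\<lambda>z. K (transition e d z))"
      by (rule smooth_on_compose[OF o _ smooth_on_subset[OF smooth_surface_transition[OF \<A> e d] sub] K])
    then show ?thesis by (simp add: c_def o_def)
  qed
  show "smooth_surface (insert c \<A>)"
    using \<A> oc im hom tcc tce tec unfolding smooth_surface_def by simp
qed

text \<open>Conformality is arranged inside one chart around \<open>x\<close>; the transformation
  law of the metric carries it to every overlapping chart of the atlas.\<close>

lemma conformal_chart_exists:
  fixes \<A> :: "'m::{t2_space, second_countable_topology} chart set"
  assumes \<A>: "smooth_surface \<A>" and g: "lorentzian_metric \<A> g"
  shows "\<exists>c. conformal_chart \<A> g c \<and> snd c ` fst c = UNIV \<and> x \<in> fst c"
proof -
  obtain d where d: "d \<in> \<A>" "x \<in> fst d"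
    using \<A> unfolding smooth_surface_def by blast
  let ?U = "snd d ` fst d"
  have z0: "snd d x \<in> ?U" using d by simp
  have gd: "\<And>v w. smooth_on ?U (\<lambda>z. g d z v w)" "\<And>z. z \<in> ?U \<Longrightarrow> bilinear (g d z)"
    "\<And>z v w. z \<in> ?U \<Longrightarrow> g d z v w = g d z w v"
    "\<And>z. z \<in> ?U \<Longrightarrow> \<exists>e1 e2. g d z e1 e1 = 1 \<and> g d z e2 e2 = -1 \<and> g d z e1 e2 = 0"
    using g d(1) unfolding lorentzian_metric_def by blast+
  have gde: "g d z v w = g e (transition d e z) (differential (transition d e) z v) (differential (transition d e) z w)"
    if "e \<in> \<A>" "z \<in> overlap d e" for e z v w
    using g d(1) that unfolding lorentzian_metric_def by blast
  obtain e1 e2 where e: "g d (snd d x) e1 e1 = 1" "g d (snd d x) e2 e2 = -1" "g d (snd d x) e1 e2 = 0"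
    using gd(4)[OF z0] by blast
  obtain N K K' \<rho> where N: "open N" "snd d x \<in> N" "N \<subseteq> ?U" and K: "smooth_on N K" and K': "smooth_on UNIV K'"
    and "\<And>z. z \<in> N \<Longrightarrow> K' (K z) = z" and inv: "\<And>u. K' u \<in> N" "\<And>u. K (K' u) = u"
    and \<rho>: "\<And>u. \<rho> u \<noteq> (0 :: real)"
      "\<And>u v w. g d (K' u) (differential K' u v) (differential K' u w) = \<rho> u * da_dahat v w"
    by (rule conformal_plane_coordinates[OF smooth_surface_chart(2)[OF \<A> d(1)] z0 gd(1-3) e]) (assumption | rule that)+
  define c where "c = (fst d \<inter> snd d -` N, \<lambda>x. K (snd d x))"
  have "\<forall>z\<in>N. K' (K z) = z" by (intro ballI) fact
  note rc = reparametrised_chart[OF \<A> d(1) N(1,3) K K' this inv, folded c_def]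
  have "g e (transition c e u) (differential (transition c e) u v) (differential (transition c e) u w) = \<rho> u * da_dahat v w"
    if e: "e \<in> \<A>" and u: "u \<in> overlap c e" for e u v w
  proof -
    have t: "transition c e y = transition d e (K' y)" for y by (simp add: rc(3))
    have K'u: "K' u \<in> overlap d e" by (rule rc(4)[OF u])
    have "differential (transition c e) u v = differential (transition d e) (K' u) (differential K' u v)" for v
      unfolding t[abs_def]
      by (rule differential_compose[OF smooth_on_UNIV_has_derivative[OF K']
            smooth_on_has_derivative[OF smooth_surface_transition[OF \<A> d(1) e] K'u]])
    note dT = this
    show ?thesis
      unfolding dT t gde[OF e K'u, symmetric] by (rule \<rho>(2))
  qed
  then have "conformal_chart \<A> g c"
    unfolding conformal_chart_def using rc(1) \<rho>(1) by blast
  moreover have "x \<in> fst c" using d(2) N(2) by (simp add: c_def)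
  ultimately show ?thesis using rc(2) by blast
qed

text \<open>The isometry is stated in charts of \<open>\<A>\<close>, with which \<open>c\<close> is
  only known to be compatible. Near each point the immersion in \<open>c\<close> is the one in a
  chart of the atlas after a transition, and the factor \<open>\<rho>\<close> of \<open>c\<close> is
  defined by these same transitions.\<close>

lemma conformal_chart_immersion:
  fixes \<A> :: "'m::{t2_space, second_countable_topology} chart set"
  assumes \<A>: "smooth_surface \<A>" and f: "isometric_immersion \<A> g f"
    and c: "conformal_chart \<A> g c" "snd c ` fst c = UNIV"
  obtains \<rho> where "smooth_on UNIV (\<lambda>z. f (chart_inv c z))" "\<And>z. \<rho> z \<noteq> 0"
    "\<And>z v w. induced_metric (\<lambda>z. f (chart_inv c z)) z v w = \<rho> z * da_dahat v w"
proof -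
  define F where "F z = f (chart_inv c z)" for z
  have cA: "smooth_surface (insert c \<A>)" using c(1) unfolding conformal_chart_def by blast
  obtain \<rho> where "\<forall>z \<in> snd c ` fst c. \<rho> z \<noteq> 0 \<and> (\<forall>d\<in>\<A>. z \<in> overlap c d \<longrightarrow> (\<forall>v w.
      g d (transition c d z) (differential (transition c d) z v) (differential (transition c d) z w) = \<rho> z * da_dahat v w))"
    using c(1) unfolding conformal_chart_def by blast
  then have \<rho>: "\<And>z. \<rho> z \<noteq> 0" "\<And>z d v w. d \<in> \<A> \<Longrightarrow> z \<in> overlap c d \<Longrightarrow>
      g d (transition c d z) (differential (transition c d) z v) (differential (transition c d) z w) = \<rho> z * da_dahat v w"
    unfolding c(2) by blast+
  have loc: "\<exists>d\<in>\<A>. z \<in> overlap c d" for z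
  proof -
    have z: "z \<in> snd c ` fst c" using c(2) by simp
    obtain d where "d \<in> \<A>" "chart_inv c z \<in> fst d"
      using \<A> unfolding smooth_surface_def by blast
    then show ?thesis
      using smooth_surface_chart(6,7)[OF cA insertI1 z] by (metis IntI image_eqI)
  qed
  have od: "open (overlap c d)" if "d \<in> \<A>" for d
    by (rule overlap_open[OF cA]) (use that in auto)
  have sT: "smooth_on (overlap c d) (transition c d)" if "d \<in> \<A>" for d
    by (rule smooth_surface_transition[OF cA]) (use that in auto)
  have T: "transition c d z \<in> snd d ` fst d" "f (chart_inv d (transition c d z)) = F z"
    if "d \<in> \<A>" "z \<in> overlap c d" for d z
    using overlap_chart_inv[OF cA insertI1 that(2)] smooth_surface_chart(5)[OF \<A> that(1)]
    by (auto simp: F_def)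
  have sf: "smooth_on (snd d ` fst d) (\<lambda>z. f (chart_inv d z))" if "d \<in> \<A>" for d
    using f that unfolding isometric_immersion_def by (auto simp: o_def)
  have metric: "induced_metric (\<lambda>z. f (chart_inv d z)) y v w = g d y v w"
    if "d \<in> \<A>" "y \<in> snd d ` fst d" for d y v w
    using f that unfolding isometric_immersion_def by (auto simp: o_def)
  have sF: "smooth_on (overlap c d) F" if d: "d \<in> \<A>" for d
  proof (rule smooth_on_cong[OF _ od[OF d]])
    show "smooth_on (overlap c d) (\<lambda>z. f (chart_inv d (transition c d z)))"
      by (rule smooth_on_compose[OF od[OF d] _ sT[OF d] sf[OF d]]) (use T(1)[OF d] in blast)
  qed (rule T(2)[OF d])
  show ?thesis
  proof (rule that[of \<rho>])
    show "smooth_on UNIV (\<lambda>z. f (chart_inv c z))"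
      unfolding F_def[symmetric] using loc od sF by (intro smooth_on_local) blast
    fix z v w
    obtain d where d: "d \<in> \<A>" "z \<in> overlap c d" using loc by blast
    let ?T = "transition c d"
    have dF: "differential F z v = differential (\<lambda>y. f (chart_inv d y)) (?T z) (differential ?T z v)" for v
    proof (rule differential_eqI, rule has_derivative_transform_within_open[OF _ od[OF d(1)] d(2) T(2)[OF d(1)]])
      show "((\<lambda>z. f (chart_inv d (?T z))) has_derivative
          (\<lambda>v. differential (\<lambda>y. f (chart_inv d y)) (?T z) (differential ?T z v))) (at z)"
        by (rule has_derivative_compose[OF smooth_on_has_derivative[OF sT[OF d(1)] d(2)]
              smooth_on_has_derivative[OF sf[OF d(1)] T(1)[OF d]]])
    qed
    have "induced_metric F z v w = induced_metric (\<lambda>y. f (chart_inv d y)) (?T z) (differential ?T z v) (differential ?T z w)"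
      by (simp only: induced_metric_def dF)
    also have "\<dots> = \<rho> z * da_dahat v w"
      unfolding metric[OF d(1) T(1)[OF d]] by (rule \<rho>(2)[OF d])
    finally show "induced_metric (\<lambda>z. f (chart_inv c z)) z v w = \<rho> z * da_dahat v w"
      by (simp only: F_def[abs_def])
  qed (rule \<rho>(1))
qed

text \<open>The formulas force the value 0 at the base point, so the immersion is recovered up to a
  translation, from the same spinors for every base point.\<close>

lemma weierstrass_converse:
  fixes \<A> :: "'m::{t2_space, second_countable_topology} chart set"
  assumes "smooth_surface \<A>" "isometric_immersion \<A> g f" "conformal_chart \<A> g c" "snd c ` fst c = UNIV"
  shows "\<exists>\<phi>1 \<phi>2 \<psi>1 \<psi>2 p q. weierstrass_data \<phi>1 \<phi>2 \<psi>1 \<psi>2 p q \<and>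
    (\<forall>a\<^sub>0. weierstrass_formulas a\<^sub>0 \<phi>1 \<phi>2 \<psi>1 \<psi>2 (\<lambda>z. f (chart_inv c z) - f (chart_inv c a\<^sub>0)))"
proof -
  obtain \<rho> where F: "smooth_on UNIV (\<lambda>z. f (chart_inv c z))" and \<rho>: "\<And>z. \<rho> z \<noteq> 0"
    and conf: "\<And>z v w. induced_metric (\<lambda>z. f (chart_inv c z)) z v w = \<rho> z * da_dahat v w"
    by (rule conformal_chart_immersion[OF assms]) blast
  obtain \<phi>1 \<phi>2 \<psi>1 \<psi>2 p q where data: "weierstrass_data \<phi>1 \<phi>2 \<psi>1 \<psi>2 p q"
    and d: "\<And>z. ((\<lambda>z. f (chart_inv c z)) has_derivative spinor_differential \<phi>1 \<phi>2 \<psi>1 \<psi>2 z) (at z)"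
    by (rule conformal_immersion_spinors[OF F conf \<rho>]) blast
  have "weierstrass_formulas a\<^sub>0 \<phi>1 \<phi>2 \<psi>1 \<psi>2 (\<lambda>z. f (chart_inv c z) - f (chart_inv c a\<^sub>0))" for a\<^sub>0
    by (rule weierstrass_formulas_primitive) (use has_derivative_diff[OF d has_derivative_const] in simp_all)
  then show ?thesis using data by blast
qed

theorem theorem1:
  shows "(\<forall>\<phi>1 \<phi>2 \<psi>1 \<psi>2 p q a\<^sub>0. weierstrass_data \<phi>1 \<phi>2 \<psi>1 \<psi>2 p q \<longrightarrow>
      (\<exists>!F. weierstrass_formulas a\<^sub>0 \<phi>1 \<phi>2 \<psi>1 \<psi>2 F) \<and>
      (\<forall>F. weierstrass_formulas a\<^sub>0 \<phi>1 \<phi>2 \<psi>1 \<psi>2 F \<longrightarrow>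
        conformal_immersion F \<and>
        (\<forall>z v w. induced_metric F z v w =
          - lsq (\<psi>2 z * \<phi>1 z - \<psi>1 z * \<phi>2 z) * da_dahat v w) \<and>
        (\<forall>z. inner22 (mean_curvature F z) (mean_curvature F z) =
          4 * p z * q z / lsq (\<psi>2 z * \<phi>1 z - \<psi>1 z * \<phi>2 z))))
    \<and>
    (\<forall>(\<A> :: 'm::{t2_space, second_countable_topology} chart set) g f.
      smooth_surface \<A> \<and> simply_connected (UNIV :: 'm set) \<and>
      lorentzian_metric \<A> g \<and> isometric_immersion \<A> g f \<longrightarrow>
        (\<forall>x. \<exists>c. conformal_chart \<A> g c \<and> snd c ` fst c = UNIV \<and> x \<in> fst c) \<and>
        (\<forall>c. conformal_chart \<A> g c \<and> snd c ` fst c = UNIV \<longrightarrow>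
          (\<exists>\<phi>1 \<phi>2 \<psi>1 \<psi>2 p q. weierstrass_data \<phi>1 \<phi>2 \<psi>1 \<psi>2 p q \<and>
            (\<forall>a\<^sub>0. weierstrass_formulas a\<^sub>0 \<phi>1 \<phi>2 \<psi>1 \<psi>2
              (\<lambda>z. f (chart_inv c z) - f (chart_inv c a\<^sub>0))))))"
proof (rule conjI, goal_cases)
  case 1
  show ?case by (intro allI impI conjI[OF weierstrass_direct(1)] weierstrass_direct(2))
next
  case 2
  show ?case using conformal_chart_exists weierstrass_converse by blast
qed

end
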